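(* Let $\mathcal{D}(prog)$ be a definition $\{\forall\bar x_1[prog\,A_1\,G_1\triangleq\top],\ldots,\forall\bar x_n[prog\,A_n\,G_n\triangleq\top]\}$ ($n\ge 0$), and let $\mathcal{P}$ be the corresponding intuitionistic theory, i.e. the set of formulas $\bigwedge\bar x_i(G_i^\circ\Rightarrow A_i^\circ)$ for $i\in\{1,\ldots,n\}$. Let $\mathcal{D}$ be a definition extending $\mathcal{D}(nat)\cup\mathcal{D}_{list}(atm)\cup\mathcal{D}(intuit)\cup\mathcal{D}(prog)$ with clauses that do not define $nat$, $seq$, $element$, or $prog$. Then for $L: atmlst$ and $B: prp$, the sequent $\longrightarrow\ \vdash_L B$ is derivable in $FO\lambda^{\Delta\mathbb{N}}$ with definition $\mathcal{D}$ if and only if $B^\circ$ is an intuitionistic consequence of $L^\circ\cup\mathcal{P}$.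
   Context: $FO\lambda^{\Delta\mathbb{N}}$ is the following intuitionistic sequent calculus. Terms are simply typed $\lambda$-terms (up to $\alpha\beta\eta$-conversion) over a signature of typed constants; $o$ is the type of formulas, and quantifiers range only over types not containing $o$. Formulas are built from atomic formulas with $\bot,\top,\land,\lor,\supset,\forall,\exists$. There is a type $nt$ with constants $z:nt$, $s:nt\to nt$ and a predicate $nat: nt\to o$. Sequents are $\Gamma\longrightarrow B$, $\Gamma$ a finite multiset. Rules: $\bot,\Gamma\longrightarrow B$ and $\Gamma\longrightarrow\top$ are axioms; the usual intuitionistic left and right rules for $\land,\lor,\supset,\forall,\exists$ (with the usual eigenvariable conditions); initial sequents $A,\Gamma\longrightarrow A$ for atomic $A$; left contraction; cut. For $nat$: $\Gamma\longrightarrow nat\,z$; from $\Gamma\longrightarrow nat\,I$ infer $\Gamma\longrightarrow nat\,(s\,I)$; induction: for $B:nt\to o$ and eigenvariable $j$ not free in $B$, from $\longrightarrow B\,z$, $B\,j\longrightarrow B\,(s\,j)$, $B\,I,\Gamma\longrightarrow C$ infer $nat\,I,\Gamma\longrightarrow C$. Relative to a definition (set of clauses $\forall\bar x[p\,\bar t\triangleq B]$, free variables of $B$ occurring in $\bar t$, satisfying a level condition): right rule: from $\Gamma\longrightarrow B\theta$ infer $\Gamma\longrightarrow p\,\bar u$ when $p\,\bar u=(p\,\bar t)\theta$; left rule: infer $p\,\bar u,\Gamma\longrightarrow C$ from the premises $B\theta,\Gamma\theta\longrightarrow C\theta$ for every clause (renamed apart) and every $\theta$ in a complete set of unifiers of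 $p\,\bar u$ and $p\,\bar t$. $\mathcal{D}(nat)$: predicates $=,<,\le: nt\to nt\to o$, $sum: nt\to nt\to nt\to o$; clauses $I=I\triangleq\top$; $sum\,z\,J\,J\triangleq nat\,J$; $sum\,(s\,I)\,J\,(s\,K)\triangleq sum\,I\,J\,K$; $z<(s\,J)\triangleq nat\,J$; $(s\,I)<(s\,J)\triangleq I<J$; $I\le I\triangleq\top$; $I\le J\triangleq I<J$. Object logic: types $i$ (object terms), $atm$ (atoms), $prp$ (goal formulas), constants $\langle\cdot\rangle: atm\to prp$, $tt: prp$, $\&: prp\to prp\to prp$, $\Rightarrow: atm\to prp\to prp$, $\bigwedge: (i\to prp)\to prp$; object predicates are constants producing terms of type $atm$. $atmlst$ is the list type over $atm$ with $nil$ and infix $::$. $\mathcal{D}_{list}(atm)$ has clauses $length\,nil\,z\triangleq\top$; $length\,(X::L)\,(s\,I)\triangleq length\,L\,I$; $list\,L\triangleq\exists i(nat\,i\land length\,L\,i)$; $element\,X\,(X::L)\triangleq\top$; $element\,X\,(Y::L)\triangleq element\,X\,L$; $split\,nil\,nil\,nil\triangleq\top$; $split\,(X::L_1)\,(X::L_2)\,L_3\triangleq split\,L_1\,L_2\,L_3$; $split\,(X::L_1)\,L_2\,(X::L_3)\triangleq split\,L_1\,L_2\,L_3$; $permute\,nil\,nil\triangleq\top$; $permute\,(X::L_1)\,L_2\triangleq\exists l_{22}(split\,L_2\,(X::nil)\,l_{22}\land permute\,L_1\,l_{22})$. With $prog: atm\to prp\to o$ and $seq: nt\to atmlst\to prp\to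 o$ (first argument written as subscript), $\mathcal{D}(intuit)$ is: $seq_I\,(A'::L)\,\langle A\rangle\triangleq element\,A\,(A'::L)$; $seq_I\,L\,tt\triangleq\top$; $seq_{(s I)}\,L\,(B\,\&\,C)\triangleq seq_I\,L\,B\land seq_I\,L\,C$; $seq_{(s I)}\,L\,(A\Rightarrow B)\triangleq seq_I\,(A::L)\,B$; $seq_{(s I)}\,L\,(\bigwedge B)\triangleq\forall x\,seq_I\,L\,(B\,x)$; $seq_{(s I)}\,L\,\langle A\rangle\triangleq\exists b(prog\,A\,b\land seq_I\,L\,b)$. $\vdash_L B$ abbreviates $\exists i(nat\,i\land seq_i\,L\,B)$. The translation $(\cdot)^\circ$ sends a term of type $prp$ to the intuitionistic formula obtained by reading $\langle A\rangle$ as the atomic formula $A$, $tt$ as truth, $\&$ as conjunction, $\Rightarrow$ as implication and $\bigwedge$ as universal quantification; for $L: atmlst$, $L^\circ$ is the multiset of (translations of) its elements. *)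

theory Defs
  imports "HOL-Library.Multiset"
begin

section \<open>Simply typed terms\<close>

text \<open>
  The type of formulas is not a member of this type, so that the quantifiers below range only over
  types that do not contain it. \<open>TBase\<close> supplies arbitrary further base types.
\<close>

datatype 'b ty = TNt | TI | TAtm | TPrp | TAtmlst | TBase 'b | TFun "'b ty" "'b ty"  (infixr \<open>\<rightarrow>\<^sub>t\<close> 70)

primrec target :: "'b ty \<Rightarrow> 'b ty" where
  "target TNt = TNt"
| "target TI = TI"
| "target TAtm = TAtm"
| "target TPrp = TPrp"
| "target TAtmlst = TAtmlst"
| "target (TBase b) = TBase b"
| "target (a \<rightarrow>\<^sub>t b) = target b"

datatype 'c con =
    CZ | CS
  | CNil | CCons
  | CAtom  \<comment> \<open>\<open>\<langle>\<cdot>\<rangle>\<close>\<close>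
  | CTt
  | CAnd   \<comment> \<open>\<open>&\<close>\<close>
  | CImp   \<comment> \<open>\<open>\<Rightarrow>\<close>\<close>
  | CAll   \<comment> \<open>\<open>\<And>\<close>\<close>
  | CUser 'c

type_synonym ('b, 'c) csig = "'c \<Rightarrow> 'b ty option"

primrec con_ty :: "('b, 'c) csig \<Rightarrow> 'c con \<Rightarrow> 'b ty option" where
  "con_ty cs CZ = Some TNt"
| "con_ty cs CS = Some (TNt \<rightarrow>\<^sub>t TNt)"
| "con_ty cs CNil = Some TAtmlst"
| "con_ty cs CCons = Some (TAtm \<rightarrow>\<^sub>t TAtmlst \<rightarrow>\<^sub>t TAtmlst)"
| "con_ty cs CAtom = Some (TAtm \<rightarrow>\<^sub>t TPrp)"
| "con_ty cs CTt = Some TPrp"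
| "con_ty cs CAnd = Some (TPrp \<rightarrow>\<^sub>t TPrp \<rightarrow>\<^sub>t TPrp)"
| "con_ty cs CImp = Some (TAtm \<rightarrow>\<^sub>t TPrp \<rightarrow>\<^sub>t TPrp)"
| "con_ty cs CAll = Some ((TI \<rightarrow>\<^sub>t TPrp) \<rightarrow>\<^sub>t TPrp)"
| "con_ty cs (CUser c) = cs c"

text \<open>
  Bound variables are de Bruijn indices. Free variables are names that carry their type; there are
  infinitely many of each type.
\<close>

type_synonym 'b var = "nat \<times> 'b ty"

datatype ('b, 'c) tm =
    Bnd nat
  | Var "'b var"
  | Con "'c con"
  | App "('b, 'c) tm" "('b, 'c) tm"  (infixl \<open>\<cdot>\<close> 100)
  | Lam "('b, 'c) tm"

inductive wt :: "('b, 'c) csig \<Rightarrow> 'b ty list \<Rightarrow> ('b, 'c) tm \<Rightarrow> 'b ty \<Rightarrow> bool"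
  for cs :: "('b, 'c) csig" where
  wt_Bnd: "i < length E \<Longrightarrow> wt cs E (Bnd i) (E ! i)"
| wt_Var: "wt cs E (Var (x, a)) a"
| wt_Con: "con_ty cs c = Some a \<Longrightarrow> wt cs E (Con c) a"
| wt_App: "wt cs E t (a \<rightarrow>\<^sub>t b) \<Longrightarrow> wt cs E u a \<Longrightarrow> wt cs E (t \<cdot> u) b"
| wt_Lam: "wt cs (a # E) t b \<Longrightarrow> wt cs E (Lam t) (a \<rightarrow>\<^sub>t b)"

primrec fv :: "('b, 'c) tm \<Rightarrow> 'b var set" where
  "fv (Bnd i) = {}"
| "fv (Var v) = {v}"
| "fv (Con c) = {}"
| "fv (t \<cdot> u) = fv t \<union> fv u"
| "fv (Lam t) = fv t"

primrec lift :: "('b, 'c) tm \<Rightarrow> nat \<Rightarrow> ('b, 'c) tm" where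
  "lift (Bnd i) k = (if i < k then Bnd i else Bnd (Suc i))"
| "lift (Var v) k = Var v"
| "lift (Con c) k = Con c"
| "lift (t \<cdot> u) k = lift t k \<cdot> lift u k"
| "lift (Lam t) k = Lam (lift t (Suc k))"

primrec inst :: "('b, 'c) tm \<Rightarrow> ('b, 'c) tm \<Rightarrow> nat \<Rightarrow> ('b, 'c) tm" where
  "inst (Bnd i) s k = (if k < i then Bnd (i - 1) else if i = k then s else Bnd i)"
| "inst (Var v) s k = Var v"
| "inst (Con c) s k = Con c"
| "inst (t \<cdot> u) s k = inst t s k \<cdot> inst u s k"
| "inst (Lam t) s k = Lam (inst t (lift s 0) (Suc k))"

inductive conv :: "('b, 'c) tm \<Rightarrow> ('b, 'c) tm \<Rightarrow> bool"  (infix \<open>\<approx>\<close> 50) where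
  conv_beta: "Lam t \<cdot> u \<approx> inst t u 0"
| conv_eta: "Lam (lift t 0 \<cdot> Bnd 0) \<approx> t"
| conv_refl: "t \<approx> t"
| conv_sym: "t \<approx> u \<Longrightarrow> u \<approx> t"
| conv_trans: "t \<approx> u \<Longrightarrow> u \<approx> v \<Longrightarrow> t \<approx> v"
| conv_App: "t \<approx> t' \<Longrightarrow> u \<approx> u' \<Longrightarrow> t \<cdot> u \<approx> t' \<cdot> u'"
| conv_Lam: "t \<approx> t' \<Longrightarrow> Lam t \<approx> Lam t'"

primrec is_Lam :: "('b, 'c) tm \<Rightarrow> bool" where
  "is_Lam (Bnd i) = False"
| "is_Lam (Var v) = False"
| "is_Lam (Con c) = False"
| "is_Lam (t \<cdot> u) = False"
| "is_Lam (Lam t) = True"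

primrec normal :: "('b, 'c) tm \<Rightarrow> bool" where
  "normal (Bnd i) = True"
| "normal (Var v) = True"
| "normal (Con c) = True"
| "normal (t \<cdot> u) = (normal t \<and> normal u \<and> \<not> is_Lam t)"
| "normal (Lam t) = (normal t \<and> (\<forall>u. t \<noteq> lift u 0 \<cdot> Bnd 0))"

definition nf :: "('b, 'c) tm \<Rightarrow> ('b, 'c) tm" where
  "nf t = (THE u. t \<approx> u \<and> normal u)"

text \<open>
  Substitutions for free variables. No lifting is needed under \<open>Lam\<close>, since the terms substituted
  have no loose indices by \<open>is_sub\<close>.
\<close>

type_synonym ('b, 'c) sub = "'b var \<Rightarrow> ('b, 'c) tm"

primrec tsub :: "('b, 'c) sub \<Rightarrow> ('b, 'c) tm \<Rightarrow> ('b, 'c) tm" where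
  "tsub \<theta> (Bnd i) = Bnd i"
| "tsub \<theta> (Var v) = \<theta> v"
| "tsub \<theta> (Con c) = Con c"
| "tsub \<theta> (t \<cdot> u) = tsub \<theta> t \<cdot> tsub \<theta> u"
| "tsub \<theta> (Lam t) = Lam (tsub \<theta> t)"

definition is_sub :: "('b, 'c) csig \<Rightarrow> ('b, 'c) sub \<Rightarrow> bool" where
  "is_sub cs \<theta> \<longleftrightarrow> (\<forall>v. wt cs [] (\<theta> v) (snd v)) \<and> finite {v. \<theta> v \<noteq> Var v}"

text \<open>\<open>tbind v t k\<close> turns the free variable \<open>v\<close> into the loose index \<open>k\<close>.\<close>

primrec tbind :: "'b var \<Rightarrow> ('b, 'c) tm \<Rightarrow> nat \<Rightarrow> ('b, 'c) tm" where
  "tbind v (Bnd i) k = (if i < k then Bnd i else Bnd (Suc i))"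
| "tbind v (Var w) k = (if w = v then Bnd k else Var w)"
| "tbind v (Con c) k = Con c"
| "tbind v (t \<cdot> u) k = tbind v t k \<cdot> tbind v u k"
| "tbind v (Lam t) k = Lam (tbind v t (Suc k))"


section \<open>Formulas\<close>

datatype ('b, 'c, 'p) fm =
    Atom 'p "('b, 'c) tm list"
  | Bot
  | Top
  | And "('b, 'c, 'p) fm" "('b, 'c, 'p) fm"
  | Or "('b, 'c, 'p) fm" "('b, 'c, 'p) fm"
  | Imp "('b, 'c, 'p) fm" "('b, 'c, 'p) fm"
  | All "'b ty" "('b, 'c, 'p) fm"
  | Ex "'b ty" "('b, 'c, 'p) fm"

primrec wff ::
  "('b, 'c) csig \<Rightarrow> ('p \<Rightarrow> 'b ty list option) \<Rightarrow> 'b ty list \<Rightarrow> ('b, 'c, 'p) fm \<Rightarrow> bool" where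
  "wff cs ps E (Atom p ts) = (\<exists>as. ps p = Some as \<and> list_all2 (wt cs E) ts as)"
| "wff cs ps E Bot = True"
| "wff cs ps E Top = True"
| "wff cs ps E (And F G) = (wff cs ps E F \<and> wff cs ps E G)"
| "wff cs ps E (Or F G) = (wff cs ps E F \<and> wff cs ps E G)"
| "wff cs ps E (Imp F G) = (wff cs ps E F \<and> wff cs ps E G)"
| "wff cs ps E (All a F) = wff cs ps (a # E) F"
| "wff cs ps E (Ex a F) = wff cs ps (a # E) F"

primrec fm_fv :: "('b, 'c, 'p) fm \<Rightarrow> 'b var set" where
  "fm_fv (Atom p ts) = \<Union> (fv ` set ts)"
| "fm_fv Bot = {}"
| "fm_fv Top = {}"
| "fm_fv (And F G) = fm_fv F \<union> fm_fv G"
| "fm_fv (Or F G) = fm_fv F \<union> fm_fv G"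
| "fm_fv (Imp F G) = fm_fv F \<union> fm_fv G"
| "fm_fv (All a F) = fm_fv F"
| "fm_fv (Ex a F) = fm_fv F"

primrec fm_inst_at :: "('b, 'c, 'p) fm \<Rightarrow> ('b, 'c) tm \<Rightarrow> nat \<Rightarrow> ('b, 'c, 'p) fm" where
  "fm_inst_at (Atom p ts) s k = Atom p (map (\<lambda>t. inst t s k) ts)"
| "fm_inst_at Bot s k = Bot"
| "fm_inst_at Top s k = Top"
| "fm_inst_at (And F G) s k = And (fm_inst_at F s k) (fm_inst_at G s k)"
| "fm_inst_at (Or F G) s k = Or (fm_inst_at F s k) (fm_inst_at G s k)"
| "fm_inst_at (Imp F G) s k = Imp (fm_inst_at F s k) (fm_inst_at G s k)"
| "fm_inst_at (All a F) s k = All a (fm_inst_at F (lift s 0) (Suc k))"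
| "fm_inst_at (Ex a F) s k = Ex a (fm_inst_at F (lift s 0) (Suc k))"

abbreviation fm_inst :: "('b, 'c, 'p) fm \<Rightarrow> ('b, 'c) tm \<Rightarrow> ('b, 'c, 'p) fm"  (\<open>_\<lparr>_\<rparr>\<close> [1000, 0] 1000) where
  "F\<lparr>t\<rparr> \<equiv> fm_inst_at F t 0"

primrec fm_sub :: "('b, 'c) sub \<Rightarrow> ('b, 'c, 'p) fm \<Rightarrow> ('b, 'c, 'p) fm" where
  "fm_sub \<theta> (Atom p ts) = Atom p (map (tsub \<theta>) ts)"
| "fm_sub \<theta> Bot = Bot"
| "fm_sub \<theta> Top = Top"
| "fm_sub \<theta> (And F G) = And (fm_sub \<theta> F) (fm_sub \<theta> G)"
| "fm_sub \<theta> (Or F G) = Or (fm_sub \<theta> F) (fm_sub \<theta> G)"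
| "fm_sub \<theta> (Imp F G) = Imp (fm_sub \<theta> F) (fm_sub \<theta> G)"
| "fm_sub \<theta> (All a F) = All a (fm_sub \<theta> F)"
| "fm_sub \<theta> (Ex a F) = Ex a (fm_sub \<theta> F)"

primrec fm_bind :: "'b var \<Rightarrow> ('b, 'c, 'p) fm \<Rightarrow> nat \<Rightarrow> ('b, 'c, 'p) fm" where
  "fm_bind v (Atom p ts) k = Atom p (map (\<lambda>t. tbind v t k) ts)"
| "fm_bind v Bot k = Bot"
| "fm_bind v Top k = Top"
| "fm_bind v (And F G) k = And (fm_bind v F k) (fm_bind v G k)"
| "fm_bind v (Or F G) k = Or (fm_bind v F k) (fm_bind v G k)"
| "fm_bind v (Imp F G) k = Imp (fm_bind v F k) (fm_bind v G k)"
| "fm_bind v (All a F) k = All a (fm_bind v F (Suc k))"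
| "fm_bind v (Ex a F) k = Ex a (fm_bind v F (Suc k))"

definition close_all :: "'b var list \<Rightarrow> ('b, 'c, 'p) fm \<Rightarrow> ('b, 'c, 'p) fm" where
  "close_all vs F = foldr (\<lambda>v G. All (snd v) (fm_bind v G 0)) vs F"

inductive fm_conv :: "('b, 'c, 'p) fm \<Rightarrow> ('b, 'c, 'p) fm \<Rightarrow> bool" where
  "list_all2 (\<approx>) ts us \<Longrightarrow> fm_conv (Atom p ts) (Atom p us)"
| "fm_conv Bot Bot"
| "fm_conv Top Top"
| "fm_conv F F' \<Longrightarrow> fm_conv G G' \<Longrightarrow> fm_conv (And F G) (And F' G')"
| "fm_conv F F' \<Longrightarrow> fm_conv G G' \<Longrightarrow> fm_conv (Or F G) (Or F' G')"
| "fm_conv F F' \<Longrightarrow> fm_conv G G' \<Longrightarrow> fm_conv (Imp F G) (Imp F' G')"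
| "fm_conv F F' \<Longrightarrow> fm_conv (All a F) (All a F')"
| "fm_conv F F' \<Longrightarrow> fm_conv (Ex a F) (Ex a F')"

primrec level :: "('p \<Rightarrow> nat) \<Rightarrow> ('b, 'c, 'p) fm \<Rightarrow> nat" where
  "level l (Atom p ts) = l p"
| "level l Bot = 0"
| "level l Top = 0"
| "level l (And F G) = max (level l F) (level l G)"
| "level l (Or F G) = max (level l F) (level l G)"
| "level l (Imp F G) = max (Suc (level l F)) (level l G)"
| "level l (All a F) = level l F"
| "level l (Ex a F) = level l F"


section \<open>The sequent calculus with definitions and induction\<close>

datatype 'q prd =
    PNat | PEq | PLt | PLe | PSum
  | PLength | PList | PElement | PSplit | PPermute
  | PProg | PSeq
  | PUser 'q

type_synonym ('b, 'q) psig = "'q \<Rightarrow> 'b ty list option"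

primrec prd_ty :: "('b, 'q) psig \<Rightarrow> 'q prd \<Rightarrow> 'b ty list option" where
  "prd_ty qs PNat = Some [TNt]"
| "prd_ty qs PEq = Some [TNt, TNt]"
| "prd_ty qs PLt = Some [TNt, TNt]"
| "prd_ty qs PLe = Some [TNt, TNt]"
| "prd_ty qs PSum = Some [TNt, TNt, TNt]"
| "prd_ty qs PLength = Some [TAtmlst, TNt]"
| "prd_ty qs PList = Some [TAtmlst]"
| "prd_ty qs PElement = Some [TAtm, TAtmlst]"
| "prd_ty qs PSplit = Some [TAtmlst, TAtmlst, TAtmlst]"
| "prd_ty qs PPermute = Some [TAtmlst, TAtmlst]"
| "prd_ty qs PProg = Some [TAtm, TPrp]"
| "prd_ty qs PSeq = Some [TNt, TAtmlst, TPrp]"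
| "prd_ty qs (PUser q) = qs q"

type_synonym ('b, 'c, 'q) form = "('b, 'c, 'q prd) fm"

text \<open>The variables quantified by a clause are the free variables of its head.\<close>

datatype ('b, 'c, 'q) clause =
  Clause (cprd: "'q prd") (cargs: "('b, 'c) tm list") (cbody: "('b, 'c, 'q) form")

definition chead :: "('b, 'c, 'q) clause \<Rightarrow> ('b, 'c, 'q) form" where
  "chead c = Atom (cprd c) (cargs c)"

definition cfv :: "('b, 'c, 'q) clause \<Rightarrow> 'b var set" where
  "cfv c = fm_fv (chead c) \<union> fm_fv (cbody c)"

text \<open>
  \<open>nat\<close> has its own rules and is not subject to definition. Occurrence in the arguments is tested on
  normal forms, since terms are identified up to conversion.
\<close>

definition is_definition ::
  "('b, 'c) csig \<Rightarrow> ('b, 'q) psig \<Rightarrow> ('b, 'c, 'q) clause set \<Rightarrow> bool" where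
  "is_definition cs qs D \<longleftrightarrow>
     (\<forall>c \<in> D. cprd c \<noteq> PNat \<and>
        wff cs (prd_ty qs) [] (chead c) \<and> wff cs (prd_ty qs) [] (cbody c) \<and>
        fm_fv (cbody c) \<subseteq> (\<Union>t \<in> set (cargs c). fv (nf t))) \<and>
     (\<exists>l. \<forall>c \<in> D. level l (cbody c) \<le> l (cprd c))"

definition is_variant :: "('b, 'c, 'q) clause \<Rightarrow> ('b, 'c, 'q) clause \<Rightarrow> bool" where
  "is_variant c c' \<longleftrightarrow>
     (\<exists>\<rho>. inj_on \<rho> (cfv c) \<and> (\<forall>v. snd (\<rho> v) = snd v) \<and>
        c' = Clause (cprd c) (map (tsub (Var \<circ> \<rho>)) (cargs c)) (fm_sub (Var \<circ> \<rho>) (cbody c)))"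

definition unifier ::
  "('b, 'c) csig \<Rightarrow> ('b, 'c, 'p) fm \<Rightarrow> ('b, 'c, 'p) fm \<Rightarrow> ('b, 'c) sub \<Rightarrow> bool" where
  "unifier cs F G \<theta> \<longleftrightarrow> is_sub cs \<theta> \<and> fm_conv (fm_sub \<theta> F) (fm_sub \<theta> G)"

definition is_csu ::
  "('b, 'c) csig \<Rightarrow> ('b, 'c, 'p) fm \<Rightarrow> ('b, 'c, 'p) fm \<Rightarrow> ('b, 'c) sub set \<Rightarrow> bool" where
  "is_csu cs F G U \<longleftrightarrow>
     (\<forall>\<theta> \<in> U. unifier cs F G \<theta>) \<and>
     (\<forall>\<sigma>. unifier cs F G \<sigma> \<longrightarrow>
        (\<exists>\<theta> \<in> U. \<exists>\<delta>. is_sub cs \<delta> \<and> (\<forall>v. \<sigma> v \<approx> tsub \<delta> (\<theta> v))))"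

definition mfv :: "('b, 'c, 'p) fm multiset \<Rightarrow> 'b var set" where
  "mfv \<Gamma> = (\<Union>F \<in> set_mset \<Gamma>. fm_fv F)"

definition wf_seq ::
  "('b, 'c) csig \<Rightarrow> ('b, 'q) psig \<Rightarrow> ('b, 'c, 'q) form multiset \<Rightarrow> ('b, 'c, 'q) form \<Rightarrow> bool" where
  "wf_seq cs qs \<Gamma> B \<longleftrightarrow> (\<forall>F \<in># \<Gamma>. wff cs (prd_ty qs) [] F) \<and> wff cs (prd_ty qs) [] B"

abbreviation zero :: "('b, 'c) tm" where "zero \<equiv> Con CZ"
abbreviation succ :: "('b, 'c) tm \<Rightarrow> ('b, 'c) tm" where "succ t \<equiv> Con CS \<cdot> t"

text \<open>
  The rule \<open>conv\<close> accounts for the identification of terms up to \<open>\<beta>\<eta>\<close>-conversion. In \<open>allL\<close>,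
  \<open>allR\<close>, \<open>exL\<close>, \<open>exR\<close> and \<open>natL\<close> the formula \<open>B\<close> has one loose index and stands for an
  abstraction. In \<open>defL\<close>, \<open>ren\<close> picks the renamed clauses and \<open>U\<close> the complete sets of unifiers.
\<close>

inductive derivable ::
  "('b, 'c) csig \<Rightarrow> ('b, 'q) psig \<Rightarrow> ('b, 'c, 'q) clause set \<Rightarrow>
   ('b, 'c, 'q) form multiset \<Rightarrow> ('b, 'c, 'q) form \<Rightarrow> bool"
  for cs :: "('b, 'c) csig" and qs :: "('b, 'q) psig" and D :: "('b, 'c, 'q) clause set" where
  conv:
    "derivable cs qs D \<Gamma> B \<Longrightarrow> rel_mset fm_conv \<Gamma> \<Gamma>' \<Longrightarrow> fm_conv B B' \<Longrightarrow> wf_seq cs qs \<Gamma>' B' \<Longrightarrow>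
     derivable cs qs D \<Gamma>' B'"
| init:
    "wf_seq cs qs (add_mset (Atom p ts) \<Gamma>) (Atom p ts) \<Longrightarrow>
     derivable cs qs D (add_mset (Atom p ts) \<Gamma>) (Atom p ts)"
| contrL:
    "derivable cs qs D (add_mset B (add_mset B \<Gamma>)) C \<Longrightarrow> derivable cs qs D (add_mset B \<Gamma>) C"
| cut:
    "derivable cs qs D \<Delta> B \<Longrightarrow> derivable cs qs D (add_mset B \<Gamma>) C \<Longrightarrow> derivable cs qs D (\<Delta> + \<Gamma>) C"
| botL:
    "wf_seq cs qs (add_mset Bot \<Gamma>) B \<Longrightarrow> derivable cs qs D (add_mset Bot \<Gamma>) B"
| topR:
    "wf_seq cs qs \<Gamma> Top \<Longrightarrow> derivable cs qs D \<Gamma> Top"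
| andL1:
    "derivable cs qs D (add_mset B \<Gamma>) E \<Longrightarrow> wf_seq cs qs (add_mset (And B C) \<Gamma>) E \<Longrightarrow>
     derivable cs qs D (add_mset (And B C) \<Gamma>) E"
| andL2:
    "derivable cs qs D (add_mset C \<Gamma>) E \<Longrightarrow> wf_seq cs qs (add_mset (And B C) \<Gamma>) E \<Longrightarrow>
     derivable cs qs D (add_mset (And B C) \<Gamma>) E"
| andR:
    "derivable cs qs D \<Gamma> B \<Longrightarrow> derivable cs qs D \<Gamma> C \<Longrightarrow> derivable cs qs D \<Gamma> (And B C)"
| orL:
    "derivable cs qs D (add_mset B \<Gamma>) E \<Longrightarrow> derivable cs qs D (add_mset C \<Gamma>) E \<Longrightarrow>
     derivable cs qs D (add_mset (Or B C) \<Gamma>) E"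
| orR1:
    "derivable cs qs D \<Gamma> B \<Longrightarrow> wf_seq cs qs \<Gamma> (Or B C) \<Longrightarrow> derivable cs qs D \<Gamma> (Or B C)"
| orR2:
    "derivable cs qs D \<Gamma> C \<Longrightarrow> wf_seq cs qs \<Gamma> (Or B C) \<Longrightarrow> derivable cs qs D \<Gamma> (Or B C)"
| impL:
    "derivable cs qs D \<Gamma> B \<Longrightarrow> derivable cs qs D (add_mset C \<Gamma>) E \<Longrightarrow>
     derivable cs qs D (add_mset (Imp B C) \<Gamma>) E"
| impR:
    "derivable cs qs D (add_mset B \<Gamma>) C \<Longrightarrow> derivable cs qs D \<Gamma> (Imp B C)"
| allL:
    "wt cs [] t a \<Longrightarrow> derivable cs qs D (add_mset B\<lparr>t\<rparr> \<Gamma>) C \<Longrightarrow>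
     wf_seq cs qs (add_mset (All a B) \<Gamma>) C \<Longrightarrow>
     derivable cs qs D (add_mset (All a B) \<Gamma>) C"
| allR:
    "derivable cs qs D \<Gamma> B\<lparr>Var (y, a)\<rparr> \<Longrightarrow> (y, a) \<notin> mfv \<Gamma> \<union> fm_fv B \<Longrightarrow>
     wf_seq cs qs \<Gamma> (All a B) \<Longrightarrow>
     derivable cs qs D \<Gamma> (All a B)"
| exL:
    "derivable cs qs D (add_mset B\<lparr>Var (y, a)\<rparr> \<Gamma>) C \<Longrightarrow>
     (y, a) \<notin> mfv \<Gamma> \<union> fm_fv B \<union> fm_fv C \<Longrightarrow>
     wf_seq cs qs (add_mset (Ex a B) \<Gamma>) C \<Longrightarrow>
     derivable cs qs D (add_mset (Ex a B) \<Gamma>) C"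
| exR:
    "wt cs [] t a \<Longrightarrow> derivable cs qs D \<Gamma> B\<lparr>t\<rparr> \<Longrightarrow> wf_seq cs qs \<Gamma> (Ex a B) \<Longrightarrow>
     derivable cs qs D \<Gamma> (Ex a B)"
| natZ:
    "wf_seq cs qs \<Gamma> (Atom PNat [zero]) \<Longrightarrow> derivable cs qs D \<Gamma> (Atom PNat [zero])"
| natS:
    "derivable cs qs D \<Gamma> (Atom PNat [t]) \<Longrightarrow> derivable cs qs D \<Gamma> (Atom PNat [succ t])"
| natL:
    "wff cs (prd_ty qs) [TNt] B \<Longrightarrow>
     derivable cs qs D {#} B\<lparr>zero\<rparr> \<Longrightarrow>
     derivable cs qs D {# B\<lparr>Var (j, TNt)\<rparr> #} B\<lparr>succ (Var (j, TNt))\<rparr> \<Longrightarrow>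
     (j, TNt) \<notin> fm_fv B \<Longrightarrow>
     derivable cs qs D (add_mset B\<lparr>t\<rparr> \<Gamma>) C \<Longrightarrow>
     wf_seq cs qs (add_mset (Atom PNat [t]) \<Gamma>) C \<Longrightarrow>
     derivable cs qs D (add_mset (Atom PNat [t]) \<Gamma>) C"
| defR:
    "c \<in> D \<Longrightarrow> is_sub cs \<theta> \<Longrightarrow> fm_conv (Atom p us) (fm_sub \<theta> (chead c)) \<Longrightarrow>
     derivable cs qs D \<Gamma> (fm_sub \<theta> (cbody c)) \<Longrightarrow> wf_seq cs qs \<Gamma> (Atom p us) \<Longrightarrow>
     derivable cs qs D \<Gamma> (Atom p us)"
| defL:
    "p \<noteq> PNat \<Longrightarrow> wf_seq cs qs (add_mset (Atom p us) \<Gamma>) C \<Longrightarrow>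
     (\<And>c. c \<in> D \<Longrightarrow> is_variant c (ren c)) \<Longrightarrow>
     (\<And>c. c \<in> D \<Longrightarrow> cfv (ren c) \<inter> (mfv (add_mset (Atom p us) \<Gamma>) \<union> fm_fv C) = {}) \<Longrightarrow>
     (\<And>c. c \<in> D \<Longrightarrow> is_csu cs (Atom p us) (chead (ren c)) (U c)) \<Longrightarrow>
     (\<And>c \<theta>. c \<in> D \<Longrightarrow> \<theta> \<in> U c \<Longrightarrow>
        derivable cs qs D
          (add_mset (fm_sub \<theta> (cbody (ren c))) (image_mset (fm_sub \<theta>) \<Gamma>)) (fm_sub \<theta> C)) \<Longrightarrow>
     derivable cs qs D (add_mset (Atom p us) \<Gamma>) C"


section \<open>The definitions\<close>

abbreviation lnil :: "('b, 'c) tm" where "lnil \<equiv> Con CNil"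
abbreviation lcons :: "('b, 'c) tm \<Rightarrow> ('b, 'c) tm \<Rightarrow> ('b, 'c) tm" where
  "lcons t u \<equiv> Con CCons \<cdot> t \<cdot> u"

definition D_nat :: "('b, 'c, 'q) clause set" where
  "D_nat =
    (let I = Var (0, TNt); J = Var (1, TNt); K = Var (2, TNt) in
     { Clause PEq [I, I] Top,
       Clause PSum [zero, J, J] (Atom PNat [J]),
       Clause PSum [succ I, J, succ K] (Atom PSum [I, J, K]),
       Clause PLt [zero, succ J] (Atom PNat [J]),
       Clause PLt [succ I, succ J] (Atom PLt [I, J]),
       Clause PLe [I, I] Top,
       Clause PLe [I, J] (Atom PLt [I, J]) })"

definition D_list :: "('b, 'c, 'q) clause set" where
  "D_list =
    (let I = Var (0, TNt); X = Var (0, TAtm); Y = Var (1, TAtm);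
         L = Var (0, TAtmlst); L1 = Var (1, TAtmlst); L2 = Var (2, TAtmlst); L3 = Var (3, TAtmlst) in
     { Clause PLength [lnil, zero] Top,
       Clause PLength [lcons X L, succ I] (Atom PLength [L, I]),
       Clause PList [L] (Ex TNt (And (Atom PNat [Bnd 0]) (Atom PLength [L, Bnd 0]))),
       Clause PElement [X, lcons X L] Top,
       Clause PElement [X, lcons Y L] (Atom PElement [X, L]),
       Clause PSplit [lnil, lnil, lnil] Top,
       Clause PSplit [lcons X L1, lcons X L2, L3] (Atom PSplit [L1, L2, L3]),
       Clause PSplit [lcons X L1, L2, lcons X L3] (Atom PSplit [L1, L2, L3]),
       Clause PPermute [lnil, lnil] Top,
       Clause PPermute [lcons X L1, L2]
         (Ex TAtmlst (And (Atom PSplit [L2, lcons X lnil, Bnd 0]) (Atom PPermute [L1, Bnd 0]))) })"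

definition D_intuit :: "('b, 'c, 'q) clause set" where
  "D_intuit =
    (let I = Var (0, TNt); A = Var (0, TAtm); A' = Var (1, TAtm); L = Var (0, TAtmlst);
         B = Var (0, TPrp); C = Var (1, TPrp); F = Var (0, TI \<rightarrow>\<^sub>t TPrp) in
     { Clause PSeq [I, lcons A' L, Con CAtom \<cdot> A] (Atom PElement [A, lcons A' L]),
       Clause PSeq [I, L, Con CTt] Top,
       Clause PSeq [succ I, L, Con CAnd \<cdot> B \<cdot> C] (And (Atom PSeq [I, L, B]) (Atom PSeq [I, L, C])),
       Clause PSeq [succ I, L, Con CImp \<cdot> A \<cdot> B] (Atom PSeq [I, lcons A L, B]),
       Clause PSeq [succ I, L, Con CAll \<cdot> F] (All TI (Atom PSeq [I, L, F \<cdot> Bnd 0])),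
       Clause PSeq [succ I, L, Con CAtom \<cdot> A]
         (Ex TPrp (And (Atom PProg [A, Bnd 0]) (Atom PSeq [I, L, Bnd 0]))) })"

text \<open>A triple \<open>(xs, A, G)\<close> represents the clause \<open>\<forall>xs. prog A G \<triangleq> \<top>\<close>.\<close>

type_synonym ('b, 'c) prog_clause = "'b var list \<times> ('b, 'c) tm \<times> ('b, 'c) tm"

definition D_prog :: "('b, 'c) prog_clause list \<Rightarrow> ('b, 'c, 'q) clause set" where
  "D_prog prg = {Clause PProg [A, G] Top |xs A G. (xs, A, G) \<in> set prg}"

definition base_def :: "('b, 'c) prog_clause list \<Rightarrow> ('b, 'c, 'q) clause set" where
  "base_def prg = D_nat \<union> D_list \<union> D_intuit \<union> D_prog prg"

definition entails :: "('b, 'c) tm \<Rightarrow> ('b, 'c) tm \<Rightarrow> ('b, 'c, 'q) form" where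
  "entails L B = Ex TNt (And (Atom PNat [Bnd 0]) (Atom PSeq [Bnd 0, lift L 0, lift B 0]))"


section \<open>Object-level intuitionistic logic\<close>

text \<open>
  The atomic formulas of the object logic are the terms of type \<open>TAtm\<close>, written \<open>Atom () [A]\<close>.
\<close>

type_synonym ('b, 'c) ofm = "('b, 'c, unit) fm"

abbreviation oatom :: "('b, 'c) tm \<Rightarrow> ('b, 'c) ofm" where "oatom A \<equiv> Atom () [A]"

abbreviation owff :: "('b, 'c) csig \<Rightarrow> 'b ty list \<Rightarrow> ('b, 'c) ofm \<Rightarrow> bool" where
  "owff cs \<equiv> wff cs (\<lambda>_. Some [TAtm])"

inductive nj :: "('b, 'c) csig \<Rightarrow> ('b, 'c) ofm set \<Rightarrow> ('b, 'c) ofm \<Rightarrow> bool"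
  for cs :: "('b, 'c) csig" where
  nj_assm: "F \<in> \<Gamma> \<Longrightarrow> \<forall>G \<in> \<Gamma>. owff cs [] G \<Longrightarrow> nj cs \<Gamma> F"
| nj_conv: "nj cs \<Gamma> F \<Longrightarrow> fm_conv F G \<Longrightarrow> owff cs [] G \<Longrightarrow> nj cs \<Gamma> G"
| nj_topI: "\<forall>G \<in> \<Gamma>. owff cs [] G \<Longrightarrow> nj cs \<Gamma> Top"
| nj_botE: "nj cs \<Gamma> Bot \<Longrightarrow> owff cs [] F \<Longrightarrow> nj cs \<Gamma> F"
| nj_andI: "nj cs \<Gamma> F \<Longrightarrow> nj cs \<Gamma> G \<Longrightarrow> nj cs \<Gamma> (And F G)"
| nj_andE1: "nj cs \<Gamma> (And F G) \<Longrightarrow> nj cs \<Gamma> F"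
| nj_andE2: "nj cs \<Gamma> (And F G) \<Longrightarrow> nj cs \<Gamma> G"
| nj_orI1: "nj cs \<Gamma> F \<Longrightarrow> owff cs [] G \<Longrightarrow> nj cs \<Gamma> (Or F G)"
| nj_orI2: "nj cs \<Gamma> G \<Longrightarrow> owff cs [] F \<Longrightarrow> nj cs \<Gamma> (Or F G)"
| nj_orE:
    "nj cs \<Gamma> (Or F G) \<Longrightarrow> nj cs (insert F \<Gamma>) H \<Longrightarrow> nj cs (insert G \<Gamma>) H \<Longrightarrow> nj cs \<Gamma> H"
| nj_impI: "nj cs (insert F \<Gamma>) G \<Longrightarrow> nj cs \<Gamma> (Imp F G)"
| nj_impE: "nj cs \<Gamma> (Imp F G) \<Longrightarrow> nj cs \<Gamma> F \<Longrightarrow> nj cs \<Gamma> G"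
| nj_allI:
    "nj cs \<Gamma> F\<lparr>Var (y, a)\<rparr> \<Longrightarrow> (y, a) \<notin> \<Union> (fm_fv ` \<Gamma>) \<union> fm_fv F \<Longrightarrow> owff cs [a] F \<Longrightarrow>
     nj cs \<Gamma> (All a F)"
| nj_allE: "nj cs \<Gamma> (All a F) \<Longrightarrow> wt cs [] t a \<Longrightarrow> nj cs \<Gamma> F\<lparr>t\<rparr>"
| nj_exI: "nj cs \<Gamma> F\<lparr>t\<rparr> \<Longrightarrow> wt cs [] t a \<Longrightarrow> owff cs [a] F \<Longrightarrow> nj cs \<Gamma> (Ex a F)"
| nj_exE:
    "nj cs \<Gamma> (Ex a F) \<Longrightarrow> nj cs (insert F\<lparr>Var (y, a)\<rparr> \<Gamma>) G \<Longrightarrow>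
     (y, a) \<notin> \<Union> (fm_fv ` \<Gamma>) \<union> fm_fv F \<union> fm_fv G \<Longrightarrow>
     nj cs \<Gamma> G"

definition int_consequence :: "('b, 'c) csig \<Rightarrow> ('b, 'c) ofm set \<Rightarrow> ('b, 'c) ofm \<Rightarrow> bool" where
  "int_consequence cs T F \<longleftrightarrow> (\<exists>\<Gamma> \<subseteq> T. finite \<Gamma> \<and> nj cs \<Gamma> F)"

text \<open>
  The translation is read off the \<open>\<beta>\<eta>\<close>-normal form. The default cases do not arise for normal
  terms of type \<open>TPrp\<close> and \<open>TAtmlst\<close> whose user constants and free variables are
  \<open>object_level_ty\<close>; in particular the argument of \<open>CAll\<close> is then an abstraction.
\<close>

fun prp_trans_nf :: "('b, 'c) tm \<Rightarrow> ('b, 'c) ofm" where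
  "prp_trans_nf (Con CAtom \<cdot> A) = oatom A"
| "prp_trans_nf (Con CTt) = Top"
| "prp_trans_nf (Con CAnd \<cdot> B \<cdot> C) = And (prp_trans_nf B) (prp_trans_nf C)"
| "prp_trans_nf (Con CImp \<cdot> A \<cdot> B) = Imp (oatom A) (prp_trans_nf B)"
| "prp_trans_nf (Con CAll \<cdot> Lam B) = All TI (prp_trans_nf B)"
| "prp_trans_nf _ = undefined"

definition prp_trans :: "('b, 'c) tm \<Rightarrow> ('b, 'c) ofm" where
  "prp_trans B = prp_trans_nf (nf B)"

fun lst_trans_nf :: "('b, 'c) tm \<Rightarrow> ('b, 'c) ofm multiset" where
  "lst_trans_nf (Con CNil) = {#}"
| "lst_trans_nf (Con CCons \<cdot> A \<cdot> L) = add_mset (oatom A) (lst_trans_nf L)"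
| "lst_trans_nf _ = undefined"

definition lst_trans :: "('b, 'c) tm \<Rightarrow> ('b, 'c) ofm multiset" where
  "lst_trans L = lst_trans_nf (nf L)"

definition prog_theory :: "('b, 'c) prog_clause list \<Rightarrow> ('b, 'c) ofm set" where
  "prog_theory prg = {close_all xs (Imp (prp_trans G) (oatom A)) |xs A G. (xs, A, G) \<in> set prg}"

text \<open>
  The constants given above are the only constructors of goal formulas and atom lists. Free variables
  of object-level expressions do not stand for (functions into) goal formulas or atom lists either;
  otherwise the translation would make no sense.
\<close>

definition object_level_ty :: "'b ty \<Rightarrow> bool" where
  "object_level_ty a \<longleftrightarrow> target a \<noteq> TPrp \<and> target a \<noteq> TAtmlst"

definition object_sig :: "('b, 'c) csig \<Rightarrow> bool" where
  "object_sig cs \<longleftrightarrow> (\<forall>c a. cs c = Some a \<longrightarrow> object_level_ty a)"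

definition object_term :: "('b, 'c) csig \<Rightarrow> ('b, 'c) tm \<Rightarrow> 'b ty \<Rightarrow> bool" where
  "object_term cs t a \<longleftrightarrow> wt cs [] t a \<and> (\<forall>v \<in> fv t. object_level_ty (snd v))"

definition is_prog_clause :: "('b, 'c) csig \<Rightarrow> ('b, 'c) prog_clause \<Rightarrow> bool" where
  "is_prog_clause cs = (\<lambda>(xs, A, G).
     object_term cs A TAtm \<and> object_term cs G TPrp \<and> fv A \<union> fv G \<subseteq> set xs)"

end

theory Submission
  imports Defs
begin

text \<open>
  Neither direction needs cut elimination.

  If \<open>\<turnstile>\<^sub>L B\<close> is derivable, it is true in every model of the definition whose domain consists of the
  (open) terms up to conversion, free variables denoting themselves: a stratified least fixed point
  of the clauses is such a model, and all rules including induction and definitional reflection are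
  classically sound in it. There \<open>nat\<close> holds of the numerals only, so that truth of \<open>seq\<^sub>n L B\<close>
  unfolds, by induction on \<open>n\<close>, to a natural deduction proof.

  Conversely, take the Kripke model whose worlds are the atom contexts and in which an atom is
  forced if it has a backchaining proof. It forces the program, and a goal formula forced at \<open>L\<close> has a
  backchaining proof from \<open>L\<close>, which is mirrored by the clauses for \<open>seq\<close>.

  Both directions analyse terms up to \<open>\<beta>\<eta>\<close>-conversion, which requires confluence for untyped and weak
  normalization for typed terms.
\<close>

section \<open>Lifting, instantiation and substitution\<close>

text \<open>Classical truth yields intuitionistic proofs because the clause bodies for
  \<open>seq\<close>, \<open>element\<close> and \<open>prog\<close> contain no implication: an
  object-level implication becomes a longer atom list, so unfolding a true \<open>seq\<close> atom
  produces introduction rules and backchaining steps only. Open terms are in the domain for the sake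
  of the universal quantifier: a true universal statement has an instance at a fresh variable, and
  this instance is the premise of the eigenvariable rule. The same device returns in the converse
  direction, where it selects one premise out of infinitely many. The derivations built for the
  converse have empty antecedents and consist of right rules and conversion steps. The further
  clauses of \<open>D\<close> therefore matter in one direction only: they may contain implications,
  and the model has to satisfy them all for \<open>defL\<close> to be sound. Conversion relates
  untyped terms, so a chain between two typed terms may pass through untypable ones; hence
  confluence is proved without types. Typed terms need normal forms because \<open>prp_trans\<close>
  and \<open>lst_trans\<close> are read off these.\<close>

lemma lift_lift: "i \<le> k \<Longrightarrow> lift (lift t i) (Suc k) = lift (lift t k) i"
  by (induction t arbitrary: i k) auto

lemma inst_lift [simp]: "inst (lift t k) s k = t"
  by (induction t arbitrary: s k) auto

lemma lift_inst_le: "j \<le> i \<Longrightarrow> lift (inst t s j) i = inst (lift t (Suc i)) (lift s i) j"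
  by (induction t arbitrary: i j s) (auto simp: lift_lift)

lemma lift_inst_ge: "i \<le> j \<Longrightarrow> lift (inst t s j) i = inst (lift t i) (lift s i) (Suc j)"
  by (induction t arbitrary: i j s) (auto simp: lift_lift)

lemma inst_inst:
  "i \<le> j \<Longrightarrow> inst (inst t (lift v i) (Suc j)) (inst u v j) i = inst (inst t u i) v j"
  by (induction t arbitrary: i j u v) (auto simp: lift_lift[symmetric] lift_inst_ge)

lemma inst_Suc_lift_Bnd [simp]: "inst (lift t (Suc k)) (Bnd k) k = t"
  by (induction t arbitrary: k) auto

primrec tmsize :: "('b, 'c) tm \<Rightarrow> nat" where
  "tmsize (Bnd i) = 1"
| "tmsize (Var v) = 1"
| "tmsize (Con c) = 1"
| "tmsize (t \<cdot> u) = Suc (tmsize t + tmsize u)"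
| "tmsize (Lam t) = Suc (tmsize t)"

lemma tmsize_lift [simp]: "tmsize (lift t k) = tmsize t"
  by (induction t arbitrary: k) auto

lemma tmsize_inst_Var [simp]: "tmsize (inst t (Var v) k) = tmsize t"
  by (induction t arbitrary: k) auto

lemma fv_lift [simp]: "fv (lift t k) = fv t"
  by (induction t arbitrary: k) auto

lemma finite_fv [simp]: "finite (fv t)"
  by (induction t) auto

lemma fv_inst: "fv (inst t s k) \<subseteq> fv t \<union> fv s"
proof (induction t arbitrary: s k)
  case (Lam t)
  then show ?case using Lam[of "lift s 0"] by simp
qed (auto, blast)

lemma lift_inj [simp]: "lift t k = lift u k \<longleftrightarrow> t = u"
  by (metis inst_lift)

text \<open>A pullback property of the square in \<open>lift_lift\<close>: a term that misses two
  loose indices comes from a term in which both gaps are closed. It serves to recognise an eta redex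
  through a lifting.\<close>

lemma lift_eq_lift:
  assumes "lift t (Suc k) = lift q i" "i \<le> k"
  obtains w where "t = lift w i" "q = lift w k"
proof -
  have "\<exists>w. t = lift w i \<and> q = lift w k" using assms
  proof (induction t arbitrary: q i k)
    case (Bnd n)
    then show ?case
      by (cases q) (auto split: if_splits intro: exI[of _ "Bnd n"] exI[of _ "Bnd (n - 1)"])
  next
    case (Var v)
    then show ?case by (cases q) (auto split: if_splits intro: exI[of _ "Var v"])
  next
    case (Con c)
    then show ?case by (cases q) (auto split: if_splits intro: exI[of _ "Con c"])
  next
    case (App t1 t2)
    from App.prems obtain q1 q2 where q: "q = q1 \<cdot> q2"
      "lift t1 (Suc k) = lift q1 i" "lift t2 (Suc k) = lift q2 i"
      by (cases q) (auto split: if_splits)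
    from App.IH(1)[OF q(2) App.prems(2)] App.IH(2)[OF q(3) App.prems(2)]
    obtain w1 w2 where "t1 = lift w1 i" "q1 = lift w1 k" "t2 = lift w2 i" "q2 = lift w2 k" by auto
    then show ?case by (intro exI[of _ "w1 \<cdot> w2"]) (simp add: q(1))
  next
    case (Lam t)
    from Lam.prems obtain q1 where q: "q = Lam q1" "lift t (Suc (Suc k)) = lift q1 (Suc i)"
      by (cases q) (auto split: if_splits)
    from Lam.IH[OF q(2)] Lam.prems(2)
    obtain w where "t = lift w (Suc i)" "q1 = lift w (Suc k)" by auto
    then show ?case by (intro exI[of _ "Lam w"]) (simp add: q(1))
  qed
  then show thesis using that by blast
qed

text \<open>Local closure as an invariance, so that it acts as a rewrite rule. It is what makes
  \<open>tsub\<close> correct under \<open>Lam\<close> without any lifting.\<close>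

definition lc :: "('b, 'c) tm \<Rightarrow> bool" where
  "lc t \<longleftrightarrow> (\<forall>k. lift t k = t)"

lemma lc_lift [simp]: "lc t \<Longrightarrow> lift t k = t"
  by (simp add: lc_def)

lemma lc_inst [simp]: "lc t \<Longrightarrow> inst t s k = t"
  by (metis inst_lift lc_lift)

lemma lc_simps [simp]: "lc (Var v)" "lc (Con c)" "lc (t \<cdot> u) \<longleftrightarrow> lc t \<and> lc u"
  by (auto simp: lc_def)

lemma tsub_lift:
  assumes "\<And>v. lc (\<theta> v)"
  shows "tsub \<theta> (lift t k) = lift (tsub \<theta> t) k"
  using assms by (induction t arbitrary: k) auto

lemma tsub_inst:
  assumes "\<And>v. lc (\<theta> v)"
  shows "tsub \<theta> (inst t s k) = inst (tsub \<theta> t) (tsub \<theta> s) k"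
  using assms by (induction t arbitrary: s k) (auto simp: tsub_lift)

lemma tsub_cong: "(\<And>v. v \<in> fv t \<Longrightarrow> \<theta> v = \<theta>' v) \<Longrightarrow> tsub \<theta> t = tsub \<theta>' t"
  by (induction t) auto

lemma tsub_Var [simp]: "tsub Var t = t"
  by (induction t) auto

lemma tsub_tsub: "tsub \<delta> (tsub \<theta> t) = tsub (\<lambda>v. tsub \<delta> (\<theta> v)) t"
  by (induction t) auto

text \<open>Reinterpreting the fresh \<open>x\<close> as \<open>s\<close> turns the instance at a
  fresh variable into an arbitrary instance. This drives the abstraction case of
  \<open>wt_red\<close>; its counterpart for formulas handles the eigenvariables of the quantifier
  rules.\<close>

lemma tsub_upd_inst_Var:
  assumes "\<And>v. lc (\<theta> v)" "lc s" "x \<notin> fv t"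
  shows "tsub (\<theta>(x := s)) (inst t (Var x) k) = inst (tsub \<theta> t) s k"
proof -
  have "tsub (\<theta>(x := s)) t = tsub \<theta> t"
    using assms(3) by (intro tsub_cong) auto
  then show ?thesis using assms(1,2) by (subst tsub_inst) auto
qed

lemma inst_tsub_tbind:
  assumes "\<And>v. lc (\<theta> v)" "lc s"
  shows "inst (tsub \<theta> (tbind v t k)) s k = tsub (\<theta>(v := s)) t"
  using assms by (induction t arbitrary: k) auto

lemma tbind_lift: "i \<le> k \<Longrightarrow> tbind v (lift t i) (Suc k) = lift (tbind v t k) i"
  by (induction t arbitrary: i k) auto

lemma tbind_inst:
  "j \<le> i \<Longrightarrow> tbind v (inst t s j) i = inst (tbind v t (Suc i)) (tbind v s i) j"
  by (induction t arbitrary: i j s) (auto simp: tbind_lift)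

lemma tbind_fresh: "v \<notin> fv t \<Longrightarrow> tbind v t k = lift t k"
  by (induction t arbitrary: k) auto

section \<open>Typing\<close>

inductive_cases wt_BndE [elim!]: "wt cs E (Bnd i) a"
inductive_cases wt_VarE [elim!]: "wt cs E (Var v) a"
inductive_cases wt_ConE [elim!]: "wt cs E (Con c) a"
inductive_cases wt_AppE [elim!]: "wt cs E (t \<cdot> u) a"
inductive_cases wt_LamE [elim!]: "wt cs E (Lam t) a"

lemma wt_Bnd_iff [simp]: "wt cs E (Bnd i) a \<longleftrightarrow> i < length E \<and> a = E ! i"
  by (auto intro: wt.intros)

lemma wt_Var_iff [simp]: "wt cs E (Var v) a \<longleftrightarrow> a = snd v"
  by (cases v) (auto intro: wt.intros)

lemma wt_Con_iff [simp]: "wt cs E (Con c) a \<longleftrightarrow> con_ty cs c = Some a"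
  by (auto intro: wt.intros)

lemma wt_App_iff: "wt cs E (t \<cdot> u) b \<longleftrightarrow> (\<exists>a. wt cs E t (a \<rightarrow>\<^sub>t b) \<and> wt cs E u a)"
  by (auto intro: wt.intros)

lemma wt_Lam_iff: "wt cs E (Lam t) c \<longleftrightarrow> (\<exists>a b. c = a \<rightarrow>\<^sub>t b \<and> wt cs (a # E) t b)"
  by (auto intro: wt.intros)

lemma wt_lift_ge: "wt cs E t a \<Longrightarrow> length E \<le> k \<Longrightarrow> lift t k = t"
  by (induction arbitrary: k rule: wt.induct) auto

lemma wt_lc: "wt cs [] t a \<Longrightarrow> lc t"
  by (simp add: lc_def wt_lift_ge)

lemma wt_append: "wt cs E t a \<Longrightarrow> wt cs (E @ E') t a"
  by (induction rule: wt.induct) (auto simp: nth_append intro: wt.intros)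

lemma wt_weaken_Nil: "wt cs [] t a \<Longrightarrow> wt cs E t a"
  using wt_append[of cs "[]" t a E] by simp

lemma wt_lift_iff:
  "wt cs (E1 @ b # E2) (lift t (length E1)) a \<longleftrightarrow> wt cs (E1 @ E2) t a"
proof (induction t arbitrary: E1 a)
  case (Lam t)
  show ?case using Lam.IH[of "_ # E1"] by (simp add: wt_Lam_iff)
qed (auto simp: wt_App_iff nth_append Suc_diff_le)

lemma wt_lift_0 [simp]: "wt cs (b # E) (lift t 0) a \<longleftrightarrow> wt cs E t a"
  using wt_lift_iff[of cs "[]" b E t a] by simp

lemma wt_inst:
  "wt cs (E1 @ b # E2) t a \<Longrightarrow> wt cs (E1 @ E2) s b \<Longrightarrow> wt cs (E1 @ E2) (inst t s (length E1)) a"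
proof (induction t arbitrary: E1 a s)
  case (Bnd i)
  consider "i < length E1" | "i = length E1" | "i > length E1" by linarith
  then show ?case
  proof cases
    case 3
    then obtain m where "i = Suc m" "length E1 \<le> m" by (cases i) auto
    with Bnd show ?thesis by (auto simp: nth_append Suc_diff_le)
  qed (use Bnd in \<open>auto simp: nth_append\<close>)
next
  case (Lam t)
  from Lam.prems obtain c d where t: "a = c \<rightarrow>\<^sub>t d" "wt cs ((c # E1) @ b # E2) t d"
    by (auto simp: wt_Lam_iff)
  have "wt cs ((c # E1) @ E2) (inst t (lift s 0) (length (c # E1))) d"
    using Lam.prems(2) by (intro Lam.IH t(2)) simp
  then show ?case using t by (simp add: wt_Lam_iff)
next
  case (App t u)
  then show ?case by (auto simp: wt_App_iff) blast
qed auto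

lemma wt_inst_0: "wt cs (b # E) t a \<Longrightarrow> wt cs E s b \<Longrightarrow> wt cs E (inst t s 0) a"
  using wt_inst[of cs "[]" b E t a s] by simp

lemma wt_tsub:
  assumes "\<And>v. wt cs [] (\<theta> v) (snd v)"
  shows "wt cs E t a \<Longrightarrow> wt cs E (tsub \<theta> t) a"
proof (induction rule: wt.induct)
  case (wt_Var E x a)
  then show ?case using assms[of "(x, a)"] by (simp add: wt_weaken_Nil)
qed (auto intro: wt.intros)

lemma wt_tbind:
  "wt cs (E1 @ E2) t a \<Longrightarrow> wt cs (E1 @ snd v # E2) (tbind v t (length E1)) a"
proof (induction t arbitrary: E1 a)
  case (Lam t)
  from Lam.prems obtain c d where t: "a = c \<rightarrow>\<^sub>t d" "wt cs ((c # E1) @ E2) t d"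
    by (auto simp: wt_Lam_iff)
  show ?case using Lam.IH[OF t(2)] t(1) by (simp add: wt_Lam_iff)
next
  case (App t u)
  then show ?case by (auto simp: wt_App_iff) blast
qed (auto simp: wt_App_iff nth_append Suc_diff_le)

section \<open>Closure properties of conversion\<close>

lemma conv_lift: "t \<approx> t' \<Longrightarrow> lift t k \<approx> lift t' k"
proof (induction arbitrary: k rule: conv.induct)
  case (conv_beta t u)
  then show ?case using conv.conv_beta[of "lift t (Suc k)" "lift u k"] by (simp add: lift_inst_le)
next
  case (conv_eta t)
  then show ?case using conv.conv_eta[of "lift t k"] by (simp add: lift_lift)
next
  case (conv_trans t u v)
  then show ?case by (meson conv.conv_trans)
qed (auto intro: conv_refl conv_sym conv_App conv_Lam)

lemma conv_inst_left: "t \<approx> t' \<Longrightarrow> inst t s k \<approx> inst t' s k"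
proof (induction arbitrary: s k rule: conv.induct)
  case (conv_beta t u)
  then show ?case
    using conv.conv_beta[of "inst t (lift s 0) (Suc k)" "inst u s k"] by (simp add: inst_inst)
next
  case (conv_eta t)
  then show ?case using conv.conv_eta[of "inst t s k"] by (simp add: lift_inst_ge)
next
  case (conv_trans t u v)
  then show ?case by (meson conv.conv_trans)
qed (auto intro: conv_refl conv_sym conv_App conv_Lam)

lemma conv_inst_right: "s \<approx> s' \<Longrightarrow> inst t s k \<approx> inst t s' k"
proof (induction t arbitrary: s s' k)
  case (Lam t)
  from Lam.IH[OF conv_lift[OF Lam.prems]] show ?case by (simp add: conv_Lam)
qed (auto intro: conv_refl conv_App)

lemma conv_tsub_left:
  assumes "\<And>v. lc (\<theta> v)"
  shows "t \<approx> t' \<Longrightarrow> tsub \<theta> t \<approx> tsub \<theta> t'"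
proof (induction rule: conv.induct)
  case (conv_beta t u)
  then show ?case
    using conv.conv_beta[of "tsub \<theta> t" "tsub \<theta> u"] assms by (simp add: tsub_inst)
next
  case (conv_eta t)
  then show ?case using conv.conv_eta[of "tsub \<theta> t"] assms by (simp add: tsub_lift)
next
  case (conv_trans t u v)
  then show ?case by (meson conv.conv_trans)
qed (auto intro: conv_refl conv_sym conv_App conv_Lam)

lemma conv_tsub_right: "(\<And>v. \<theta> v \<approx> \<theta>' v) \<Longrightarrow> tsub \<theta> t \<approx> tsub \<theta>' t"
  by (induction t) (auto intro: conv_refl conv_App conv_Lam)

lemma conv_tbind: "t \<approx> t' \<Longrightarrow> tbind v t k \<approx> tbind v t' k"
proof (induction arbitrary: k rule: conv.induct)
  case (conv_beta t u)
  then show ?case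
    using conv.conv_beta[of "tbind v t (Suc k)" "tbind v u k"] by (simp add: tbind_inst)
next
  case (conv_eta t)
  then show ?case using conv.conv_eta[of "tbind v t k"] by (simp add: tbind_lift)
next
  case (conv_trans t u v)
  then show ?case by (meson conv.conv_trans)
qed (auto intro: conv_refl conv_sym conv_App conv_Lam)

section \<open>Confluence\<close>

text \<open>Parallel reduction in the style of Tait and Martin-Loef, with eta included, so that one
  diamond property replaces separate confluence proofs for beta and eta and their
  commutation.\<close>

inductive par :: "('b, 'c) tm \<Rightarrow> ('b, 'c) tm \<Rightarrow> bool"  (infix \<open>\<Rrightarrow>\<close> 50) where
  par_Bnd [simp, intro]: "Bnd i \<Rrightarrow> Bnd i"
| par_Var [simp, intro]: "Var v \<Rrightarrow> Var v"
| par_Con [simp, intro]: "Con c \<Rrightarrow> Con c"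
| par_App [intro]: "t \<Rrightarrow> t' \<Longrightarrow> u \<Rrightarrow> u' \<Longrightarrow> t \<cdot> u \<Rrightarrow> t' \<cdot> u'"
| par_Lam [intro]: "t \<Rrightarrow> t' \<Longrightarrow> Lam t \<Rrightarrow> Lam t'"
| par_beta [intro]: "t \<Rrightarrow> t' \<Longrightarrow> u \<Rrightarrow> u' \<Longrightarrow> Lam t \<cdot> u \<Rrightarrow> inst t' u' 0"
| par_eta [intro]: "t \<Rrightarrow> t' \<Longrightarrow> Lam (lift t 0 \<cdot> Bnd 0) \<Rrightarrow> t'"

inductive_cases par_BndE [elim!]: "Bnd i \<Rrightarrow> t"
inductive_cases par_VarE [elim!]: "Var v \<Rrightarrow> t"
inductive_cases par_ConE [elim!]: "Con c \<Rrightarrow> t"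
inductive_cases par_AppE [consumes 1, case_names app beta]: "t \<cdot> u \<Rrightarrow> w"
inductive_cases par_LamE [consumes 1, case_names lam eta]: "Lam t \<Rrightarrow> w"

lemma par_refl [simp, intro]: "t \<Rrightarrow> t"
  by (induction t) auto

lemma par_conv: "t \<Rrightarrow> u \<Longrightarrow> t \<approx> u"
proof (induction rule: par.induct)
  case (par_beta t t' u u')
  then show ?case by (meson conv.conv_beta conv_inst_left conv_inst_right conv_trans)
next
  case (par_eta t t')
  then show ?case by (meson conv.conv_eta conv_trans)
qed (auto intro: conv_refl conv_App conv_Lam)

lemma par_lift: "t \<Rrightarrow> u \<Longrightarrow> lift t k \<Rrightarrow> lift u k"
proof (induction arbitrary: k rule: par.induct)
  case (par_beta t t' u u')
  then show ?case
    using par.par_beta[of "lift t (Suc k)" "lift t' (Suc k)" "lift u k" "lift u' k"]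
    by (simp add: lift_inst_le)
next
  case (par_eta t t')
  then show ?case using par.par_eta[of "lift t k" "lift t' k"] by (simp add: lift_lift)
qed auto

lemma par_inst: "t \<Rrightarrow> t' \<Longrightarrow> s \<Rrightarrow> s' \<Longrightarrow> inst t s k \<Rrightarrow> inst t' s' k"
proof (induction arbitrary: k s s' rule: par.induct)
  case (par_Lam t t')
  then show ?case by (auto simp: par_lift)
next
  case (par_beta t t' u u')
  then show ?case
    using par.par_beta[of "inst t (lift s 0) (Suc k)" "inst t' (lift s' 0) (Suc k)" "inst u s k" "inst u' s' k"]
    by (simp add: inst_inst par_lift)
next
  case (par_eta t t')
  then show ?case
    using par.par_eta[of "inst t s k" "inst t' s' k"] by (simp add: lift_inst_ge)
qed auto

lemma lift_eq_App: "lift t k = u1 \<cdot> u2 \<Longrightarrow> \<exists>t1 t2. t = t1 \<cdot> t2 \<and> u1 = lift t1 k \<and> u2 = lift t2 k"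
  by (cases t) (auto split: if_splits)

lemma lift_eq_Lam: "lift t k = Lam u \<Longrightarrow> \<exists>t1. t = Lam t1 \<and> u = lift t1 (Suc k)"
  by (cases t) (auto split: if_splits)

lemma lift_eq_Bnd0: "lift t (Suc k) = Bnd 0 \<Longrightarrow> t = Bnd 0"
  by (cases t) (auto split: if_splits)

text \<open>Reduction never creates a loose index, so an index missing from the source is missing
  from the target. In the eta case the inner gap and the gap at \<open>k\<close> have to be
  separated, which is the purpose of \<open>lift_eq_lift\<close>.\<close>

lemma par_lift_inv:
  assumes "lift t k \<Rrightarrow> u"
  obtains u' where "u = lift u' k" "t \<Rrightarrow> u'"
proof -
  have "r \<Rrightarrow> u \<Longrightarrow> r = lift t k \<Longrightarrow> \<exists>u'. u = lift u' k \<and> t \<Rrightarrow> u'" for r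
  proof (induction arbitrary: t k rule: par.induct)
    case (par_App a a' b b')
    then obtain t1 t2 where "t = t1 \<cdot> t2" "a = lift t1 k" "b = lift t2 k" by (metis lift_eq_App)
    with par_App.IH show ?case by (metis par.par_App lift.simps(4))
  next
    case (par_Lam a a')
    then obtain t1 where "t = Lam t1" "a = lift t1 (Suc k)" by (metis lift_eq_Lam)
    with par_Lam.IH show ?case by (metis par.par_Lam lift.simps(5))
  next
    case (par_beta a a' b b')
    then obtain t1 t2 where "t = t1 \<cdot> t2" "Lam a = lift t1 k" "b = lift t2 k" by (metis lift_eq_App)
    moreover then obtain t3 where "t1 = Lam t3" "a = lift t3 (Suc k)" by (metis lift_eq_Lam)
    moreover obtain u3 u2 where "a' = lift u3 (Suc k)" "t3 \<Rrightarrow> u3" "b' = lift u2 k" "t2 \<Rrightarrow> u2"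
      using par_beta.IH calculation by metis
    ultimately show ?case
      by (intro exI[of _ "inst u3 u2 0"]) (auto simp: lift_inst_le)
  next
    case (par_eta a a')
    then obtain t1 where "t = Lam t1" "lift a 0 \<cdot> Bnd 0 = lift t1 (Suc k)" by (metis lift_eq_Lam)
    moreover then obtain t2 t3 where "t1 = t2 \<cdot> t3" "lift a 0 = lift t2 (Suc k)" "Bnd 0 = lift t3 (Suc k)"
      by (metis lift_eq_App)
    moreover then have "t3 = Bnd 0" by (metis lift_eq_Bnd0)
    moreover obtain w where "t2 = lift w 0" "a = lift w k"
      using calculation(4) lift_eq_lift[of t2 k a 0] by auto
    moreover obtain u' where "a' = lift u' k" "w \<Rrightarrow> u'"
      using par_eta.IH[OF \<open>a = lift w k\<close>] by blast
    ultimately show ?case by (metis par.par_eta)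
  next
    case (par_Bnd i)
    then show ?case by (metis par_refl)
  next
    case (par_Var v)
    then show ?case by (metis par_refl)
  next
    case (par_Con c)
    then show ?case by (metis par_refl)
  qed
  then show thesis using assms that by blast
qed

lemma par_wt: "t \<Rrightarrow> u \<Longrightarrow> wt cs E t a \<Longrightarrow> wt cs E u a"
proof (induction arbitrary: E a rule: par.induct)
  case (par_App t t' u u')
  then show ?case by (metis wt_App_iff)
next
  case (par_beta t t' u u')
  from par_beta.prems obtain b where "wt cs (b # E) t a" "wt cs E u b" by auto
  then show ?case using par_beta.IH wt_inst_0 by blast
next
  case (par_eta t t')
  from par_eta.prems have "wt cs E t a" by (auto simp: wt_App_iff wt_Lam_iff)
  then show ?case by (rule par_eta.IH)
qed (auto simp: wt_Lam_iff)

lemma par_fv: "t \<Rrightarrow> u \<Longrightarrow> fv u \<subseteq> fv t"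
proof (induction rule: par.induct)
  case (par_beta t t' u u')
  then show ?case using fv_inst[of t' u' 0] by auto
qed auto

text \<open>The overlap of eta with beta: if \<open>s\<close> is an abstraction, the body of the eta
  redex is a beta redex, and contracting it gives back the body of \<open>s\<close>, because
  instantiating \<open>lift s' (Suc 0)\<close> at \<open>Bnd 0\<close> returns
  \<open>s'\<close>.\<close>

lemma par_eta_body:
  assumes "lift s 0 \<cdot> Bnd 0 \<Rrightarrow> q"
  shows "(\<exists>s'. q = lift s' 0 \<cdot> Bnd 0 \<and> s \<Rrightarrow> s') \<or> (\<exists>s'. s = Lam s' \<and> s' \<Rrightarrow> q)"
  using assms
proof (cases rule: par_AppE)
  case c1: (app a b)
  then show ?thesis by (metis par_BndE par_lift_inv)
next
  case c2: (beta p p' b)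
  from c2(1) obtain s' where s': "s = Lam s'" "p = lift s' (Suc 0)" using lift_eq_Lam by blast
  with c2(3) obtain p0 where "p' = lift p0 (Suc 0)" "s' \<Rrightarrow> p0" by (metis par_lift_inv)
  with c2 s' show ?thesis by auto
qed

text \<open>Induction on size instead of structure: the contractum \<open>s\<close> of an eta redex
  \<open>Lam (lift s 0 \<cdot> Bnd 0)\<close> is smaller than the redex, but what occurs in the
  redex is only its lifting.\<close>

lemma par_diamond:
  fixes t :: "('b, 'c) tm"
  shows "t \<Rrightarrow> u \<Longrightarrow> t \<Rrightarrow> v \<Longrightarrow> \<exists>w. u \<Rrightarrow> w \<and> v \<Rrightarrow> w"
proof (induction t arbitrary: u v rule: measure_induct_rule[where f = tmsize])
  case (less t)
  \<comment> \<open>Contracting a beta redex against reducing its function part. The delicate case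
    is a function part that is an eta redex over an abstraction \<open>Lam s'\<close>: after the eta
    step the same situation recurs with \<open>s'\<close> in place of \<open>q\<close>, hence the
    inner induction.\<close>
  have join_beta: "\<exists>w. r \<cdot> u1 \<Rrightarrow> w \<and> inst q' u2 0 \<Rrightarrow> w"
    if "Lam q \<Rrightarrow> r" "q \<Rrightarrow> q'" "tmsize (Lam q) < tmsize t" "u1 \<Rrightarrow> u3" "u2 \<Rrightarrow> u3"
    for q r q' u1 u2 u3 :: "('b, 'c) tm"
    using that
  proof (induction q arbitrary: r q' rule: measure_induct_rule[where f = tmsize])
    case inner: (less q)
    from inner.prems(1) show ?case
    proof (cases rule: par_LamE)
      case c1: (lam q1)
      from inner.prems(3) have "tmsize q < tmsize t" by simp
      from less.IH[OF this c1(2) inner.prems(2)] obtain q3 where "q1 \<Rrightarrow> q3" "q' \<Rrightarrow> q3" by blast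
      then show ?thesis using c1(1) inner.prems(4,5) par_inst by blast
    next
      case c2: (eta s)
      from inner.prems(2) c2(1) have "lift s 0 \<cdot> Bnd 0 \<Rrightarrow> q'" by simp
      from par_eta_body[OF this] show ?thesis
      proof (elim disjE exE conjE)
        fix s' assume s': "q' = lift s' 0 \<cdot> Bnd 0" "s \<Rrightarrow> s'"
        from inner.prems(3) c2 have "tmsize s < tmsize t" by simp
        from less.IH[OF this c2(2) s'(2)] obtain w where "r \<Rrightarrow> w" "s' \<Rrightarrow> w" by blast
        then show ?thesis using s'(1) inner.prems(4,5) by (intro exI[of _ "w \<cdot> u3"]) auto
      next
        fix s' assume s': "s = Lam s'" "s' \<Rrightarrow> q'"
        from inner.prems(3) c2 s' show ?thesis
          by (intro inner.IH[of s'] inner.prems(4,5)) auto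
      qed
    qed
  qed
  \<comment> \<open>Contracting an eta redex against reducing below its \<open>Lam\<close>. In both
    cases of \<open>par_eta_body\<close> the abstraction over \<open>q'\<close> is within one
    parallel step of a reduct of \<open>s\<close>, so the size induction is applied to
    \<open>s\<close>.\<close>
  have join_eta: "\<exists>w. r \<Rrightarrow> w \<and> Lam q' \<Rrightarrow> w"
    if "s \<Rrightarrow> r" "lift s 0 \<cdot> Bnd 0 \<Rrightarrow> q'" "tmsize s < tmsize t"
    for s r q' :: "('b, 'c) tm"
    using par_eta_body[OF that(2)]
  proof (elim disjE exE conjE)
    fix s' assume "q' = lift s' 0 \<cdot> Bnd 0" "s \<Rrightarrow> s'"
    then show ?thesis using less.IH[OF that(3,1)] by blast
  next
    fix s' assume "s = Lam s'" "s' \<Rrightarrow> q'"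
    then show ?thesis using less.IH[OF that(3,1)] by blast
  qed
  show ?case
  proof (cases t)
    case (App a b)
    note IHa = less.IH[of a] and IHb = less.IH[of b]
    have size: "tmsize a < tmsize t" "tmsize b < tmsize t" using App by auto
    from less.prems(1)[unfolded App] show ?thesis
    proof (cases rule: par_AppE)
      case u: (app a1 b1)
      from less.prems(2)[unfolded App] show ?thesis
      proof (cases rule: par_AppE)
        case v: (app a2 b2)
        then show ?thesis using u IHa[OF size(1)] IHb[OF size(2)] by blast
      next
        case v: (beta q q2 b2)
        obtain b3 where "b1 \<Rrightarrow> b3" "b2 \<Rrightarrow> b3" using IHb[OF size(2) u(3) v(4)] by blast
        with join_beta[of q a1 q2 b1 b3 b2] u v size show ?thesis by auto
      qed
    next
      case u: (beta q q1 b1)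
      from less.prems(2)[unfolded App] show ?thesis
      proof (cases rule: par_AppE)
        case v: (app a2 b2)
        obtain b3 where "b1 \<Rrightarrow> b3" "b2 \<Rrightarrow> b3" using IHb[OF size(2) u(4) v(3)] by blast
        with join_beta[of q a2 q1 b2 b3 b1] u v size show ?thesis by auto
      next
        case v: (beta q' q2 b2)
        have "tmsize q < tmsize t" "q \<Rrightarrow> q2" using u(1) v(1,3) size by auto
        then obtain q3 where "q1 \<Rrightarrow> q3" "q2 \<Rrightarrow> q3" using less.IH u(3) by blast
        moreover obtain b3 where "b1 \<Rrightarrow> b3" "b2 \<Rrightarrow> b3" using IHb[OF size(2) u(4) v(4)] by blast
        ultimately show ?thesis using u(2) v(2) par_inst by blast
      qed
    qed
  next
    case (Lam q)
    from less.prems(1)[unfolded Lam] show ?thesis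
    proof (cases rule: par_LamE)
      case u: (lam q1)
      from less.prems(2)[unfolded Lam] show ?thesis
      proof (cases rule: par_LamE)
        case v: (lam q2)
        then show ?thesis using u less.IH[of q q1 q2] Lam by auto
      next
        case v: (eta s)
        then show ?thesis using join_eta[of s v q1] u Lam by auto
      qed
    next
      case u: (eta s)
      from less.prems(2)[unfolded Lam] show ?thesis
      proof (cases rule: par_LamE)
        case v: (lam q2)
        then show ?thesis using join_eta[of s u q2] u Lam by auto
      next
        case v: (eta s')
        then show ?thesis using u less.IH[of s u v] Lam by auto
      qed
    qed
  qed (use less.prems in auto)
qed

abbreviation pars :: "('b, 'c) tm \<Rightarrow> ('b, 'c) tm \<Rightarrow> bool"  (infix \<open>\<Rrightarrow>\<^sup>*\<close> 50) where
  "t \<Rrightarrow>\<^sup>* u \<equiv> par\<^sup>*\<^sup>* t u"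

lemma pars_strip: "t \<Rrightarrow>\<^sup>* v \<Longrightarrow> t \<Rrightarrow> u \<Longrightarrow> \<exists>w. u \<Rrightarrow>\<^sup>* w \<and> v \<Rrightarrow> w"
proof (induction rule: rtranclp_induct)
  case (step v v')
  then show ?case by (meson par_diamond rtranclp.rtrancl_into_rtrancl)
qed blast

lemma pars_confluent: "t \<Rrightarrow>\<^sup>* u \<Longrightarrow> t \<Rrightarrow>\<^sup>* v \<Longrightarrow> \<exists>w. u \<Rrightarrow>\<^sup>* w \<and> v \<Rrightarrow>\<^sup>* w"
proof (induction rule: rtranclp_induct)
  case (step u u')
  then show ?case by (meson pars_strip rtranclp.rtrancl_into_rtrancl)
qed blast

lemma pars_App:
  assumes "t \<Rrightarrow>\<^sup>* t'" "u \<Rrightarrow>\<^sup>* u'"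
  shows "t \<cdot> u \<Rrightarrow>\<^sup>* t' \<cdot> u'"
proof -
  have "t \<cdot> u \<Rrightarrow>\<^sup>* t' \<cdot> u"
    using assms(1) by (induction rule: rtranclp_induct) (auto intro: rtranclp.rtrancl_into_rtrancl)
  moreover have "t' \<cdot> u \<Rrightarrow>\<^sup>* t' \<cdot> u'"
    using assms(2) by (induction rule: rtranclp_induct) (auto intro: rtranclp.rtrancl_into_rtrancl)
  ultimately show ?thesis by (rule rtranclp_trans)
qed

lemma pars_Lam: "t \<Rrightarrow>\<^sup>* t' \<Longrightarrow> Lam t \<Rrightarrow>\<^sup>* Lam t'"
  by (induction rule: rtranclp_induct) (auto intro: rtranclp.rtrancl_into_rtrancl)

lemma pars_wt: "t \<Rrightarrow>\<^sup>* u \<Longrightarrow> wt cs E t a \<Longrightarrow> wt cs E u a"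
  by (induction rule: rtranclp_induct) (auto dest: par_wt)

lemma pars_fv: "t \<Rrightarrow>\<^sup>* u \<Longrightarrow> fv u \<subseteq> fv t"
  by (induction rule: rtranclp_induct) (auto dest: par_fv)

lemma pars_conv: "t \<Rrightarrow>\<^sup>* u \<Longrightarrow> t \<approx> u"
  by (induction rule: rtranclp_induct) (blast intro: conv_refl conv_trans par_conv)+

theorem church_rosser: "t \<approx> u \<Longrightarrow> \<exists>w. t \<Rrightarrow>\<^sup>* w \<and> u \<Rrightarrow>\<^sup>* w"
proof (induction rule: conv.induct)
  case (conv_beta t u)
  have "Lam t \<cdot> u \<Rrightarrow> inst t u 0" by (intro par_beta par_refl)
  then show ?case by blast
next
  case (conv_eta t)
  have "Lam (lift t 0 \<cdot> Bnd 0) \<Rrightarrow> t" by (intro par_eta par_refl)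
  then show ?case by blast
next
  case (conv_trans t u v)
  then obtain w1 w2 where w: "t \<Rrightarrow>\<^sup>* w1" "u \<Rrightarrow>\<^sup>* w1" "u \<Rrightarrow>\<^sup>* w2" "v \<Rrightarrow>\<^sup>* w2" by blast
  obtain w where "w1 \<Rrightarrow>\<^sup>* w" "w2 \<Rrightarrow>\<^sup>* w" using pars_confluent[OF w(2,3)] by blast
  with w show ?case by (meson rtranclp_trans)
next
  case (conv_App t t' u u')
  then show ?case using pars_App by blast
next
  case (conv_Lam t t')
  then show ?case using pars_Lam by blast
qed blast+

section \<open>Consequences of confluence: unique normal forms, and injectivity of constructors up
  to conversion\<close>

lemma normal_par: "normal t \<Longrightarrow> t \<Rrightarrow> u \<Longrightarrow> u = t"
proof (induction t arbitrary: u)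
  case (App t1 t2)
  from App.prems(2) show ?case by (cases rule: par_AppE) (use App in auto)
next
  case (Lam t)
  from Lam.prems(2) show ?case by (cases rule: par_LamE) (use Lam in auto)
qed auto

lemma normal_pars: "t \<Rrightarrow>\<^sup>* u \<Longrightarrow> normal t \<Longrightarrow> u = t"
  by (induction rule: rtranclp_induct) (auto dest: normal_par)

lemma conv_normal_pars:
  assumes "t \<approx> u" "normal u"
  shows "t \<Rrightarrow>\<^sup>* u"
  using church_rosser[OF assms(1)] normal_pars assms(2) by blast

lemma nf_eqI:
  assumes "t \<approx> u" "normal u"
  shows "nf t = u"
  unfolding nf_def
proof (rule the_equality)
  fix v assume "t \<approx> v \<and> normal v"
  then have "v \<approx> u" using assms(1) conv_sym conv_trans by blast
  then show "v = u" using \<open>t \<approx> v \<and> normal v\<close> assms(2) conv_normal_pars normal_pars by blast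
qed (use assms in simp)

text \<open>A constant at the head blocks every redex along the spine, so reducing the term means
  reducing the arguments separately. This is what makes constructors injective and disjoint up to
  conversion.\<close>

primrec rigid :: "('b, 'c) tm \<Rightarrow> bool" where
  "rigid (Bnd i) = False"
| "rigid (Var v) = False"
| "rigid (Con c) = True"
| "rigid (t \<cdot> u) = rigid t"
| "rigid (Lam t) = False"

lemma rigid_par: "t \<Rrightarrow> u \<Longrightarrow> rigid t \<Longrightarrow> rigid u"
  by (induction rule: par.induct) auto

lemma rigid_App_pars:
  assumes "t \<cdot> u \<Rrightarrow>\<^sup>* w" "rigid t"
  shows "\<exists>t' u'. w = t' \<cdot> u' \<and> t \<Rrightarrow>\<^sup>* t' \<and> u \<Rrightarrow>\<^sup>* u' \<and> rigid t'"
  using assms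
proof (induction rule: rtranclp_induct)
  case (step v w)
  then obtain t' u' where v: "v = t' \<cdot> u'" "t \<Rrightarrow>\<^sup>* t'" "u \<Rrightarrow>\<^sup>* u'" "rigid t'" by blast
  from step.hyps(2)[unfolded v(1)] show ?case
  proof (cases rule: par_AppE)
    case c1: (app t'' u'')
    moreover have "rigid t''" using c1(2) v(4) rigid_par by blast
    ultimately show ?thesis using v(2,3) by (auto intro: rtranclp.rtrancl_into_rtrancl)
  qed (use v in auto)
qed auto

lemma Con_pars: "Con c \<Rrightarrow>\<^sup>* w \<Longrightarrow> w = Con c"
  by (induction rule: rtranclp_induct) auto

lemma conv_rigid_App:
  assumes "t \<cdot> u \<approx> t' \<cdot> u'" "rigid t" "rigid t'"
  shows "t \<approx> t'" "u \<approx> u'"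
proof -
  from church_rosser[OF assms(1)] obtain w where "t \<cdot> u \<Rrightarrow>\<^sup>* w" "t' \<cdot> u' \<Rrightarrow>\<^sup>* w" by blast
  then obtain t'' u'' where "t \<Rrightarrow>\<^sup>* t''" "u \<Rrightarrow>\<^sup>* u''" "t' \<Rrightarrow>\<^sup>* t''" "u' \<Rrightarrow>\<^sup>* u''"
    using rigid_App_pars assms(2,3) by (metis tm.inject(4))
  then have "t \<approx> t''" "u \<approx> u''" "t'' \<approx> t'" "u'' \<approx> u'" by (simp_all add: pars_conv conv_sym)
  then show "t \<approx> t'" "u \<approx> u'" by (blast intro: conv_trans)+
qed

text \<open>Together with the next two simplification rules this matches clause heads automatically:
  conversions between constructor terms split into their components or become false.\<close>

lemma conv_rigid_App_iff [simp]:
  assumes "rigid t" "rigid t'"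
  shows "t \<cdot> u \<approx> t' \<cdot> u' \<longleftrightarrow> t \<approx> t' \<and> u \<approx> u'"
  using conv_rigid_App[OF _ assms] conv_App by blast

lemma conv_Con_iff [simp]: "Con c \<approx> Con c' \<longleftrightarrow> c = c'"
  using church_rosser Con_pars conv_refl by (metis tm.inject(3))

lemma not_conv_Con_App [simp]:
  assumes "rigid t"
  shows "\<not> Con c \<approx> t \<cdot> u" "\<not> t \<cdot> u \<approx> Con c"
proof -
  show "\<not> Con c \<approx> t \<cdot> u"
  proof
    assume "Con c \<approx> t \<cdot> u"
    then obtain w where "Con c \<Rrightarrow>\<^sup>* w" "t \<cdot> u \<Rrightarrow>\<^sup>* w" using church_rosser by blast
    then show False using Con_pars rigid_App_pars[OF _ assms] by blast
  qed
  then show "\<not> t \<cdot> u \<approx> Con c" using conv_sym by blast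
qed

section \<open>Weak normalization\<close>

definition normalizable :: "('b, 'c) tm \<Rightarrow> bool" where
  "normalizable t \<longleftrightarrow> (\<exists>u. t \<approx> u \<and> normal u)"

text \<open>Neutrality is taken up to conversion, not syntactically: it asks for a normal form that
  stays normal when applied to a normal argument.\<close>

definition neutral :: "('b, 'c) tm \<Rightarrow> bool" where
  "neutral t \<longleftrightarrow> (\<exists>u. t \<approx> u \<and> normal u \<and> \<not> is_Lam u)"

lemma neutral_App: "neutral t \<Longrightarrow> normalizable u \<Longrightarrow> neutral (t \<cdot> u)"
  unfolding neutral_def normalizable_def by (meson conv_App is_Lam.simps(4) normal.simps(4))

lemma normal_neutral: "normal t \<Longrightarrow> \<not> is_Lam t \<Longrightarrow> neutral t"
  unfolding neutral_def using conv_refl by blast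

lemma is_Lam_tbind [simp]: "is_Lam (tbind v t k) = is_Lam t"
  by (cases t) auto

text \<open>Binding \<open>v\<close> at \<open>Suc k\<close> touches no index up to
  \<open>k\<close>, so a gap at \<open>i\<close> was there before. Consequently \<open>tbind\<close>
  creates no eta redexes.\<close>

lemma tbind_eq_lift:
  assumes "tbind v t (Suc k) = lift q i" "i \<le> k"
  shows "\<exists>w. t = lift w i"
  using assms
proof (induction t arbitrary: q i k)
  case (Bnd n)
  then show ?case
    by (cases q) (auto split: if_splits intro: exI[of _ "Bnd n"] exI[of _ "Bnd (n - 1)"])
next
  case (Var w)
  show ?case by (intro exI[of _ "Var w"]) simp
next
  case (Con c)
  show ?case by (intro exI[of _ "Con c"]) simp
next
  case (App t1 t2)
  from App.prems obtain q1 q2 where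
    "tbind v t1 (Suc k) = lift q1 i" "tbind v t2 (Suc k) = lift q2 i"
    by (cases q) (auto split: if_splits)
  with App.IH App.prems(2) obtain w1 w2 where "t1 = lift w1 i" "t2 = lift w2 i" by blast
  then show ?case by (intro exI[of _ "w1 \<cdot> w2"]) simp
next
  case (Lam t)
  from Lam.prems obtain q1 where "tbind v t (Suc (Suc k)) = lift q1 (Suc i)"
    by (cases q) (auto split: if_splits)
  with Lam.IH[of "Suc k" q1 "Suc i"] Lam.prems(2) obtain w where "t = lift w (Suc i)" by auto
  then show ?case by (intro exI[of _ "Lam w"]) simp
qed

lemma normal_tbind: "normal t \<Longrightarrow> normal (tbind v t k)"
proof (induction t arbitrary: k)
  case (Lam t)
  have False if eq: "tbind v t (Suc k) = lift u 0 \<cdot> Bnd 0" for u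
  proof -
    from eq obtain t1 t2 where t: "t = t1 \<cdot> t2"
      "tbind v t1 (Suc k) = lift u 0" "tbind v t2 (Suc k) = Bnd 0"
      by (cases t) (auto split: if_splits)
    from t(3) have "t2 = Bnd 0" by (cases t2) (auto split: if_splits)
    moreover obtain w where "t1 = lift w 0" using tbind_eq_lift[OF t(2)] by auto
    ultimately show False using t(1) Lam.prems by simp
  qed
  then show ?case using Lam by auto
qed auto

lemma normal_lift_inv: "normal (lift t k) \<Longrightarrow> normal t"
proof (induction t arbitrary: k)
  case (App t1 t2)
  then show ?case by (cases t1) auto
next
  case (Lam t)
  have False if "t = lift u 0 \<cdot> Bnd 0" for u
  proof -
    have "lift t (Suc k) = lift (lift u k) 0 \<cdot> Bnd 0" using that by (simp add: lift_lift)
    then show False using Lam.prems by simp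
  qed
  then show ?case using Lam by auto
qed auto

text \<open>Abstracting the fresh \<open>x\<close> from the normal form of
  \<open>t \<cdot> Var x\<close> yields, by eta, an abstraction convertible to \<open>t\<close>. Its
  body is normal, so at most one eta redex at the root remains, and contracting it leaves a normal
  term.\<close>

lemma normalizable_App_VarD:
  assumes "normalizable (t \<cdot> Var x)" "x \<notin> fv t"
  shows "normalizable t"
proof -
  from assms(1) obtain n where n: "t \<cdot> Var x \<approx> n" "normal n" unfolding normalizable_def by blast
  let ?n = "tbind x n 0"
  from conv_tbind[OF n(1), of x 0] assms(2) have "lift t 0 \<cdot> Bnd 0 \<approx> ?n" by (simp add: tbind_fresh)
  then have "Lam (lift t 0 \<cdot> Bnd 0) \<approx> Lam ?n" by (rule conv_Lam)
  then have conv: "t \<approx> Lam ?n" using conv_eta conv_sym conv_trans by blast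
  have norm: "normal ?n" using n(2) by (rule normal_tbind)
  show ?thesis
  proof (cases "\<exists>u. ?n = lift u 0 \<cdot> Bnd 0")
    case True
    then obtain u where u: "?n = lift u 0 \<cdot> Bnd 0" by blast
    with conv have "t \<approx> u" using conv_eta conv_trans by metis
    moreover have "normal u" using norm u normal_lift_inv by auto
    ultimately show ?thesis unfolding normalizable_def by blast
  next
    case False
    then show ?thesis using norm conv unfolding normalizable_def by (metis normal.simps(5))
  qed
qed

text \<open>
  Reducibility ranges over terms without loose indices only: a fresh free variable then plays the
  role that the extended context plays in Kripke-style definitions.
\<close>

primrec red :: "'b ty \<Rightarrow> ('b, 'c) tm \<Rightarrow> bool" where
  "red TNt t = normalizable t"
| "red TI t = normalizable t"
| "red TAtm t = normalizable t"
| "red TPrp t = normalizable t"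
| "red TAtmlst t = normalizable t"
| "red (TBase b) t = normalizable t"
| "red (a \<rightarrow>\<^sub>t b) t = (\<forall>s. lc s \<longrightarrow> red a s \<longrightarrow> red b (t \<cdot> s))"

lemma neutral_normalizable: "neutral t \<Longrightarrow> normalizable t"
  unfolding neutral_def normalizable_def by blast

lemma normalizable_conv: "normalizable t \<Longrightarrow> t \<approx> u \<Longrightarrow> normalizable u"
  unfolding normalizable_def using conv_sym conv_trans by blast

lemma red_conv: "red a t \<Longrightarrow> t \<approx> u \<Longrightarrow> red a u"
proof (induction a arbitrary: t u)
  case (TFun a b)
  have "red b (u \<cdot> s)" if "lc s" "red a s" for s
    by (rule TFun.IH(2)[of "t \<cdot> s"]) (use TFun.prems that in \<open>auto intro: conv_App conv_refl\<close>)
  then show ?case by simp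
qed (simp_all, (erule (1) normalizable_conv)+)

lemma ex_fresh: "finite X \<Longrightarrow> \<exists>n. (n, a) \<notin> (X :: (nat \<times> 'a) set)"
  using finite_imageI[of X fst] infinite_UNIV_nat ex_new_if_finite[of "fst ` X"]
  by (metis fst_conv imageI)

text \<open>The two implications need each other at function types: applying a neutral term uses
  that reducible arguments are normalizable, while normalizing a reducible function uses that a
  fresh variable, being neutral, is a reducible argument.\<close>

lemma red_neutral_normalizable:
  fixes t :: "('b, 'c) tm"
  shows "(neutral t \<longrightarrow> red a t) \<and> (red a t \<longrightarrow> normalizable t)"
proof (induction a arbitrary: t)
  case (TFun a b)
  have "red b (t \<cdot> s)" if "neutral t" "red a s" for s
    using that TFun neutral_App by blast
  moreover have "normalizable t" if "red (a \<rightarrow>\<^sub>t b) t"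
  proof -
    obtain x where x: "(x, a) \<notin> fv t" using ex_fresh[of "fv t" a] by auto
    have "neutral (Var (x, a) :: ('b, 'c) tm)" by (rule normal_neutral) auto
    then have "red a (Var (x, a) :: ('b, 'c) tm)" using TFun(1) by blast
    then have "red b (t \<cdot> Var (x, a))" using that by simp
    then show ?thesis using TFun(2) normalizable_App_VarD x by blast
  qed
  ultimately show ?case by auto
qed (auto simp: neutral_normalizable)

text \<open>The fundamental lemma of reducibility. The typing context stays empty because an
  abstraction is opened with a fresh variable; the opened body is not a subterm but has the same
  size as the body, hence the induction on \<open>tmsize\<close>.\<close>

lemma wt_red:
  fixes t :: "('b, 'c) tm"
  assumes "wt cs [] t a" "\<And>v. lc (\<theta> v)" "\<And>v. red (snd v) (\<theta> v)"
  shows "red a (tsub \<theta> t)"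
  using assms
proof (induction t arbitrary: a \<theta> rule: measure_induct_rule[where f = tmsize])
  case (less t)
  have lc_tsub: "lc (tsub \<theta> u)" if "lc u" for u :: "('b, 'c) tm"
    using that less.prems(2) tsub_lift unfolding lc_def by metis
  show ?case
  proof (cases t)
    case (Bnd i)
    then show ?thesis using less.prems(1) by simp
  next
    case (Var v)
    then show ?thesis using less.prems by simp
  next
    case (Con c)
    have "neutral (Con c :: ('b, 'c) tm)" by (rule normal_neutral) auto
    then show ?thesis using Con red_neutral_normalizable by auto
  next
    case (App u v)
    then obtain b where u: "wt cs [] u (b \<rightarrow>\<^sub>t a)" and v: "wt cs [] v b"
      using less.prems(1) by auto
    have "red (b \<rightarrow>\<^sub>t a) (tsub \<theta> u)" using less.IH[OF _ u] less.prems App by auto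
    moreover have "red b (tsub \<theta> v)" using less.IH[OF _ v] less.prems App by auto
    moreover have "lc (tsub \<theta> v)" using v wt_lc lc_tsub by blast
    ultimately show ?thesis using App by simp
  next
    case (Lam u)
    then obtain b c where a: "a = b \<rightarrow>\<^sub>t c" and u: "wt cs [b] u c" using less.prems(1) by auto
    obtain x where x: "(x, b) \<notin> fv u" using ex_fresh[of "fv u" b] by auto
    have "red c (Lam (tsub \<theta> u) \<cdot> s)" if s: "lc s" "red b s" for s
    proof -
      have "red c (tsub (\<theta>((x, b) := s)) (inst u (Var (x, b)) 0))"
        using Lam u less.prems s by (intro less.IH wt_inst_0[OF u]) auto
      also have "tsub (\<theta>((x, b) := s)) (inst u (Var (x, b)) 0) = inst (tsub \<theta> u) s 0"
        using less.prems(2) s(1) x by (rule tsub_upd_inst_Var)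
      finally show ?thesis using red_conv conv_beta conv_sym by blast
    qed
    then show ?thesis using a Lam by simp
  qed
qed

theorem wt_normalizable:
  fixes t :: "('b, 'c) tm"
  assumes "wt cs [] t a"
  shows "normalizable t"
proof -
  have "neutral (Var v :: ('b, 'c) tm)" for v by (rule normal_neutral) auto
  then have "red a (Var v :: ('b, 'c) tm)" for v a
    using red_neutral_normalizable by blast
  then have "red a (tsub Var t)" by (intro wt_red[OF assms] lc_simps)
  then show ?thesis using red_neutral_normalizable by auto
qed

lemma
  assumes "wt cs [] t a"
  shows conv_nf: "t \<approx> nf t" and normal_nf: "normal (nf t)"
    and wt_nf: "wt cs [] (nf t) a" and fv_nf: "fv (nf t) \<subseteq> fv t"
proof -
  obtain u where u: "t \<approx> u" "normal u" using wt_normalizable[OF assms] unfolding normalizable_def by blast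
  then have nf: "nf t = u" by (rule nf_eqI)
  show "t \<approx> nf t" "normal (nf t)" using u nf by auto
  show "wt cs [] (nf t) a" "fv (nf t) \<subseteq> fv t"
    using conv_normal_pars[OF u] pars_wt[OF _ assms] pars_fv nf by auto
qed

section \<open>Formulas\<close>

lemma is_sub_wt: "is_sub cs \<theta> \<Longrightarrow> wt cs [] (\<theta> v) (snd v)"
  unfolding is_sub_def by blast

lemma is_sub_lc: "is_sub cs \<theta> \<Longrightarrow> lc (\<theta> v)"
  using is_sub_wt wt_lc by blast

lemma wt_is_sub: "is_sub cs \<theta> \<Longrightarrow> wt cs E t a \<Longrightarrow> wt cs E (tsub \<theta> t) a"
  using wt_tsub is_sub_wt by blast

lemma is_sub_Var [simp]: "is_sub cs Var"
  by (simp add: is_sub_def)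

lemma is_sub_upd:
  assumes "is_sub cs \<theta>" "wt cs [] t (snd v)"
  shows "is_sub cs (\<theta>(v := t))"
proof -
  have "{w. (\<theta>(v := t)) w \<noteq> Var w} \<subseteq> insert v {w. \<theta> w \<noteq> Var w}" by auto
  moreover have "finite (insert v {w. \<theta> w \<noteq> Var w})" using assms(1) by (simp add: is_sub_def)
  ultimately have "finite {w. (\<theta>(v := t)) w \<noteq> Var w}" by (rule finite_subset)
  then show ?thesis using assms unfolding is_sub_def by auto
qed

text \<open>Only connectives count, so instantiation preserves the measure. Recursions and
  inductions that pass from a quantified formula to its instances rely on this.\<close>

primrec fsize :: "('b, 'c, 'p) fm \<Rightarrow> nat" where
  "fsize (Atom p ts) = 0"
| "fsize Bot = 0"
| "fsize Top = 0"
| "fsize (And F G) = Suc (fsize F + fsize G)"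
| "fsize (Or F G) = Suc (fsize F + fsize G)"
| "fsize (Imp F G) = Suc (fsize F + fsize G)"
| "fsize (All a F) = Suc (fsize F)"
| "fsize (Ex a F) = Suc (fsize F)"

lemma fsize_inst [simp]: "fsize (fm_inst_at F t k) = fsize F"
  by (induction F arbitrary: t k) auto

lemma fm_sub_inst:
  assumes "\<And>v. lc (\<theta> v)"
  shows "fm_sub \<theta> (fm_inst_at F s k) = fm_inst_at (fm_sub \<theta> F) (tsub \<theta> s) k"
  using assms by (induction F arbitrary: s k) (auto simp: tsub_inst tsub_lift)

lemma fm_sub_cong: "(\<And>v. v \<in> fm_fv F \<Longrightarrow> \<theta> v = \<theta>' v) \<Longrightarrow> fm_sub \<theta> F = fm_sub \<theta>' F"
  by (induction F) (auto intro!: tsub_cong)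

lemma fm_sub_Var [simp]: "fm_sub Var F = F"
proof -
  have [simp]: "tsub Var = (\<lambda>t. t)" by (rule ext) simp
  show ?thesis by (induction F) auto
qed

lemma fm_sub_fm_sub: "fm_sub \<delta> (fm_sub \<theta> F) = fm_sub (\<lambda>v. tsub \<delta> (\<theta> v)) F"
  by (induction F) (auto simp: tsub_tsub)

lemma fm_sub_upd_inst_Var:
  assumes "\<And>v. lc (\<theta> v)" "lc s" "x \<notin> fm_fv F"
  shows "fm_sub (\<theta>(x := s)) (fm_inst_at F (Var x) k) = fm_inst_at (fm_sub \<theta> F) s k"
proof -
  have "fm_sub (\<theta>(x := s)) F = fm_sub \<theta> F"
    using assms(3) by (intro fm_sub_cong) auto
  then show ?thesis using assms(1,2) by (subst fm_sub_inst) auto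
qed

text \<open>Instantiating one quantifier of \<open>close_all\<close> amounts to updating the
  substitution at one variable, so successive instantiations add up to a simultaneous
  substitution.\<close>

lemma fm_inst_sub_bind:
  assumes "\<And>v. lc (\<theta> v)" "lc s"
  shows "fm_inst_at (fm_sub \<theta> (fm_bind v F k)) s k = fm_sub (\<theta>(v := s)) F"
  using assms by (induction F arbitrary: k) (auto simp: inst_tsub_tbind)

lemma finite_fm_fv [simp]: "finite (fm_fv F)"
  by (induction F) auto

lemma wff_bind:
  "wff cs ps (E1 @ E2) F \<Longrightarrow> wff cs ps (E1 @ snd v # E2) (fm_bind v F (length E1))"
proof (induction F arbitrary: E1)
  case (Atom p ts)
  then show ?case by (auto simp: list_all2_map1 intro: list_all2_mono wt_tbind)
next
  case (All b F)
  then show ?case using All.IH[of "b # E1"] by simp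
next
  case (Ex b F)
  then show ?case using Ex.IH[of "b # E1"] by simp
qed auto

lemma wff_close_all: "wff cs ps [] F \<Longrightarrow> wff cs ps [] (close_all vs F)"
  unfolding close_all_def using wff_bind[of cs ps "[]" "[]"] by (induction vs) auto

inductive_cases fm_conv_AtomE: "fm_conv (Atom p ts) F"
inductive_cases fm_conv_AndE: "fm_conv (And F G) H"
inductive_cases fm_conv_OrE: "fm_conv (Or F G) H"
inductive_cases fm_conv_ImpE: "fm_conv (Imp F G) H"
inductive_cases fm_conv_AllE: "fm_conv (All a F) H"
inductive_cases fm_conv_ExE: "fm_conv (Ex a F) H"

lemma fm_conv_Atom_iff [simp]:
  "fm_conv (Atom p ts) (Atom q us) \<longleftrightarrow> p = q \<and> list_all2 (\<approx>) ts us"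
  by (auto elim: fm_conv_AtomE intro: fm_conv.intros)

lemma fm_conv_sym: "fm_conv F G \<Longrightarrow> fm_conv G F"
proof (induction rule: fm_conv.induct)
  case (1 ts us p)
  then have "list_all2 (\<approx>) us ts" by (auto simp: list_all2_conv_all_nth intro: conv_sym)
  then show ?case by simp
qed (auto intro: fm_conv.intros)

lemma fm_conv_trans: "fm_conv F G \<Longrightarrow> fm_conv G H \<Longrightarrow> fm_conv F H"
proof (induction arbitrary: H rule: fm_conv.induct)
  case (1 ts us p)
  from 1(2) obtain vs where H: "H = Atom p vs" "list_all2 (\<approx>) us vs" by (auto elim: fm_conv_AtomE)
  have "list_all2 (\<approx>) ts vs" by (rule list_all2_trans[OF conv_trans 1(1) H(2)])
  then show ?case using H(1) by simp
qed (auto elim!: fm_conv_AndE fm_conv_OrE fm_conv_ImpE fm_conv_AllE fm_conv_ExE intro!: fm_conv.intros)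

lemma fm_conv_inst_left: "fm_conv F G \<Longrightarrow> fm_conv (fm_inst_at F t k) (fm_inst_at G t k)"
  by (induction arbitrary: t k rule: fm_conv.induct)
    (auto intro: fm_conv.intros simp: list_all2_map1 list_all2_map2 elim!: list_all2_mono conv_inst_left)

lemma fm_conv_inst_right: "t \<approx> u \<Longrightarrow> fm_conv (fm_inst_at F t k) (fm_inst_at F u k)"
  by (induction F arbitrary: t u k)
    (auto intro!: fm_conv.intros simp: list_all2_map1 list_all2_map2 list_all2_same conv_inst_right conv_lift)

lemma fm_conv_sub_left:
  assumes "\<And>v. lc (\<theta> v)"
  shows "fm_conv F G \<Longrightarrow> fm_conv (fm_sub \<theta> F) (fm_sub \<theta> G)"
  by (induction rule: fm_conv.induct)
    (auto intro: fm_conv.intros simp: list_all2_map1 list_all2_map2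
      elim!: list_all2_mono conv_tsub_left[OF assms])

lemma fm_conv_sub_right: "(\<And>v. \<theta> v \<approx> \<theta>' v) \<Longrightarrow> fm_conv (fm_sub \<theta> F) (fm_sub \<theta>' F)"
  by (induction F)
    (auto intro!: fm_conv.intros simp: list_all2_map1 list_all2_map2 list_all2_same conv_tsub_right)

section \<open>Goal formulas and atom lists\<close>

text \<open>The shapes on which \<open>prp_trans_nf\<close> is given by its proper equations. In
  contrast to normality this property survives \<open>inst\<close> and \<open>tsub\<close>, so
  instances of goals can be translated without normalizing again.\<close>

inductive goal :: "('b, 'c) tm \<Rightarrow> bool" where
  goal_atom: "goal (Con CAtom \<cdot> A)"
| goal_tt: "goal (Con CTt)"
| goal_and: "goal B \<Longrightarrow> goal C \<Longrightarrow> goal (Con CAnd \<cdot> B \<cdot> C)"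
| goal_imp: "goal B \<Longrightarrow> goal (Con CImp \<cdot> A \<cdot> B)"
| goal_all: "goal B \<Longrightarrow> goal (Con CAll \<cdot> Lam B)"

lemma goal_inst:
  "goal G \<Longrightarrow> goal (inst G t k) \<and> prp_trans_nf (inst G t k) = fm_inst_at (prp_trans_nf G) t k"
  by (induction arbitrary: t k rule: goal.induct) (auto intro: goal.intros)

lemma goal_tsub:
  "goal G \<Longrightarrow> goal (tsub \<theta> G) \<and> prp_trans_nf (tsub \<theta> G) = fm_sub \<theta> (prp_trans_nf G)"
  by (induction rule: goal.induct) (auto intro: goal.intros)

lemma goal_wff: "goal G \<Longrightarrow> wt cs E G TPrp \<Longrightarrow> owff cs E (prp_trans_nf G)"
  by (induction arbitrary: E rule: goal.induct) auto

lemma goal_fv: "goal G \<Longrightarrow> fm_fv (prp_trans_nf G) \<subseteq> fv G"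
  by (induction rule: goal.induct) auto

definition lst :: "('b, 'c) tm list \<Rightarrow> ('b, 'c) tm" where
  "lst As = foldr lcons As lnil"

lemma lst_simps [simp]: "lst [] = lnil" "lst (A # As) = lcons A (lst As)"
  by (simp_all add: lst_def)

lemma lst_trans_nf_lst: "lst_trans_nf (lst As) = image_mset oatom (mset As)"
  by (induction As) auto

lemma wt_lst: "wt cs E (lst As) TAtmlst \<longleftrightarrow> (\<forall>A \<in> set As. wt cs E A TAtm)"
  by (induction As) (auto simp: wt_App_iff)

text \<open>Includes the partial applications of the constructors, which have functional types,
  because an induction along the applications of a normal term passes through them.\<close>

inductive spine :: "('b, 'c) csig \<Rightarrow> 'b ty list \<Rightarrow> ('b, 'c) tm \<Rightarrow> 'b ty \<Rightarrow> bool"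
  for cs :: "('b, 'c) csig" and E :: "'b ty list" where
  "spine cs E (Con CTt) TPrp"
| "spine cs E (Con CAtom) (TAtm \<rightarrow>\<^sub>t TPrp)"
| "spine cs E (Con CAtom \<cdot> A) TPrp"
| "spine cs E (Con CAnd) (TPrp \<rightarrow>\<^sub>t TPrp \<rightarrow>\<^sub>t TPrp)"
| "wt cs E B TPrp \<Longrightarrow> spine cs E (Con CAnd \<cdot> B) (TPrp \<rightarrow>\<^sub>t TPrp)"
| "wt cs E B TPrp \<Longrightarrow> wt cs E C TPrp \<Longrightarrow> spine cs E (Con CAnd \<cdot> B \<cdot> C) TPrp"
| "spine cs E (Con CImp) (TAtm \<rightarrow>\<^sub>t TPrp \<rightarrow>\<^sub>t TPrp)"
| "spine cs E (Con CImp \<cdot> A) (TPrp \<rightarrow>\<^sub>t TPrp)"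
| "wt cs E B TPrp \<Longrightarrow> spine cs E (Con CImp \<cdot> A \<cdot> B) TPrp"
| "spine cs E (Con CAll) ((TI \<rightarrow>\<^sub>t TPrp) \<rightarrow>\<^sub>t TPrp)"
| "wt cs E F (TI \<rightarrow>\<^sub>t TPrp) \<Longrightarrow> spine cs E (Con CAll \<cdot> F) TPrp"
| "spine cs E (Con CNil) TAtmlst"
| "spine cs E (Con CCons) (TAtm \<rightarrow>\<^sub>t TAtmlst \<rightarrow>\<^sub>t TAtmlst)"
| "wt cs E A TAtm \<Longrightarrow> spine cs E (Con CCons \<cdot> A) (TAtmlst \<rightarrow>\<^sub>t TAtmlst)"
| "wt cs E A TAtm \<Longrightarrow> wt cs E L TAtmlst \<Longrightarrow> spine cs E (Con CCons \<cdot> A \<cdot> L) TAtmlst"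

text \<open>A normal term that is not an abstraction has an atomic head, and the target of its type
  is the target of the head's type. When this target is \<open>TPrp\<close> or
  \<open>TAtmlst\<close>, the hypotheses rule out variables, bound indices and user constants, which
  leaves the constructors.\<close>

lemma normal_spine:
  assumes "object_sig cs" "\<forall>b \<in> set E. object_level_ty b"
  shows "normal t \<Longrightarrow> \<not> is_Lam t \<Longrightarrow> wt cs E t a \<Longrightarrow> \<not> object_level_ty a \<Longrightarrow>
    \<forall>v \<in> fv t. object_level_ty (snd v) \<Longrightarrow> spine cs E t a"
proof (induction t arbitrary: a)
  case (Bnd i)
  then show ?case using assms(2) by auto
next
  case (Con c)
  then show ?case using assms(1)
    by (cases c) (auto simp: object_sig_def object_level_ty_def intro: spine.intros)
next
  case (App t u)
  from App.prems(3) obtain b where t: "wt cs E t (b \<rightarrow>\<^sub>t a)" and u: "wt cs E u b" by auto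
  have "spine cs E t (b \<rightarrow>\<^sub>t a)" using App.prems t by (intro App.IH(1)) (auto simp: object_level_ty_def)
  then show ?case using u by (cases rule: spine.cases) (auto intro: spine.intros)
qed auto

lemma wt_not_is_Lam: "wt cs E t a \<Longrightarrow> a \<in> {TPrp, TAtmlst} \<Longrightarrow> \<not> is_Lam t"
  by (cases t) auto

lemma normal_goal:
  assumes "object_sig cs"
  shows "normal t \<Longrightarrow> wt cs E t TPrp \<Longrightarrow> \<forall>b \<in> set E. object_level_ty b \<Longrightarrow>
    \<forall>v \<in> fv t. object_level_ty (snd v) \<Longrightarrow> goal t"
proof (induction t arbitrary: E rule: measure_induct_rule[where f = tmsize])
  case (less t)
  have "spine cs E t TPrp"
    using less.prems assms by (intro normal_spine) (auto simp: object_level_ty_def dest: wt_not_is_Lam)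
  then show ?case
  proof (cases rule: spine.cases)
    case (11 F)
    \<comment> \<open>Otherwise \<open>F\<close> would be a spine, but no partial application of a
      constructor has type \<open>TI \<rightarrow>\<^sub>t TPrp\<close>.\<close>
    have "is_Lam F"
    proof (rule ccontr)
      assume "\<not> is_Lam F"
      then have "spine cs E F (TI \<rightarrow>\<^sub>t TPrp)"
        using less.prems 11 assms by (intro normal_spine) (auto simp: object_level_ty_def)
      then show False by (cases rule: spine.cases)
    qed
    then obtain B where B: "F = Lam B" by (cases F) auto
    have "goal B" using less.prems 11 B
      by (intro less.IH[of B "TI # E"]) (auto simp: object_level_ty_def)
    then show ?thesis using 11 B by (simp add: goal_all)
  qed (use less.prems in \<open>auto intro!: goal.intros less.IH[of _ E]\<close>)
qed

lemma normal_lst: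
  assumes "object_sig cs"
  shows "normal t \<Longrightarrow> wt cs [] t TAtmlst \<Longrightarrow> \<forall>v \<in> fv t. object_level_ty (snd v) \<Longrightarrow> \<exists>As. t = lst As"
proof (induction t rule: measure_induct_rule[where f = tmsize])
  case (less t)
  have "spine cs [] t TAtmlst"
    using less.prems assms by (intro normal_spine) (auto simp: object_level_ty_def dest: wt_not_is_Lam)
  then show ?case
  proof (cases rule: spine.cases)
    case 12
    then show ?thesis by (intro exI[of _ "[]"]) simp
  next
    case (15 A L)
    obtain As where "L = lst As" using less.IH[of L] less.prems 15 by auto
    then show ?thesis using 15 by (intro exI[of _ "A # As"]) simp
  qed
qed

lemma goal_nf:
  assumes "object_sig cs" "object_term cs B TPrp"
  shows "goal (nf B)"
  using assms normal_goal[of cs "nf B" "[]"] normal_nf wt_nf fv_nf unfolding object_term_def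
  by (metis empty_iff list.set(1) subset_eq)

lemma lst_nf:
  assumes "object_sig cs" "object_term cs L TAtmlst"
  shows "\<exists>As. nf L = lst As"
  using assms normal_lst[of cs "nf L"] normal_nf wt_nf fv_nf unfolding object_term_def
  by (metis subset_eq)

lemma is_sub_comp:
  assumes "is_sub cs \<theta>" "is_sub cs \<sigma>"
  shows "is_sub cs (\<lambda>v. tsub \<theta> (\<sigma> v))"
proof -
  have "wt cs [] (tsub \<theta> (\<sigma> v)) (snd v)" for v
    using assms wt_is_sub is_sub_wt by blast
  moreover have "finite {v. tsub \<theta> (\<sigma> v) \<noteq> Var v}"
  proof (rule finite_subset)
    show "{v. tsub \<theta> (\<sigma> v) \<noteq> Var v} \<subseteq> {v. \<sigma> v \<noteq> Var v} \<union> {v. \<theta> v \<noteq> Var v}"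
    proof
      fix v assume "v \<in> {v. tsub \<theta> (\<sigma> v) \<noteq> Var v}"
      then show "v \<in> {v. \<sigma> v \<noteq> Var v} \<union> {v. \<theta> v \<noteq> Var v}"
        by (cases "\<sigma> v = Var v") simp_all
    qed
    show "finite ({v. \<sigma> v \<noteq> Var v} \<union> {v. \<theta> v \<noteq> Var v})" using assms by (simp add: is_sub_def)
  qed
  ultimately show ?thesis unfolding is_sub_def by blast
qed

section \<open>Models of definitions\<close>

text \<open>
  Antecedents of implications are evaluated in \<open>N\<close>, everything else in \<open>X\<close>, so that satisfaction is
  monotone in \<open>X\<close>. Free variables denote themselves.
\<close>

function sat ::
  "('b, 'c) csig \<Rightarrow> ('p \<Rightarrow> ('b, 'c) tm list \<Rightarrow> bool) \<Rightarrow> ('p \<Rightarrow> ('b, 'c) tm list \<Rightarrow> bool) \<Rightarrow>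
   ('b, 'c, 'p) fm \<Rightarrow> bool" where
  "sat cs N X (Atom p ts) = X p ts"
| "sat cs N X Bot = False"
| "sat cs N X Top = True"
| "sat cs N X (And F G) = (sat cs N X F \<and> sat cs N X G)"
| "sat cs N X (Or F G) = (sat cs N X F \<or> sat cs N X G)"
| "sat cs N X (Imp F G) = (sat cs N N F \<longrightarrow> sat cs N X G)"
| "sat cs N X (All a F) = (\<forall>t. wt cs [] t a \<longrightarrow> sat cs N X F\<lparr>t\<rparr>)"
| "sat cs N X (Ex a F) = (\<exists>t. wt cs [] t a \<and> sat cs N X F\<lparr>t\<rparr>)"
  by pat_completeness auto
termination by (relation "measure (\<lambda>(cs, N, X, F). fsize F)") auto

lemma sat_mono: "X \<le> Y \<Longrightarrow> sat cs N X F \<Longrightarrow> sat cs N Y F"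
proof (induction F rule: measure_induct_rule[where f = fsize])
  case (less F)
  show ?case
  proof (cases F)
    case (Atom p ts)
    then show ?thesis using less.prems by (auto simp: le_fun_def)
  next
    case (All a G)
    then show ?thesis using less.IH[of "G\<lparr>_\<rparr>"] less.prems by auto
  next
    case (Ex a G)
    then show ?thesis using less.IH[of "G\<lparr>_\<rparr>"] less.prems by auto
  qed (use less in auto)
qed

lemma level_inst [simp]: "level l (fm_inst_at F t k) = level l F"
  by (induction F arbitrary: t k) auto

lemma level_sub [simp]: "level l (fm_sub \<theta> F) = level l F"
  by (induction F) auto

text \<open>The successor in the level of an implication is used here: antecedents lie strictly
  below the level of the whole formula, so \<open>N\<close> is consulted only there.\<close>

lemma sat_level_cong:
  assumes "\<And>p ts. l p < level l F \<Longrightarrow> N p ts = N' p ts" "\<And>p ts. l p \<le> level l F \<Longrightarrow> X p ts = X' p ts"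
  shows "sat cs N X F = sat cs N' X' F"
  using assms
proof (induction F arbitrary: X X' rule: measure_induct_rule[where f = fsize])
  case (less F)
  show ?case
  proof (cases F)
    case (And G H)
    then have "sat cs N X G = sat cs N' X' G" "sat cs N X H = sat cs N' X' H"
      using less.prems by (intro less.IH; simp)+
    then show ?thesis using And by simp
  next
    case (Or G H)
    then have "sat cs N X G = sat cs N' X' G" "sat cs N X H = sat cs N' X' H"
      using less.prems by (intro less.IH; simp)+
    then show ?thesis using Or by simp
  next
    case (Imp G H)
    then have "sat cs N N G = sat cs N' N' G" "sat cs N X H = sat cs N' X' H"
      using less.prems by (intro less.IH; simp)+
    then show ?thesis using Imp by simp
  next
    case (All a G)
    then have "sat cs N X G\<lparr>t\<rparr> = sat cs N' X' G\<lparr>t\<rparr>" for t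
      using less.prems by (intro less.IH; simp)
    then show ?thesis using All by simp
  next
    case (Ex a G)
    then have "sat cs N X G\<lparr>t\<rparr> = sat cs N' X' G\<lparr>t\<rparr>" for t
      using less.prems by (intro less.IH; simp)
    then show ?thesis using Ex by simp
  qed (use less.prems in auto)
qed

primrec num :: "nat \<Rightarrow> ('b, 'c) tm" where
  "num 0 = zero"
| "num (Suc n) = succ (num n)"

lemma wt_num [simp]: "wt cs E (num n) TNt"
  by (induction n) (auto simp: wt_App_iff)

text \<open>The two directions of \<open>model_def\<close> validate \<open>defR\<close> and
  \<open>defL\<close>; \<open>model_nat\<close> validates the rules for \<open>nat\<close>,
  induction included.\<close>

locale definition_model =
  fixes cs :: "('b, 'c) csig" and D :: "('b, 'c, 'q) clause set"
    and M :: "'q prd \<Rightarrow> ('b, 'c) tm list \<Rightarrow> bool"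
  assumes clause_not_nat: "c \<in> D \<Longrightarrow> cprd c \<noteq> PNat"
    and model_nat: "M PNat ts \<longleftrightarrow> (\<exists>k. list_all2 (\<approx>) ts [num k])"
    and model_def: "p \<noteq> PNat \<Longrightarrow> M p ts \<longleftrightarrow>
      (\<exists>c \<in> D. \<exists>\<theta>. is_sub cs \<theta> \<and> fm_conv (Atom p ts) (fm_sub \<theta> (chead c)) \<and>
        sat cs M M (fm_sub \<theta> (cbody c)))"

text \<open>The level condition makes the least fixed point exist stratum by stratum.\<close>

theorem definition_model_exists:
  fixes D :: "('b, 'c, 'q) clause set"
  assumes "is_definition cs qs D"
  shows "\<exists>M. definition_model cs D M"
proof -
  obtain l where l: "\<And>c. c \<in> D \<Longrightarrow> level l (cbody c) \<le> l (cprd c)"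
    using assms unfolding is_definition_def by blast
  \<comment> \<open>Strata below \<open>n\<close> are copied from \<open>N\<close>, stratum
    \<open>n\<close> is evaluated by the clauses, and everything above is false. Antecedents are
    read in the fixed \<open>N\<close>, which is what makes the operator monotone in
    \<open>X\<close>.\<close>
  define step where "step = (\<lambda>n N X p ts. l p < n \<and> N p ts \<or>
    l p = n \<and> (if p = PNat then \<exists>k. list_all2 (\<approx>) ts [num k]
      else \<exists>c \<in> D. \<exists>\<theta>. is_sub cs \<theta> \<and> fm_conv (Atom p ts) (fm_sub \<theta> (chead c)) \<and>
        sat cs N X (fm_sub \<theta> (cbody c))))"
  have mono: "mono (step n N)" for n N
  proof (rule monoI)
    fix X Y :: "'q prd \<Rightarrow> ('b, 'c) tm list \<Rightarrow> bool"
    assume "X \<le> Y"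
    then have "sat cs N X F \<Longrightarrow> sat cs N Y F" for F by (rule sat_mono)
    then show "step n N X \<le> step n N Y" unfolding step_def le_fun_def le_bool_def by (smt (verit))
  qed
  define stage where "stage = rec_nat (\<lambda>_ _. False) (\<lambda>n N. lfp (step n N))"
  have stage_Suc: "stage (Suc n) = step n (stage n) (stage (Suc n))" for n
    using lfp_unfold[OF mono, of n "stage n"] by (simp add: stage_def)
  \<comment> \<open>Stage \<open>n\<close> settles the predicates of level below \<open>n\<close>,
    so \<open>Suc (l p)\<close> is the first stage that settles \<open>p\<close>.\<close>
  define M where "M = (\<lambda>p ts. stage (Suc (l p)) p ts)"
  have stage_M: "l p < n \<Longrightarrow> stage n p ts = M p ts" for n p ts
  proof (induction n)
    case (Suc n)
    then show ?case
      by (cases "l p = n") (auto simp: M_def fun_cong[OF fun_cong[OF stage_Suc[of n]]] step_def)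
  qed simp
  have M: "M p ts = step (l p) (stage (l p)) (stage (Suc (l p))) p ts" for p ts
    unfolding M_def by (subst stage_Suc) (rule refl)
  \<comment> \<open>Antecedents have level below \<open>n\<close> and are final at stage
    \<open>n\<close>; the remaining atoms have level at most \<open>n\<close> and are final one
    stage later.\<close>
  have sat_M: "sat cs (stage n) (stage (Suc n)) F = sat cs M M F" if "level l F \<le> n" for n F
    using that by (intro sat_level_cong[of l]) (auto simp: stage_M)
  have "definition_model cs D M"
  proof
    fix c assume "c \<in> D"
    then show "cprd c \<noteq> PNat" using assms unfolding is_definition_def by blast
  next
    fix ts show "M PNat ts \<longleftrightarrow> (\<exists>k. list_all2 (\<approx>) ts [num k])"
      by (simp add: M step_def)
  next
    fix p :: "'q prd" and ts
    assume p: "p \<noteq> PNat"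
    have "sat cs (stage (l p)) (stage (Suc (l p))) (fm_sub \<theta> (cbody c)) = sat cs M M (fm_sub \<theta> (cbody c))"
      if "c \<in> D" "fm_conv (Atom p ts) (fm_sub \<theta> (chead c))" for c \<theta>
      using that l[of c] by (intro sat_M) (auto simp: chead_def)
    then show "M p ts \<longleftrightarrow>
      (\<exists>c \<in> D. \<exists>\<theta>. is_sub cs \<theta> \<and> fm_conv (Atom p ts) (fm_sub \<theta> (chead c)) \<and>
        sat cs M M (fm_sub \<theta> (cbody c)))"
      using p by (auto simp: M step_def)
  qed
  then show ?thesis by blast
qed

section \<open>Soundness of the sequent calculus in a model\<close>

context definition_model
begin

abbreviation tr :: "('b, 'c, 'q) form \<Rightarrow> bool" where "tr \<equiv> sat cs M M"

text \<open>One unfolding suffices, without induction, because clause heads and numerals are matched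
  up to conversion.\<close>

lemma model_conv:
  assumes "M p ts" "list_all2 (\<approx>) ts us"
  shows "M p us"
proof -
  from assms(2) have "fm_conv (Atom p ts) (Atom p us)" by simp
  then have conv: "fm_conv (Atom p us) (Atom p ts)" by (rule fm_conv_sym)
  show ?thesis
  proof (cases "p = PNat")
    case True
    with assms(1) obtain k where "list_all2 (\<approx>) ts [num k]" using model_nat by blast
    then have "fm_conv (Atom p ts) (Atom p [num k])" by simp
    from fm_conv_trans[OF conv this] show ?thesis using True model_nat by auto
  next
    case False
    with assms(1) obtain c \<theta> where c: "c \<in> D" "is_sub cs \<theta>" "sat cs M M (fm_sub \<theta> (cbody c))"
      "fm_conv (Atom p ts) (fm_sub \<theta> (chead c))"
      using model_def by blast
    from fm_conv_trans[OF conv c(4)] show ?thesis using c(1-3) False model_def by blast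
  qed
qed

lemma tr_conv: "fm_conv F G \<Longrightarrow> tr F \<longleftrightarrow> tr G"
proof (induction F arbitrary: G rule: measure_induct_rule[where f = fsize])
  case (less F)
  show ?case
  proof (cases F)
    case (Atom p ts)
    with less.prems obtain us where us: "G = Atom p us" "list_all2 (\<approx>) ts us"
      by (auto elim: fm_conv_AtomE)
    moreover have "list_all2 (\<approx>) us ts" using us(2) by (auto simp: list_all2_conv_all_nth intro: conv_sym)
    ultimately show ?thesis using Atom model_conv by auto
  next
    case (And F1 F2)
    with less show ?thesis by (auto elim!: fm_conv_AndE)
  next
    case (Or F1 F2)
    with less show ?thesis by (auto elim!: fm_conv_OrE)
  next
    case (Imp F1 F2)
    with less show ?thesis by (auto elim!: fm_conv_ImpE)
  next
    case (All a F1)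
    with less.prems obtain G1 where "G = All a G1" "fm_conv F1 G1" by (auto elim: fm_conv_AllE)
    moreover then have "tr F1\<lparr>t\<rparr> \<longleftrightarrow> tr G1\<lparr>t\<rparr>" for t
      using All by (intro less.IH fm_conv_inst_left) auto
    ultimately show ?thesis using All by simp
  next
    case (Ex a F1)
    with less.prems obtain G1 where "G = Ex a G1" "fm_conv F1 G1" by (auto elim: fm_conv_ExE)
    moreover then have "tr F1\<lparr>t\<rparr> \<longleftrightarrow> tr G1\<lparr>t\<rparr>" for t
      using Ex by (intro less.IH fm_conv_inst_left) auto
    ultimately show ?thesis using Ex by simp
  qed (use less.prems in \<open>auto elim: fm_conv.cases\<close>)
qed

text \<open>
  An instance of a defined atom and an instance of a clause head that make it true combine, the
  clause being renamed apart, to a unifier, which factors through the complete set.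
\<close>

lemma defL_sound:
  assumes "p \<noteq> PNat" "is_sub cs \<theta>" "tr (fm_sub \<theta> (Atom p us))"
    and variant: "\<And>c. c \<in> D \<Longrightarrow> is_variant c (ren c)"
    and apart: "\<And>c. c \<in> D \<Longrightarrow> cfv (ren c) \<inter> V = {}" and V: "fm_fv (Atom p us) \<subseteq> V"
    and csu: "\<And>c. c \<in> D \<Longrightarrow> is_csu cs (Atom p us) (chead (ren c)) (U c)"
  obtains c \<theta>' \<delta> where "c \<in> D" "\<theta>' \<in> U c" "is_sub cs \<delta>"
    "tr (fm_sub \<delta> (fm_sub \<theta>' (cbody (ren c))))"
    "\<And>F. fm_fv F \<subseteq> V \<Longrightarrow> tr (fm_sub \<delta> (fm_sub \<theta>' F)) \<longleftrightarrow> tr (fm_sub \<theta> F)"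
proof -
  from assms(1,3) obtain c \<sigma> where c: "c \<in> D" and \<sigma>: "is_sub cs \<sigma>"
    and head: "fm_conv (fm_sub \<theta> (Atom p us)) (fm_sub \<sigma> (chead c))"
    and body: "tr (fm_sub \<sigma> (cbody c))"
    using model_def[of p "map (tsub \<theta>) us"] by auto
  obtain \<rho> where \<rho>: "inj_on \<rho> (cfv c)" "\<And>v. snd (\<rho> v) = snd v"
    and ren: "ren c = Clause (cprd c) (map (tsub (Var \<circ> \<rho>)) (cargs c)) (fm_sub (Var \<circ> \<rho>) (cbody c))"
    using variant[OF c] unfolding is_variant_def by blast
  \<comment> \<open>The combined unifier: on the renamed variables it undoes the renaming and acts
    as \<open>\<sigma>\<close>, elsewhere it acts as \<open>\<theta>\<close>. The clause is renamed
    apart, so it agrees with \<open>\<theta>\<close> on all of \<open>V\<close>.\<close>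
  define \<tau> where "\<tau> = (\<lambda>v. if v \<in> \<rho> ` cfv c then \<sigma> (the_inv_into (cfv c) \<rho> v) else \<theta> v)"
  have \<tau>_\<rho>: "\<tau> (\<rho> v) = \<sigma> v" if "v \<in> cfv c" for v
    using that \<rho>(1) by (simp add: \<tau>_def the_inv_into_f_f)
  have fv_tsub: "fv (tsub (Var \<circ> \<rho>) t) = \<rho> ` fv t" for t :: "('b, 'c) tm"
    by (induction t) auto
  have fm_fv_sub: "fm_fv (fm_sub (Var \<circ> \<rho>) F) = \<rho> ` fm_fv F" for F :: "('b, 'c, 'q) form"
    by (induction F) (simp_all add: fv_tsub[unfolded o_def] image_UN image_Un)
  have chead_ren: "chead (ren c) = fm_sub (Var \<circ> \<rho>) (chead c)" by (simp add: ren chead_def)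
  have cfv_ren: "cfv (ren c) = \<rho> ` cfv c"
    unfolding cfv_def chead_ren fm_fv_sub by (simp add: ren fm_fv_sub image_Un)
  have sub_ren: "fm_sub \<tau> (fm_sub (Var \<circ> \<rho>) F) = fm_sub \<sigma> F" if "fm_fv F \<subseteq> cfv c"
    for F :: "('b, 'c, 'q) form"
    unfolding fm_sub_fm_sub using that \<tau>_\<rho> by (intro fm_sub_cong) auto
  have sub_V: "fm_sub \<tau> F = fm_sub \<theta> F" if "fm_fv F \<subseteq> V" for F :: "('b, 'c, 'q) form"
    using that apart[OF c] cfv_ren by (intro fm_sub_cong) (auto simp: \<tau>_def)
  have fin: "finite (cfv c)" by (simp add: cfv_def)
  have "is_sub cs \<tau>"
  proof -
    have "wt cs [] (\<tau> v) (snd v)" for v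
    proof (cases "v \<in> \<rho> ` cfv c")
      case True
      then obtain w where "w \<in> cfv c" "v = \<rho> w" by blast
      then show ?thesis using \<tau>_\<rho> \<rho>(2) is_sub_wt[OF \<sigma>, of w] by simp
    next
      case False
      then show ?thesis using is_sub_wt[OF assms(2)] by (simp add: \<tau>_def)
    qed
    moreover have "finite {v. \<tau> v \<noteq> Var v}"
    proof (rule finite_subset)
      show "{v. \<tau> v \<noteq> Var v} \<subseteq> \<rho> ` cfv c \<union> {v. \<theta> v \<noteq> Var v}" by (auto simp: \<tau>_def)
      show "finite (\<rho> ` cfv c \<union> {v. \<theta> v \<noteq> Var v})" using fin assms(2) by (simp add: is_sub_def)
    qed
    ultimately show ?thesis unfolding is_sub_def by blast
  qed
  moreover have "fm_sub \<tau> (chead (ren c)) = fm_sub \<sigma> (chead c)"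
    unfolding chead_ren by (rule sub_ren) (simp add: cfv_def)
  ultimately have "unifier cs (Atom p us) (chead (ren c)) \<tau>"
    using head unfolding unifier_def sub_V[OF V] by simp
  then obtain \<theta>' \<delta> where \<theta>': "\<theta>' \<in> U c" "is_sub cs \<delta>" "\<And>v. \<tau> v \<approx> tsub \<delta> (\<theta>' v)"
    using csu[OF c] unfolding is_csu_def by blast
  \<comment> \<open>Factoring through the complete set holds only up to conversion, which truth does
    not notice.\<close>
  have factor: "tr (fm_sub \<delta> (fm_sub \<theta>' F)) \<longleftrightarrow> tr (fm_sub \<tau> F)" for F
    unfolding fm_sub_fm_sub by (rule tr_conv[OF fm_conv_sub_right[OF conv_sym[OF \<theta>'(3)]]])
  have "fm_sub \<tau> (cbody (ren c)) = fm_sub \<sigma> (cbody c)"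
    using sub_ren[of "cbody c"] by (simp add: ren cfv_def)
  then show thesis using that[OF c \<theta>'(1,2)] factor body sub_V by simp
qed

text \<open>Quantifying over all \<open>\<theta>\<close> is essential: eigenvariables are handled by
  updating \<open>\<theta>\<close>, and the premises of \<open>defL\<close> are evaluated under the
  remainder \<open>\<delta>\<close> of a factorization.\<close>

theorem derivable_sound:
  "derivable cs qs D \<Gamma> C \<Longrightarrow> is_sub cs \<theta> \<Longrightarrow> \<forall>F \<in># \<Gamma>. tr (fm_sub \<theta> F) \<Longrightarrow> tr (fm_sub \<theta> C)"
proof (induction arbitrary: \<theta> rule: derivable.induct)
  case (conv \<Gamma> B \<Gamma>' B')
  note lc = is_sub_lc[OF conv.prems(1)]
  have "tr (fm_sub \<theta> F)" if F: "F \<in># \<Gamma>" for F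
  proof -
    obtain xs ys where "mset xs = \<Gamma>" "mset ys = \<Gamma>'" "list_all2 fm_conv xs ys"
      using conv.hyps(2) unfolding rel_mset_def by blast
    then obtain G where "G \<in># \<Gamma>'" "fm_conv F G" using F
      by (metis in_set_conv_nth list_all2_conv_all_nth set_mset_mset)
    then show ?thesis using conv.prems(2) tr_conv fm_conv_sub_left[of \<theta>, OF lc] by blast
  qed
  then have "tr (fm_sub \<theta> B)" using conv.IH conv.prems(1) by blast
  then show ?case using tr_conv fm_conv_sub_left[of \<theta>, OF lc conv.hyps(3)] by blast
next
  case (allL t a B \<Gamma> C)
  have "tr (fm_sub \<theta> B)\<lparr>tsub \<theta> t\<rparr>" using allL.prems allL.hyps(1) wt_is_sub by fastforce
  then show ?case using allL.prems allL.IH by (simp add: fm_sub_inst is_sub_lc)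
next
  case (allR \<Gamma> B y a)
  have "tr (fm_sub \<theta> B)\<lparr>t\<rparr>" if t: "wt cs [] t a" for t
  proof -
    define \<theta>' where "\<theta>' = \<theta>((y, a) := t)"
    have "is_sub cs \<theta>'" unfolding \<theta>'_def using allR.prems(1) t by (intro is_sub_upd) auto
    moreover have "fm_sub \<theta>' F = fm_sub \<theta> F" if "F \<in># \<Gamma>" for F
      unfolding \<theta>'_def using that allR.hyps(2) by (intro fm_sub_cong) (auto simp: mfv_def)
    ultimately have "tr (fm_sub \<theta>' B\<lparr>Var (y, a)\<rparr>)" using allR.prems by (intro allR.IH) auto
    also have "fm_sub \<theta>' B\<lparr>Var (y, a)\<rparr> = (fm_sub \<theta> B)\<lparr>t\<rparr>"
      unfolding \<theta>'_def using allR.hyps(2) allR.prems(1) t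
      by (intro fm_sub_upd_inst_Var) (auto intro: is_sub_lc wt_lc)
    finally show ?thesis .
  qed
  then show ?case by simp
next
  case (exL B y a \<Gamma> C)
  then obtain t where t: "wt cs [] t a" "tr (fm_sub \<theta> B)\<lparr>t\<rparr>" by auto
  define \<theta>' where "\<theta>' = \<theta>((y, a) := t)"
  have "is_sub cs \<theta>'" unfolding \<theta>'_def using exL.prems(1) t by (intro is_sub_upd) auto
  moreover have eq: "fm_sub \<theta>' F = fm_sub \<theta> F" if "F \<in># \<Gamma> \<or> F = C" for F
    unfolding \<theta>'_def using that exL.hyps(2) by (intro fm_sub_cong) (auto simp: mfv_def)
  moreover have "fm_sub \<theta>' B\<lparr>Var (y, a)\<rparr> = (fm_sub \<theta> B)\<lparr>t\<rparr>"
    unfolding \<theta>'_def using exL.hyps(2) exL.prems(1) t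
    by (intro fm_sub_upd_inst_Var) (auto intro: is_sub_lc wt_lc)
  ultimately have "tr (fm_sub \<theta>' C)" using exL.prems t by (intro exL.IH) auto
  then show ?case using eq by simp
next
  case (exR t a \<Gamma> B)
  have "tr (fm_sub \<theta> B)\<lparr>tsub \<theta> t\<rparr>"
    using exR.IH[OF exR.prems] exR.prems(1) by (simp add: fm_sub_inst is_sub_lc)
  then show ?case using exR.hyps(1) exR.prems(1) wt_is_sub by fastforce
next
  case (natZ \<Gamma>)
  have "list_all2 (\<approx>) [zero] [num 0]" by (simp add: conv_refl)
  then have "M PNat [zero]" unfolding model_nat by blast
  then show ?case by simp
next
  case (natS \<Gamma> t)
  then have "M PNat [tsub \<theta> t]" by simp
  then obtain k where "tsub \<theta> t \<approx> num k" by (auto simp: model_nat)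
  then have "list_all2 (\<approx>) [succ (tsub \<theta> t)] [num (Suc k)]" by (simp add: conv_refl)
  then have "M PNat [succ (tsub \<theta> t)]" unfolding model_nat by blast
  then show ?case by simp
next
  case (natL B j t \<Gamma> C)
  note lc = is_sub_lc[OF natL.prems(1)]
  have "M PNat [tsub \<theta> t]" using natL.prems(2) by simp
  then obtain k where k: "tsub \<theta> t \<approx> num k" by (auto simp: model_nat)
  \<comment> \<open>The invariant holds at every numeral by induction outside the calculus. The step
    premise has no side formulas, so updating the eigenvariable to \<open>num n\<close> leaves
    nothing else to verify.\<close>
  have "tr (fm_sub \<theta> B)\<lparr>num n\<rparr>" for n
  proof (induction n)
    case 0
    then show ?case using natL.IH(1)[OF natL.prems(1)] by (simp add: fm_sub_inst lc)
  next
    case (Suc n)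
    define \<theta>' where "\<theta>' = \<theta>((j, TNt) := num n)"
    have sub: "is_sub cs \<theta>'" unfolding \<theta>'_def using natL.prems(1) by (intro is_sub_upd) auto
    have B: "fm_sub \<theta>' B = fm_sub \<theta> B"
      unfolding \<theta>'_def using natL.hyps(4) by (intro fm_sub_cong) auto
    have j: "\<theta>' (j, TNt) = num n" by (simp add: \<theta>'_def)
    have "tr (fm_sub \<theta>' B\<lparr>succ (Var (j, TNt))\<rparr>)"
      using Suc sub B j by (intro natL.IH(2)) (auto simp: fm_sub_inst is_sub_lc[OF sub])
    then show ?case using B j by (simp add: fm_sub_inst is_sub_lc[OF sub])
  qed
  then have "tr (fm_sub \<theta> B)\<lparr>tsub \<theta> t\<rparr>" using k tr_conv fm_conv_inst_right by blast
  then show ?case using natL.IH(3)[OF natL.prems(1)] natL.prems(2) by (simp add: fm_sub_inst lc)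
next
  case (defR c \<sigma> p us \<Gamma>)
  have p: "p = cprd c" using defR.hyps(3) by (simp add: chead_def)
  have "fm_conv (Atom p (map (tsub \<theta>) us)) (fm_sub \<theta> (fm_sub \<sigma> (chead c)))"
    using fm_conv_sub_left[OF is_sub_lc[OF defR.prems(1)] defR.hyps(3)] by simp
  moreover have "is_sub cs (\<lambda>v. tsub \<theta> (\<sigma> v))" using defR.prems(1) defR.hyps(2) by (rule is_sub_comp)
  moreover have "tr (fm_sub \<theta> (fm_sub \<sigma> (cbody c)))" using defR.IH defR.prems by blast
  ultimately have "M p (map (tsub \<theta>) us)"
    unfolding fm_sub_fm_sub using clause_not_nat[OF defR.hyps(1)] defR.hyps(1) p
    by (subst model_def) auto
  then show ?case by simp
next
  case (defL p us \<Gamma> C ren U)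
  have true: "tr (fm_sub \<theta> (Atom p us))" using defL.prems(2) by simp
  have V: "fm_fv (Atom p us) \<subseteq> mfv (add_mset (Atom p us) \<Gamma>) \<union> fm_fv C" by (auto simp: mfv_def)
  obtain c \<theta>' \<delta> where *: "c \<in> D" "\<theta>' \<in> U c" "is_sub cs \<delta>"
    "tr (fm_sub \<delta> (fm_sub \<theta>' (cbody (ren c))))"
    "\<And>F. fm_fv F \<subseteq> mfv (add_mset (Atom p us) \<Gamma>) \<union> fm_fv C \<Longrightarrow>
      tr (fm_sub \<delta> (fm_sub \<theta>' F)) \<longleftrightarrow> tr (fm_sub \<theta> F)"
    by (rule defL_sound[OF defL.hyps(1) defL.prems(1) true defL.hyps(3,4) V defL.hyps(5)]) (assumption | rule that)+
  have "tr (fm_sub \<delta> (fm_sub \<theta>' F))" if "F \<in># \<Gamma>" for F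
    using that *(5)[of F] defL.prems(2) by (auto simp: mfv_def)
  then have "tr (fm_sub \<delta> (fm_sub \<theta>' C))"
    using * by (intro defL.IH[of c \<theta>' \<delta>]) auto
  then show ?case using *(5)[of C] by blast
qed auto

end

section \<open>From truth in the model to intuitionistic provability\<close>

lemma close_all_Nil [simp]: "close_all [] F = F"
  and close_all_Cons [simp]: "close_all (v # vs) F = All (snd v) (fm_bind v (close_all vs F) 0)"
  by (simp_all add: close_all_def)

text \<open>\<open>\<theta>\<close> collects the instances chosen for the outer quantifiers. The
  terms \<open>\<sigma> v\<close> become values of a substitution and are never substituted into, so
  the result is simultaneous even if they mention variables of \<open>xs\<close>.\<close>

lemma nj_close_all:
  assumes "is_sub cs \<sigma>"
  shows "is_sub cs \<theta> \<Longrightarrow> nj cs \<Gamma> (fm_sub \<theta> (close_all xs F)) \<Longrightarrow>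
    nj cs \<Gamma> (fm_sub (\<lambda>v. if v \<in> set xs then \<sigma> v else \<theta> v) F)"
proof (induction xs arbitrary: \<theta>)
  case (Cons v vs)
  let ?\<theta> = "\<theta>(v := \<sigma> v)"
  have sub: "is_sub cs ?\<theta>" using Cons.prems(1) is_sub_wt[OF assms] by (rule is_sub_upd)
  have "nj cs \<Gamma> (All (snd v) (fm_sub \<theta> (fm_bind v (close_all vs F) 0)))" using Cons.prems(2) by simp
  then have "nj cs \<Gamma> (fm_sub \<theta> (fm_bind v (close_all vs F) 0))\<lparr>\<sigma> v\<rparr>"
    using is_sub_wt[OF assms] by (rule nj_allE)
  also have "(fm_sub \<theta> (fm_bind v (close_all vs F) 0))\<lparr>\<sigma> v\<rparr> = fm_sub ?\<theta> (close_all vs F)"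
    using is_sub_lc[OF Cons.prems(1)] is_sub_lc[OF assms] by (rule fm_inst_sub_bind)
  finally have "nj cs \<Gamma> (fm_sub (\<lambda>w. if w \<in> set vs then \<sigma> w else ?\<theta> w) F)"
    by (rule Cons.IH[OF sub])
  also have "(\<lambda>w. if w \<in> set vs then \<sigma> w else ?\<theta> w) = (\<lambda>w. if w \<in> set (v # vs) then \<sigma> w else \<theta> w)"
    by auto
  finally show ?case .
qed simp

lemma nj_close_all_inst:
  assumes "nj cs \<Gamma> (close_all xs F)" "is_sub cs \<sigma>" "fm_fv F \<subseteq> set xs"
  shows "nj cs \<Gamma> (fm_sub \<sigma> F)"
proof -
  have "nj cs \<Gamma> (fm_sub (\<lambda>v. if v \<in> set xs then \<sigma> v else Var v) F)"
    using nj_close_all[OF assms(2) is_sub_Var] assms(1) by simp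
  also have "fm_sub (\<lambda>v. if v \<in> set xs then \<sigma> v else Var v) F = fm_sub \<sigma> F"
    using assms(3) by (intro fm_sub_cong) auto
  finally show ?thesis .
qed

lemma
  assumes "object_sig cs" "is_prog_clause cs (xs, A, G)"
  shows prog_clause_goal: "goal (nf G)" and prog_clause_conv: "G \<approx> nf G"
    and prog_clause_wt: "wt cs [] A TAtm" "wt cs [] G TPrp" "wt cs [] (nf G) TPrp"
    and prog_clause_wff: "owff cs [] (Imp (prp_trans G) (oatom A))"
    and prog_clause_fv: "fm_fv (Imp (prp_trans G) (oatom A)) \<subseteq> set xs"
proof -
  have *: "object_term cs A TAtm" "object_term cs G TPrp" "fv A \<union> fv G \<subseteq> set xs"
    using assms(2) by (auto simp: is_prog_clause_def)
  then show wt: "wt cs [] A TAtm" "wt cs [] G TPrp" by (auto simp: object_term_def)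
  show goal: "goal (nf G)" using assms(1) *(2) by (rule goal_nf)
  show "G \<approx> nf G" "wt cs [] (nf G) TPrp" using wt(2) by (rule conv_nf wt_nf)+
  then show "owff cs [] (Imp (prp_trans G) (oatom A))"
    using wt goal goal_wff by (auto simp: prp_trans_def)
  show "fm_fv (Imp (prp_trans G) (oatom A)) \<subseteq> set xs"
    using goal_fv[OF goal] fv_nf[OF wt(2)] *(3) by (auto simp: prp_trans_def)
qed

lemma num_conv_succ: "num n \<approx> succ I \<longleftrightarrow> (\<exists>m. n = Suc m \<and> num m \<approx> I)"
  by (cases n) (auto simp: conv_refl)

locale object_logic =
  fixes cs :: "('b, 'c) csig" and prg :: "('b, 'c) prog_clause list"
    and D :: "('b, 'c, 'q) clause set"
  assumes sig: "object_sig cs"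
    and prg: "\<forall>c \<in> set prg. is_prog_clause cs c"
    and base: "base_def prg \<subseteq> D"
    and fixed: "\<forall>c \<in> D - base_def prg. cprd c \<notin> {PNat, PSeq, PElement, PProg}"
begin

abbreviation ctx :: "('b, 'c) tm list \<Rightarrow> ('b, 'c) ofm set" where
  "ctx As \<equiv> oatom ` set As \<union> prog_theory prg"

lemma wff_prog_theory: "F \<in> prog_theory prg \<Longrightarrow> owff cs [] F"
  using prg prog_clause_wff[OF sig] by (auto simp: prog_theory_def intro!: wff_close_all)

lemma finite_prog_theory: "finite (prog_theory prg)"
proof -
  have "prog_theory prg = (\<lambda>(xs, A, G). close_all xs (Imp (prp_trans G) (oatom A))) ` set prg"
    by (force simp: prog_theory_def)
  then show ?thesis by simp
qed

end

locale object_logic_model = object_logic cs prg D + definition_model cs D M for cs prg D M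
begin

text \<open>Clauses for \<open>PSeq\<close> come from \<open>D_intuit\<close> alone, so each case is
  one of its clauses. The list that a clause variable denotes is convertible to \<open>L\<close>,
  and the premises are restated for \<open>L\<close> by \<open>model_conv\<close>.\<close>

lemma model_seqE:
  assumes "M PSeq [t, L, B]"
  obtains (init) A A' L' where "L \<approx> lcons A' L'" "B \<approx> Con CAtom \<cdot> A" "M PElement [A, L]"
  | (tt) "B \<approx> Con CTt"
  | ("and") I B1 B2 where "t \<approx> succ I" "B \<approx> Con CAnd \<cdot> B1 \<cdot> B2" "M PSeq [I, L, B1]" "M PSeq [I, L, B2]"
  | (imp) I A B1 where "t \<approx> succ I" "B \<approx> Con CImp \<cdot> A \<cdot> B1" "M PSeq [I, lcons A L, B1]"
  | (all) I F where "t \<approx> succ I" "B \<approx> Con CAll \<cdot> F" "\<And>x. wt cs [] x TI \<Longrightarrow> M PSeq [I, L, F \<cdot> x]"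
  | (prog) I A b where "t \<approx> succ I" "B \<approx> Con CAtom \<cdot> A" "M PProg [A, b]" "M PSeq [I, L, b]"
proof -
  from assms obtain c \<theta> where c: "c \<in> D" and \<theta>: "is_sub cs \<theta>"
    and head: "fm_conv (Atom PSeq [t, L, B]) (fm_sub \<theta> (chead c))"
    and body: "tr (fm_sub \<theta> (cbody c))"
    by (auto simp: model_def)
  have "cprd c = PSeq" using head by (simp add: chead_def)
  then have "c \<in> D_intuit"
    using c fixed by (auto simp: base_def_def D_nat_def D_list_def D_prog_def Let_def)
  note lc = is_sub_lc[OF \<theta>]
  have seq: "M PSeq [a, L, b]" if "M PSeq [a, L', b]" "L \<approx> L'" for a b L'
    using that(2) by (intro model_conv[OF that(1)]) (simp add: conv_refl conv_sym)
  from \<open>c \<in> D_intuit\<close> show thesis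
    unfolding D_intuit_def Let_def
  proof (elim insertE)
    assume "c = Clause PSeq [Var (0, TNt), lcons (Var (1, TAtm)) (Var (0, TAtmlst)), Con CAtom \<cdot> Var (0, TAtm)]
      (Atom PElement [Var (0, TAtm), lcons (Var (1, TAtm)) (Var (0, TAtmlst))])"
    with head body have *: "L \<approx> lcons (\<theta> (1, TAtm)) (\<theta> (0, TAtmlst))" "B \<approx> Con CAtom \<cdot> \<theta> (0, TAtm)"
      "M PElement [\<theta> (0, TAtm), lcons (\<theta> (1, TAtm)) (\<theta> (0, TAtmlst))]"
      by (simp_all add: chead_def)
    have "M PElement [\<theta> (0, TAtm), L]"
      using *(1) by (intro model_conv[OF *(3)]) (simp add: conv_refl conv_sym)
    with * init show thesis by blast
  next
    assume "c = Clause PSeq [Var (0, TNt), Var (0, TAtmlst), Con CTt] Top"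
    with head tt show thesis by (simp add: chead_def)
  next
    assume "c = Clause PSeq [succ (Var (0, TNt)), Var (0, TAtmlst), Con CAnd \<cdot> Var (0, TPrp) \<cdot> Var (1, TPrp)]
      (And (Atom PSeq [Var (0, TNt), Var (0, TAtmlst), Var (0, TPrp)])
        (Atom PSeq [Var (0, TNt), Var (0, TAtmlst), Var (1, TPrp)]))"
    with head body show thesis
      by (intro "and"[of "\<theta> (0, TNt)" "\<theta> (0, TPrp)" "\<theta> (1, TPrp)"] seq[of _ "\<theta> (0, TAtmlst)"])
        (simp_all add: chead_def)
  next
    assume "c = Clause PSeq [succ (Var (0, TNt)), Var (0, TAtmlst), Con CImp \<cdot> Var (0, TAtm) \<cdot> Var (0, TPrp)]
      (Atom PSeq [Var (0, TNt), lcons (Var (0, TAtm)) (Var (0, TAtmlst)), Var (0, TPrp)])"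
    with head body have *: "t \<approx> succ (\<theta> (0, TNt))" "L \<approx> \<theta> (0, TAtmlst)"
      "B \<approx> Con CImp \<cdot> \<theta> (0, TAtm) \<cdot> \<theta> (0, TPrp)"
      "M PSeq [\<theta> (0, TNt), lcons (\<theta> (0, TAtm)) (\<theta> (0, TAtmlst)), \<theta> (0, TPrp)]"
      by (simp_all add: chead_def)
    have "M PSeq [\<theta> (0, TNt), lcons (\<theta> (0, TAtm)) L, \<theta> (0, TPrp)]"
      using *(2) by (intro model_conv[OF *(4)]) (simp add: conv_refl conv_sym)
    with * imp show thesis by blast
  next
    assume "c = Clause PSeq [succ (Var (0, TNt)), Var (0, TAtmlst), Con CAll \<cdot> Var (0, TI \<rightarrow>\<^sub>t TPrp)]
      (All TI (Atom PSeq [Var (0, TNt), Var (0, TAtmlst), Var (0, TI \<rightarrow>\<^sub>t TPrp) \<cdot> Bnd 0]))"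
    with head body show thesis
      by (intro all[of "\<theta> (0, TNt)" "\<theta> (0, TI \<rightarrow>\<^sub>t TPrp)"] seq[of _ "\<theta> (0, TAtmlst)"])
        (simp_all add: chead_def lc)
  next
    assume "c = Clause PSeq [succ (Var (0, TNt)), Var (0, TAtmlst), Con CAtom \<cdot> Var (0, TAtm)]
      (Ex TPrp (And (Atom PProg [Var (0, TAtm), Bnd 0]) (Atom PSeq [Var (0, TNt), Var (0, TAtmlst), Bnd 0])))"
    with head body obtain b where *: "t \<approx> succ (\<theta> (0, TNt))" "L \<approx> \<theta> (0, TAtmlst)"
      "B \<approx> Con CAtom \<cdot> \<theta> (0, TAtm)" "M PProg [\<theta> (0, TAtm), b]" "M PSeq [\<theta> (0, TNt), \<theta> (0, TAtmlst), b]"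
      by (auto simp: chead_def lc)
    with prog seq show thesis by blast
  qed simp
qed

lemma model_element: "M PElement [X, lst As] \<Longrightarrow> \<exists>A \<in> set As. X \<approx> A"
proof (induction As)
  case (Cons A As)
  from Cons.prems obtain c \<theta> where c: "c \<in> D" and \<theta>: "is_sub cs \<theta>"
    and head: "fm_conv (Atom PElement [X, lst (A # As)]) (fm_sub \<theta> (chead c))"
    and body: "tr (fm_sub \<theta> (cbody c))"
    by (auto simp: model_def)
  have "cprd c = PElement" using head by (simp add: chead_def)
  then have "c \<in> D_list"
    using c fixed by (auto simp: base_def_def D_nat_def D_intuit_def D_prog_def Let_def)
  with \<open>cprd c = PElement\<close> consider
    "c = Clause PElement [Var (0, TAtm), lcons (Var (0, TAtm)) (Var (0, TAtmlst))] Top"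
  | "c = Clause PElement [Var (0, TAtm), lcons (Var (1, TAtm)) (Var (0, TAtmlst))]
      (Atom PElement [Var (0, TAtm), Var (0, TAtmlst)])"
    by (auto simp: D_list_def Let_def)
  then show ?case
  proof cases
    case 1
    with head have "X \<approx> \<theta> (0, TAtm)" "A \<approx> \<theta> (0, TAtm)" by (simp_all add: chead_def)
    then have "X \<approx> A" using conv_sym conv_trans by blast
    then show ?thesis by simp
  next
    case 2
    with head body have *: "X \<approx> \<theta> (0, TAtm)" "lst As \<approx> \<theta> (0, TAtmlst)"
      "M PElement [\<theta> (0, TAtm), \<theta> (0, TAtmlst)]"
      by (simp_all add: chead_def)
    have "M PElement [X, lst As]"
      using *(1,2) by (intro model_conv[OF *(3)]) (simp add: conv_sym)
    then show ?thesis using Cons.IH by simp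
  qed
next
  case Nil
  then obtain c \<theta> where c: "c \<in> D" and head: "fm_conv (Atom PElement [X, lnil]) (fm_sub \<theta> (chead c))"
    by (auto simp: model_def)
  have "cprd c = PElement" using head by (simp add: chead_def)
  then have "c \<in> D_list"
    using c fixed by (auto simp: base_def_def D_nat_def D_intuit_def D_prog_def Let_def)
  then show ?case using head by (auto simp: D_list_def Let_def chead_def)
qed

lemma model_prog:
  assumes "M PProg [A, b]"
  obtains xs A0 G0 \<sigma> where "(xs, A0, G0) \<in> set prg" "is_sub cs \<sigma>" "A \<approx> tsub \<sigma> A0" "b \<approx> tsub \<sigma> G0"
proof -
  from assms obtain c \<theta> where c: "c \<in> D" and \<theta>: "is_sub cs \<theta>"
    and head: "fm_conv (Atom PProg [A, b]) (fm_sub \<theta> (chead c))"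
    by (auto simp: model_def)
  have "cprd c = PProg" using head by (simp add: chead_def)
  then have "c \<in> D_prog prg"
    using c fixed by (auto simp: base_def_def D_nat_def D_list_def D_intuit_def Let_def)
  then show thesis using that \<theta> head by (auto simp: D_prog_def chead_def)
qed

text \<open>List and goal vary in the induction, since implications extend the list and backchaining
  replaces the goal. The invariant is \<open>goal\<close> and not normality, because the goals
  reached by instantiation need not be normal.\<close>

lemma model_seq_nj:
  assumes "M PSeq [num n, lst As, G]" "goal G" "wt cs [] G TPrp" "\<forall>A \<in> set As. wt cs [] A TAtm"
  shows "nj cs (ctx As) (prp_trans_nf G)"
  using assms
proof (induction n arbitrary: As G rule: less_induct)
  case (less n)
  have wff: "\<forall>F \<in> ctx As. owff cs [] F" using less.prems(4) wff_prog_theory by auto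
  have IH: "nj cs (ctx As') (prp_trans_nf G')"
    if "num n \<approx> succ I" "M PSeq [I, L, B]" "L \<approx> lst As'" "B \<approx> G'" "goal G'" "wt cs [] G' TPrp"
      "\<forall>A \<in> set As'. wt cs [] A TAtm" for I L B As' G'
  proof -
    from that(1) obtain m where m: "n = Suc m" "num m \<approx> I" by (auto simp: num_conv_succ)
    then have "M PSeq [num m, lst As', G']"
      using that(3,4) by (intro model_conv[OF that(2)]) (simp add: conv_sym)
    then show ?thesis using less.IH m(1) that(5-7) by blast
  qed
  from less.prems(1) show ?case
  proof (cases rule: model_seqE)
    case (init A A' L')
    from less.prems(2) init(2) obtain A0 where G: "G = Con CAtom \<cdot> A0" "A0 \<approx> A" by (cases rule: goal.cases) auto
    obtain A1 where A1: "A1 \<in> set As" "A \<approx> A1" using model_element[OF init(3)] by blast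
    then have "nj cs (ctx As) (oatom A1)" using wff by (intro nj_assm) auto
    moreover have "A0 \<approx> A1" using G(2) A1(2) by (rule conv_trans)
    then have "fm_conv (oatom A1) (oatom A0)" using conv_sym by simp
    moreover have "owff cs [] (oatom A0)" using less.prems(3) G(1) by auto
    ultimately show ?thesis using G(1) nj_conv by fastforce
  next
    case tt
    from less.prems(2) tt have "G = Con CTt" by (cases rule: goal.cases) auto
    then show ?thesis using wff by (simp add: nj_topI)
  next
    case ("and" I B1 B2)
    from less.prems(2) "and"(2) obtain G1 G2 where G: "G = Con CAnd \<cdot> G1 \<cdot> G2" "B1 \<approx> G1" "B2 \<approx> G2" "goal G1" "goal G2" by (cases rule: goal.cases) (auto intro: conv_sym)
    then have "wt cs [] G1 TPrp" "wt cs [] G2 TPrp" using less.prems(3) by auto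
    then have "nj cs (ctx As) (prp_trans_nf G1)" "nj cs (ctx As) (prp_trans_nf G2)"
      using "and" G less.prems(4) conv_refl by (blast intro: IH)+
    then show ?thesis using G(1) by (simp add: nj_andI)
  next
    case (imp I A B1)
    from less.prems(2) imp(2) obtain A0 G1 where G: "G = Con CImp \<cdot> A0 \<cdot> G1" "A \<approx> A0" "B1 \<approx> G1" "goal G1" by (cases rule: goal.cases) (auto intro: conv_sym)
    then have "wt cs [] G1 TPrp" "wt cs [] A0 TAtm" using less.prems(3) by auto
    then have "nj cs (ctx (A0 # As)) (prp_trans_nf G1)"
      using G less.prems(4) by (intro IH[OF imp(1,3)]) (auto simp: conv_refl)
    then show ?thesis using G(1) by (simp add: nj_impI)
  next
    case (all I F)
    from less.prems(2) all(2) obtain G1 where G: "G = Con CAll \<cdot> Lam G1" "F \<approx> Lam G1" "goal G1" by (cases rule: goal.cases) (auto intro: conv_sym)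
    then have wt: "wt cs [TI] G1 TPrp" using less.prems(3) by auto
    \<comment> \<open>The fresh variable is an element of the domain, so truth of the universal body
      includes its generic instance, as \<open>nj_allI\<close> requires.\<close>
    obtain y where y: "(y, TI) \<notin> \<Union> (fm_fv ` ctx As) \<union> fm_fv (prp_trans_nf G1)"
      using ex_fresh[of "\<Union> (fm_fv ` ctx As) \<union> fm_fv (prp_trans_nf G1)" TI] finite_prog_theory by auto
    let ?y = "Var (y, TI)"
    have "F \<cdot> ?y \<approx> inst G1 ?y 0" using G(2) conv_App conv_beta conv_refl conv_trans by blast
    moreover have "wt cs [] (inst G1 ?y 0) TPrp" using wt by (rule wt_inst_0) simp
    moreover have "M PSeq [I, lst As, F \<cdot> ?y]" by (rule all(3)) simp
    ultimately have "nj cs (ctx As) (prp_trans_nf (inst G1 ?y 0))"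
      using goal_inst[OF G(3)] all(1) less.prems(4) conv_refl by (blast intro: IH)
    then have "nj cs (ctx As) (All TI (prp_trans_nf G1))"
      using goal_inst[OF G(3)] y goal_wff[OF G(3) wt] by (intro nj_allI) auto
    then show ?thesis using G(1) by simp
  next
    case (prog I A b)
    from less.prems(2) prog(2) obtain A0 where G: "G = Con CAtom \<cdot> A0" "A0 \<approx> A" by (cases rule: goal.cases) auto
    obtain xs A1 G1 \<sigma> where clause: "(xs, A1, G1) \<in> set prg" "is_sub cs \<sigma>"
      "A \<approx> tsub \<sigma> A1" "b \<approx> tsub \<sigma> G1"
      using model_prog[OF prog(3)] by blast
    have pc: "is_prog_clause cs (xs, A1, G1)" using prg clause(1) by blast
    note pcs = prog_clause_goal[OF sig pc] prog_clause_wt[OF sig pc] prog_clause_fv[OF sig pc]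
    \<comment> \<open>The witness \<open>b\<close> is an arbitrary term; it is exchanged for a
      convertible one of known shape, to which the induction hypothesis applies.\<close>
    have "b \<approx> tsub \<sigma> (nf G1)"
      using clause(4) conv_tsub_left[OF is_sub_lc[OF clause(2)] prog_clause_conv[OF sig pc]]
      by (rule conv_trans)
    moreover have "wt cs [] (tsub \<sigma> (nf G1)) TPrp" using clause(2) pcs(4) by (rule wt_is_sub)
    ultimately have body: "nj cs (ctx As) (prp_trans_nf (tsub \<sigma> (nf G1)))"
      using goal_tsub[OF pcs(1)] prog(1,4) less.prems(4) conv_refl by (blast intro: IH)
    have "nj cs (ctx As) (close_all xs (Imp (prp_trans G1) (oatom A1)))"
      using wff clause(1) by (intro nj_assm) (auto simp: prog_theory_def)
    then have "nj cs (ctx As) (fm_sub \<sigma> (Imp (prp_trans G1) (oatom A1)))"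
      using clause(2) pcs(5) by (rule nj_close_all_inst)
    then have "nj cs (ctx As) (oatom (tsub \<sigma> A1))"
      using body goal_tsub[OF pcs(1), of \<sigma>] by (auto simp: prp_trans_def intro: nj_impE)
    moreover have "A0 \<approx> tsub \<sigma> A1" using G(2) clause(3) by (rule conv_trans)
    then have "fm_conv (oatom (tsub \<sigma> A1)) (oatom A0)" using conv_sym by simp
    moreover have "owff cs [] (oatom A0)" using less.prems(3) G(1) by auto
    ultimately show ?thesis using G(1) nj_conv by fastforce
  qed
qed

end

section \<open>From intuitionistic provability to backchaining\<close>

text \<open>
  The infinitary rule for the universal quantifier makes weakening of the context immediate.
\<close>

inductive bc ::
  "('b, 'c) csig \<Rightarrow> ('b, 'c) prog_clause list \<Rightarrow> ('b, 'c) tm list \<Rightarrow> ('b, 'c) tm \<Rightarrow> bool"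
  for cs :: "('b, 'c) csig" and prg :: "('b, 'c) prog_clause list" where
  bc_init: "A' \<in> set As \<Longrightarrow> A \<approx> A' \<Longrightarrow> bc cs prg As (Con CAtom \<cdot> A)"
| bc_tt: "bc cs prg As (Con CTt)"
| bc_and: "bc cs prg As B \<Longrightarrow> bc cs prg As C \<Longrightarrow> bc cs prg As (Con CAnd \<cdot> B \<cdot> C)"
| bc_imp: "bc cs prg (A # As) B \<Longrightarrow> bc cs prg As (Con CImp \<cdot> A \<cdot> B)"
| bc_all: "(\<And>t. wt cs [] t TI \<Longrightarrow> bc cs prg As (inst G t 0)) \<Longrightarrow> bc cs prg As (Con CAll \<cdot> Lam G)"
| bc_prog: "(xs, A0, G0) \<in> set prg \<Longrightarrow> is_sub cs \<sigma> \<Longrightarrow> A \<approx> tsub \<sigma> A0 \<Longrightarrow>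
    bc cs prg As (tsub \<sigma> (nf G0)) \<Longrightarrow> bc cs prg As (Con CAtom \<cdot> A)"

lemma bc_mono: "bc cs prg As G \<Longrightarrow> set As \<subseteq> set As' \<Longrightarrow> bc cs prg As' G"
proof (induction arbitrary: As' rule: bc.induct)
  case (bc_imp A As B)
  have "bc cs prg (A # As') B" using bc_imp.prems by (intro bc_imp.IH) auto
  then show ?case by (rule bc.bc_imp)
qed (auto intro: bc.intros)

lemma bc_atom_conv:
  assumes "bc cs prg As (Con CAtom \<cdot> A)" "A \<approx> A'"
  shows "bc cs prg As (Con CAtom \<cdot> A')"
  using assms(1)
proof (cases rule: bc.cases)
  case (bc_init A1)
  then show ?thesis using bc.bc_init conv_trans[OF conv_sym[OF assms(2)]] by blast
next
  case (bc_prog xs A0 G0 \<sigma>)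
  then show ?thesis using bc.bc_prog conv_trans[OF conv_sym[OF assms(2)]] by blast
qed

abbreviation atoms :: "('b, 'c) csig \<Rightarrow> ('b, 'c) tm list \<Rightarrow> bool" where
  "atoms cs As \<equiv> \<forall>A \<in> set As. wt cs [] A TAtm"

text \<open>Kripke forcing: the worlds are contexts, and the terms form a constant domain.\<close>

function forces ::
  "('b, 'c) csig \<Rightarrow> ('b, 'c) prog_clause list \<Rightarrow> ('b, 'c) tm list \<Rightarrow> ('b, 'c) ofm \<Rightarrow> bool" where
  "forces cs prg As (Atom p ts) \<longleftrightarrow> (\<exists>A. ts = [A] \<and> bc cs prg As (Con CAtom \<cdot> A))"
| "forces cs prg As Bot \<longleftrightarrow> False"
| "forces cs prg As Top \<longleftrightarrow> True"
| "forces cs prg As (And F G) \<longleftrightarrow> forces cs prg As F \<and> forces cs prg As G"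
| "forces cs prg As (Or F G) \<longleftrightarrow> forces cs prg As F \<or> forces cs prg As G"
| "forces cs prg As (Imp F G) \<longleftrightarrow> (\<forall>As'. atoms cs As' \<longrightarrow> set As \<subseteq> set As' \<longrightarrow>
     forces cs prg As' F \<longrightarrow> forces cs prg As' G)"
| "forces cs prg As (All a F) \<longleftrightarrow> (\<forall>t. wt cs [] t a \<longrightarrow> forces cs prg As F\<lparr>t\<rparr>)"
| "forces cs prg As (Ex a F) \<longleftrightarrow> (\<exists>t. wt cs [] t a \<and> forces cs prg As F\<lparr>t\<rparr>)"
  by pat_completeness auto
termination by (relation "measure (\<lambda>(cs, prg, As, F). fsize F)") auto

lemma forces_mono: "forces cs prg As F \<Longrightarrow> set As \<subseteq> set As' \<Longrightarrow> forces cs prg As' F"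
proof (induction F rule: measure_induct_rule[where f = fsize])
  case (less F)
  show ?case
  proof (cases F)
    case (Atom p ts)
    then show ?thesis using less.prems bc_mono by auto
  next
    case (All a G)
    then show ?thesis using less.IH[of "G\<lparr>_\<rparr>"] less.prems by auto
  next
    case (Ex a G)
    then show ?thesis using less.IH[of "G\<lparr>_\<rparr>"] less.prems by auto
  next
    case (Imp G H)
    then show ?thesis using less.prems by auto
  qed (use less in auto)
qed

lemma forces_conv: "fm_conv F G \<Longrightarrow> forces cs prg As F \<longleftrightarrow> forces cs prg As G"
proof (induction F arbitrary: G As rule: measure_induct_rule[where f = fsize])
  case (less F)
  show ?case
  proof (cases F)
    case (Atom p ts)
    with less.prems obtain us where "G = Atom p us" "list_all2 (\<approx>) ts us"
      by (auto elim: fm_conv_AtomE)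
    moreover have "bc cs prg As (Con CAtom \<cdot> A) \<longleftrightarrow> bc cs prg As (Con CAtom \<cdot> A')" if "A \<approx> A'" for A A'
      using that bc_atom_conv conv_sym by blast
    ultimately show ?thesis using Atom by (auto simp: list_all2_Cons1 list_all2_Cons2)
  next
    case (And F1 F2)
    with less show ?thesis by (auto elim!: fm_conv_AndE)
  next
    case (Or F1 F2)
    with less show ?thesis by (auto elim!: fm_conv_OrE)
  next
    case (Imp F1 F2)
    with less show ?thesis by (auto elim!: fm_conv_ImpE)
  next
    case (All a F1)
    with less.prems obtain G1 where "G = All a G1" "fm_conv F1 G1" by (auto elim: fm_conv_AllE)
    moreover then have "forces cs prg As F1\<lparr>t\<rparr> \<longleftrightarrow> forces cs prg As G1\<lparr>t\<rparr>" for t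
      using All by (intro less.IH fm_conv_inst_left) auto
    ultimately show ?thesis using All by simp
  next
    case (Ex a F1)
    with less.prems obtain G1 where "G = Ex a G1" "fm_conv F1 G1" by (auto elim: fm_conv_ExE)
    moreover then have "forces cs prg As F1\<lparr>t\<rparr> \<longleftrightarrow> forces cs prg As G1\<lparr>t\<rparr>" for t
      using Ex by (intro less.IH fm_conv_inst_left) auto
    ultimately show ?thesis using Ex by simp
  qed (use less.prems in \<open>auto elim: fm_conv.cases\<close>)
qed

text \<open>A derivation may pass through arbitrary formulas, hence \<open>forces\<close> interprets
  all connectives although goals and program clauses use few of them. \<open>As\<close> varies
  because an implication looks at larger worlds, \<open>\<theta>\<close> because of
  eigenvariables.\<close>

theorem nj_sound:
  "nj cs \<Gamma> F \<Longrightarrow> is_sub cs \<theta> \<Longrightarrow> atoms cs As \<Longrightarrow> \<forall>G \<in> \<Gamma>. forces cs prg As (fm_sub \<theta> G) \<Longrightarrow>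
   forces cs prg As (fm_sub \<theta> F)"
proof (induction arbitrary: \<theta> As rule: nj.induct)
  case (nj_conv \<Gamma> F G)
  have "fm_conv (fm_sub \<theta> F) (fm_sub \<theta> G)"
    using is_sub_lc[OF nj_conv.prems(1)] nj_conv.hyps(2) by (rule fm_conv_sub_left)
  then show ?case using nj_conv.IH[OF nj_conv.prems] forces_conv by blast
next
  case (nj_orE \<Gamma> F G H)
  from nj_orE.IH(1)[OF nj_orE.prems] show ?case
    using nj_orE.IH(2,3)[OF nj_orE.prems(1,2)] nj_orE.prems(3) by auto
next
  case (nj_impI F \<Gamma> G)
  have "forces cs prg As' (fm_sub \<theta> G)"
    if "atoms cs As'" "set As \<subseteq> set As'" "forces cs prg As' (fm_sub \<theta> F)" for As'
    using that nj_impI.prems(3) forces_mono by (intro nj_impI.IH nj_impI.prems(1)) blast+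
  then show ?case by simp
next
  case (nj_impE \<Gamma> F G)
  have "forces cs prg As (Imp (fm_sub \<theta> F) (fm_sub \<theta> G))" using nj_impE.IH(1)[OF nj_impE.prems] by simp
  then show ?case using nj_impE.IH(2)[OF nj_impE.prems] nj_impE.prems(2) by (metis forces.simps(6) subset_refl)
next
  case (nj_allI \<Gamma> F y a)
  have "forces cs prg As (fm_sub \<theta> F)\<lparr>t\<rparr>" if t: "wt cs [] t a" for t
  proof -
    define \<theta>' where "\<theta>' = \<theta>((y, a) := t)"
    have "is_sub cs \<theta>'" unfolding \<theta>'_def using nj_allI.prems(1) t by (intro is_sub_upd) auto
    moreover have "fm_sub \<theta>' G = fm_sub \<theta> G" if "G \<in> \<Gamma>" for G
      unfolding \<theta>'_def using that nj_allI.hyps(2) by (intro fm_sub_cong) auto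
    ultimately have "forces cs prg As (fm_sub \<theta>' F\<lparr>Var (y, a)\<rparr>)"
      using nj_allI.prems by (intro nj_allI.IH) auto
    also have "fm_sub \<theta>' F\<lparr>Var (y, a)\<rparr> = (fm_sub \<theta> F)\<lparr>t\<rparr>"
      unfolding \<theta>'_def using nj_allI.hyps(2) nj_allI.prems(1) t
      by (intro fm_sub_upd_inst_Var) (auto intro: is_sub_lc wt_lc)
    finally show ?thesis .
  qed
  then show ?case by simp
next
  case (nj_allE \<Gamma> a F t)
  have "forces cs prg As (All a (fm_sub \<theta> F))" using nj_allE.IH[OF nj_allE.prems] by simp
  then have "forces cs prg As (fm_sub \<theta> F)\<lparr>tsub \<theta> t\<rparr>"
    using wt_is_sub[OF nj_allE.prems(1) nj_allE.hyps(2)] by simp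
  then show ?case using nj_allE.prems(1) by (simp add: fm_sub_inst is_sub_lc)
next
  case (nj_exI \<Gamma> F t a)
  have "forces cs prg As (fm_sub \<theta> F)\<lparr>tsub \<theta> t\<rparr>"
    using nj_exI.IH[OF nj_exI.prems] nj_exI.prems(1) by (simp add: fm_sub_inst is_sub_lc)
  then show ?case using wt_is_sub[OF nj_exI.prems(1) nj_exI.hyps(2)] by auto
next
  case (nj_exE \<Gamma> a F y G)
  have "forces cs prg As (Ex a (fm_sub \<theta> F))" using nj_exE.IH(1)[OF nj_exE.prems] by simp
  then obtain t where t: "wt cs [] t a" "forces cs prg As (fm_sub \<theta> F)\<lparr>t\<rparr>" by auto
  define \<theta>' where "\<theta>' = \<theta>((y, a) := t)"
  have "is_sub cs \<theta>'" unfolding \<theta>'_def using nj_exE.prems(1) t by (intro is_sub_upd) auto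
  moreover have eq: "fm_sub \<theta>' H = fm_sub \<theta> H" if "H \<in> \<Gamma> \<or> H = G" for H
    unfolding \<theta>'_def using that nj_exE.hyps(3) by (intro fm_sub_cong) auto
  moreover have "fm_sub \<theta>' F\<lparr>Var (y, a)\<rparr> = (fm_sub \<theta> F)\<lparr>t\<rparr>"
    unfolding \<theta>'_def using nj_exE.hyps(3) nj_exE.prems(1) t
    by (intro fm_sub_upd_inst_Var) (auto intro: is_sub_lc wt_lc)
  ultimately have "forces cs prg As (fm_sub \<theta>' G)" using nj_exE.prems t by (intro nj_exE.IH(2)) auto
  then show ?case using eq by simp
qed auto

text \<open>
  One direction suffices, since the antecedents of implications in goals are atoms, for which forcing
  is backchaining.
\<close>

lemma forces_goal:
  "goal G \<Longrightarrow> wt cs [] G TPrp \<Longrightarrow> atoms cs As \<Longrightarrow> forces cs prg As (prp_trans_nf G) \<Longrightarrow> bc cs prg As G"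
proof (induction "fsize (prp_trans_nf G)" arbitrary: G As rule: less_induct)
  case less
  from less.prems(1) show ?case
  proof (cases rule: goal.cases)
    case (goal_atom A)
    then show ?thesis using less.prems(4) by simp
  next
    case goal_tt
    then show ?thesis by (simp add: bc_tt)
  next
    case (goal_and B C)
    then have "bc cs prg As B" "bc cs prg As C"
      using less.prems by (auto intro!: less.hyps)
    then show ?thesis using goal_and by (simp add: bc_and)
  next
    case (goal_imp B A)
    then have wt: "wt cs [] A TAtm" "wt cs [] B TPrp" using less.prems(2) by auto
    \<comment> \<open>The forced implication is used at the world extended by \<open>A\<close>,
      which forces \<open>A\<close> by the initial rule.\<close>
    have "bc cs prg (A # As) (Con CAtom \<cdot> A)" by (rule bc_init[of A]) (auto simp: conv_refl)
    moreover have "forces cs prg As (Imp (oatom A) (prp_trans_nf B))"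
      using less.prems(4) goal_imp(1) by simp
    ultimately have "forces cs prg (A # As) (prp_trans_nf B)"
      using less.prems(3) wt(1) by (auto dest!: spec[of _ "A # As"])
    then have "bc cs prg (A # As) B"
      using goal_imp wt less.prems(3) by (intro less.hyps) auto
    then show ?thesis using goal_imp by (simp add: bc_imp)
  next
    case (goal_all B)
    then have wt: "wt cs [TI] B TPrp" using less.prems(2) by auto
    have "bc cs prg As (inst B t 0)" if t: "wt cs [] t TI" for t
      using goal_inst[OF goal_all(2), of t 0] less.prems(3,4) goal_all(1) wt_inst_0[OF wt t] t
      by (intro less.hyps) auto
    then show ?thesis using goal_all by (simp add: bc_all)
  qed
qed

lemma forces_close_all:
  assumes "\<And>\<sigma>. is_sub cs \<sigma> \<Longrightarrow> forces cs prg As (fm_sub \<sigma> F)"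
  shows "is_sub cs \<theta> \<Longrightarrow> forces cs prg As (fm_sub \<theta> (close_all xs F))"
proof (induction xs arbitrary: \<theta>)
  case (Cons v vs)
  have "forces cs prg As (fm_sub \<theta> (fm_bind v (close_all vs F) 0))\<lparr>t\<rparr>" if t: "wt cs [] t (snd v)" for t
  proof -
    have "forces cs prg As (fm_sub (\<theta>(v := t)) (close_all vs F))"
      using is_sub_upd[OF Cons.prems t] by (rule Cons.IH)
    moreover have "(fm_sub \<theta> (fm_bind v (close_all vs F) 0))\<lparr>t\<rparr> = fm_sub (\<theta>(v := t)) (close_all vs F)"
      using is_sub_lc[OF Cons.prems] wt_lc[OF t] by (rule fm_inst_sub_bind)
    ultimately show ?thesis by simp
  qed
  then show ?case by simp
qed (simp add: assms)

context object_logic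
begin

lemma nj_bc:
  assumes "nj cs \<Gamma> (prp_trans_nf G)" "\<Gamma> \<subseteq> ctx As" "goal G" "wt cs [] G TPrp" "atoms cs As"
  shows "bc cs prg As G"
proof -
  have prog: "forces cs prg As (close_all xs (Imp (prp_trans G0) (oatom A0)))"
    if clause: "(xs, A0, G0) \<in> set prg" for xs A0 G0
  proof -
    have pc: "is_prog_clause cs (xs, A0, G0)" using prg clause by blast
    have "forces cs prg As (fm_sub \<sigma> (Imp (prp_trans G0) (oatom A0)))" if \<sigma>: "is_sub cs \<sigma>" for \<sigma>
    proof -
      \<comment> \<open>At any larger world that forces the clause body, \<open>forces_goal\<close>
        turns forcing into a backchaining proof, and \<open>bc_prog\<close> adds the step to the
        head.\<close>
      have "bc cs prg As' (Con CAtom \<cdot> tsub \<sigma> A0)"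
        if "atoms cs As'" "forces cs prg As' (fm_sub \<sigma> (prp_trans_nf (nf G0)))" for As'
      proof (rule bc_prog[OF clause \<sigma> conv_refl])
        show "bc cs prg As' (tsub \<sigma> (nf G0))"
          using that goal_tsub[OF prog_clause_goal[OF sig pc], of \<sigma>]
            wt_is_sub[OF \<sigma> prog_clause_wt(3)[OF sig pc]]
          by (intro forces_goal) auto
      qed
      then show ?thesis by (simp add: prp_trans_def)
    qed
    from forces_close_all[OF this is_sub_Var] show ?thesis by simp
  qed
  have "forces cs prg As (oatom A)" if "A \<in> set As" for A
    using bc_init[OF that conv_refl] by simp
  with prog assms(2) have "\<forall>F \<in> \<Gamma>. forces cs prg As (fm_sub Var F)"
    by (auto simp: prog_theory_def)
  from nj_sound[OF assms(1) is_sub_Var assms(5) this] have "forces cs prg As (prp_trans_nf G)" by simp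
  then show ?thesis using assms(3-5) by (intro forces_goal)
qed

end

section \<open>From backchaining to derivability\<close>

lemma wf_seq_empty: "wf_seq cs qs {#} F \<longleftrightarrow> wff cs (prd_ty qs) [] F"
  by (simp add: wf_seq_def)

context object_logic
begin

lemma derivable_defR:
  assumes "Clause p ts F \<in> base_def prg" "is_sub cs \<theta>" "list_all2 (\<approx>) us (map (tsub \<theta>) ts)"
    "derivable cs qs D {#} (fm_sub \<theta> F)" "wff cs (prd_ty qs) [] (Atom p us)"
  shows "derivable cs qs D {#} (Atom p us)"
  using assms base by (intro defR[of "Clause p ts F"]) (auto simp: chead_def wf_seq_empty)

lemma derivable_num: "derivable cs qs D {#} (Atom PNat [num n])"
  by (induction n) (auto intro!: natZ natS simp: wf_seq_def)

lemma derivable_element: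
  assumes "A \<in> set As" "X \<approx> A" "wt cs [] X TAtm" "atoms cs As"
  shows "derivable cs qs D {#} (Atom PElement [X, lst As])"
  using assms(1,4)
proof (induction As)
  case (Cons B As)
  note wt = Cons.prems(2)[simplified]
  have wff: "wff cs (prd_ty qs) [] (Atom PElement [X, lst (B # As)])"
    using assms(3) wt by (simp add: wt_App_iff wt_lst)
  show ?case
  proof (cases "X \<approx> B")
    case True
    \<comment> \<open>A variable is a number together with a type, so equal numbers at different
      types denote different variables and the updates do not interfere.\<close>
    let ?\<theta> = "Var((0, TAtm) := X, (0, TAtmlst) := lst As)"
    have "is_sub cs ?\<theta>" using assms(3) wt by (intro is_sub_upd is_sub_Var) (auto simp: wt_lst)
    then show ?thesis
      using True wff
      by (intro derivable_defR[of PElement "[Var (0, TAtm), lcons (Var (0, TAtm)) (Var (0, TAtmlst))]" Top ?\<theta>])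
        (auto simp: base_def_def D_list_def Let_def conv_refl conv_sym wf_seq_def intro: topR)
  next
    case False
    with Cons.prems assms(2) have "A \<in> set As" by auto
    then have "derivable cs qs D {#} (Atom PElement [X, lst As])" using Cons.IH wt by blast
    moreover let ?\<theta> = "Var((0, TAtm) := X, (1, TAtm) := B, (0, TAtmlst) := lst As)"
    have "is_sub cs ?\<theta>" using assms(3) wt by (intro is_sub_upd is_sub_Var) (auto simp: wt_lst)
    ultimately show ?thesis
      using wff
      by (intro derivable_defR[of PElement "[Var (0, TAtm), lcons (Var (1, TAtm)) (Var (0, TAtmlst))]"
            "Atom PElement [Var (0, TAtm), Var (0, TAtmlst)]" ?\<theta>])
        (auto simp: base_def_def D_list_def Let_def conv_refl)
  qed
qed simp

end

lemma lc_num [simp]: "lc (num n)"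
  by (induction n) auto

lemma fv_num [simp]: "fv (num n) = {}"
  by (induction n) auto

context object_logic
begin

text \<open>
  Quantifying over all large heights makes the two premises of a conjunction fit together without
  a separate monotonicity argument.
\<close>

lemma bc_derivable:
  assumes "bc cs prg As G" "wt cs [] G TPrp" "atoms cs As"
  shows "\<exists>n. \<forall>m \<ge> n. derivable cs qs D {#} (Atom PSeq [num m, lst As, G])"
  using assms
proof (induction rule: bc.induct)
  case (bc_init A' As A)
  then obtain A1 As1 where As: "As = A1 # As1" by (cases As) auto
  have wt: "wt cs [] A TAtm" using bc_init.prems(1) by auto
  have "derivable cs qs D {#} (Atom PSeq [num m, lst As, Con CAtom \<cdot> A])" for m
  proof -
    let ?\<theta> = "Var((0, TNt) := num m, (0, TAtmlst) := lst As1, (1, TAtm) := A1, (0, TAtm) := A)"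
    have "is_sub cs ?\<theta>"
      using bc_init.prems(2) wt As by (intro is_sub_upd is_sub_Var) (auto simp: wt_lst)
    moreover have "derivable cs qs D {#} (Atom PElement [A, lst As])"
      using bc_init.hyps wt bc_init.prems(2) by (rule derivable_element)
    ultimately show ?thesis using bc_init.prems As
      by (intro derivable_defR[of PSeq
            "[Var (0, TNt), lcons (Var (1, TAtm)) (Var (0, TAtmlst)), Con CAtom \<cdot> Var (0, TAtm)]"
            "Atom PElement [Var (0, TAtm), lcons (Var (1, TAtm)) (Var (0, TAtmlst))]" ?\<theta>])
        (auto simp: base_def_def D_intuit_def Let_def conv_refl wt_lst wt_App_iff)
  qed
  then show ?case by blast
next
  case (bc_tt As)
  have "derivable cs qs D {#} (Atom PSeq [num m, lst As, Con CTt])" for m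
  proof -
    let ?\<theta> = "Var((0, TNt) := num m, (0, TAtmlst) := lst As)"
    have "is_sub cs ?\<theta>"
      using bc_tt.prems(2) by (intro is_sub_upd is_sub_Var) (auto simp: wt_lst)
    then show ?thesis using bc_tt.prems
      by (intro derivable_defR[of PSeq "[Var (0, TNt), Var (0, TAtmlst), Con CTt]" Top ?\<theta>])
        (auto simp: base_def_def D_intuit_def Let_def conv_refl wt_lst wf_seq_def intro: topR)
  qed
  then show ?case by blast
next
  case (bc_and As B C)
  have wt: "wt cs [] B TPrp" "wt cs [] C TPrp" using bc_and.prems(1) by auto
  obtain n1 n2 where n: "\<forall>m \<ge> n1. derivable cs qs D {#} (Atom PSeq [num m, lst As, B])"
    "\<forall>m \<ge> n2. derivable cs qs D {#} (Atom PSeq [num m, lst As, C])"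
    using bc_and.IH wt bc_and.prems(2) by blast
  have "derivable cs qs D {#} (Atom PSeq [num m, lst As, Con CAnd \<cdot> B \<cdot> C])" if "m \<ge> Suc (max n1 n2)" for m
  proof -
    from that obtain k where k: "m = Suc k" "k \<ge> n1" "k \<ge> n2" by (cases m) auto
    let ?\<theta> = "Var((0, TNt) := num k, (0, TAtmlst) := lst As, (0, TPrp) := B, (1, TPrp) := C)"
    have "is_sub cs ?\<theta>"
      using bc_and.prems(2) wt by (intro is_sub_upd is_sub_Var) (auto simp: wt_lst)
    then show ?thesis using bc_and.prems k n
      by (intro derivable_defR[of PSeq
            "[succ (Var (0, TNt)), Var (0, TAtmlst), Con CAnd \<cdot> Var (0, TPrp) \<cdot> Var (1, TPrp)]"
            "And (Atom PSeq [Var (0, TNt), Var (0, TAtmlst), Var (0, TPrp)])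
              (Atom PSeq [Var (0, TNt), Var (0, TAtmlst), Var (1, TPrp)])" ?\<theta>])
        (auto simp: base_def_def D_intuit_def Let_def conv_refl wt_lst wt_App_iff intro: andR)
  qed
  then show ?case by blast
next
  case (bc_imp A As B)
  have wt: "wt cs [] A TAtm" "wt cs [] B TPrp" using bc_imp.prems(1) by auto
  obtain n where n: "\<forall>m \<ge> n. derivable cs qs D {#} (Atom PSeq [num m, lst (A # As), B])"
    using bc_imp.IH wt bc_imp.prems(2) by auto
  have "derivable cs qs D {#} (Atom PSeq [num m, lst As, Con CImp \<cdot> A \<cdot> B])" if "m \<ge> Suc n" for m
  proof -
    from that obtain k where k: "m = Suc k" "k \<ge> n" by (cases m) auto
    let ?\<theta> = "Var((0, TNt) := num k, (0, TAtmlst) := lst As, (0, TAtm) := A, (0, TPrp) := B)"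
    have "is_sub cs ?\<theta>"
      using bc_imp.prems(2) wt by (intro is_sub_upd is_sub_Var) (auto simp: wt_lst)
    then show ?thesis using bc_imp.prems k n
      by (intro derivable_defR[of PSeq
            "[succ (Var (0, TNt)), Var (0, TAtmlst), Con CImp \<cdot> Var (0, TAtm) \<cdot> Var (0, TPrp)]"
            "Atom PSeq [Var (0, TNt), lcons (Var (0, TAtm)) (Var (0, TAtmlst)), Var (0, TPrp)]" ?\<theta>])
        (auto simp: base_def_def D_intuit_def Let_def conv_refl wt_lst wt_App_iff)
  qed
  then show ?case by blast
next
  case (bc_all As G)
  have wt: "wt cs [] (Lam G) (TI \<rightarrow>\<^sub>t TPrp)" "wt cs [TI] G TPrp"
    using bc_all.prems(1) by (auto simp: wt_Lam_iff)
  \<comment> \<open>Among the infinitely many premises only the one at a fresh variable is used. It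
    supplies a single height, whereas the heights for all instances together might be
    unbounded.\<close>
  obtain y where y: "(y, TI) \<notin> fv (lst As) \<union> fv G"
    using ex_fresh[of "fv (lst As) \<union> fv G" TI] by auto
  let ?y = "Var (y, TI)"
  have "wt cs [] (inst G ?y 0) TPrp" using wt(2) by (rule wt_inst_0) simp
  then obtain n where n: "\<forall>m \<ge> n. derivable cs qs D {#} (Atom PSeq [num m, lst As, inst G ?y 0])"
    using bc_all.IH[of ?y] bc_all.prems(2) by auto
  have "derivable cs qs D {#} (Atom PSeq [num m, lst As, Con CAll \<cdot> Lam G])" if "m \<ge> Suc n" for m
  proof -
    from that obtain k where k: "m = Suc k" "k \<ge> n" by (cases m) auto
    let ?B = "Atom PSeq [num k, lst As, Lam G \<cdot> Bnd 0]"
    have wt_As: "wt cs E (lst As) TAtmlst" for E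
      using bc_all.prems(2) by (auto simp: wt_lst intro: wt_weaken_Nil)
    have "lc (lst As)" "lc (Lam G)" by (rule wt_lc[OF wt_As] wt_lc[OF wt(1)])+
    then have B: "?B\<lparr>?y\<rparr> = Atom PSeq [num k, lst As, Lam G \<cdot> ?y]" by (simp del: inst.simps(5))
    \<comment> \<open>The clause for the universal quantifier applies its matrix to the bound
      variable, which leaves a beta redex here; the rule \<open>conv\<close> bridges it.\<close>
    have "derivable cs qs D {#} ?B\<lparr>?y\<rparr>"
    proof (rule derivable.conv)
      show "derivable cs qs D {#} (Atom PSeq [num k, lst As, inst G ?y 0])" using n k(2) by blast
      show "fm_conv (Atom PSeq [num k, lst As, inst G ?y 0]) ?B\<lparr>?y\<rparr>"
        unfolding B by (simp add: conv_refl conv_sym[OF conv_beta])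
      show "wf_seq cs qs {#} ?B\<lparr>?y\<rparr>"
        unfolding B using wt_As wt(1) by (auto simp: wf_seq_empty wt_App_iff)
    qed (simp add: rel_mset_Zero)
    moreover have "wff cs (prd_ty qs) [] (All TI ?B)"
      using wt_As wt_weaken_Nil[OF wt(1), of "[TI]"] by (auto simp: wt_App_iff)
    ultimately have "derivable cs qs D {#} (All TI ?B)"
      using y by (intro allR) (auto simp: mfv_def wf_seq_empty)
    moreover let ?\<theta> = "Var((0, TNt) := num k, (0, TAtmlst) := lst As, (0, TI \<rightarrow>\<^sub>t TPrp) := Lam G)"
    have "is_sub cs ?\<theta>"
      using wt wt_As by (intro is_sub_upd is_sub_Var) auto
    ultimately show ?thesis using bc_all.prems k wt_As
      by (intro derivable_defR[of PSeq
            "[succ (Var (0, TNt)), Var (0, TAtmlst), Con CAll \<cdot> Var (0, TI \<rightarrow>\<^sub>t TPrp)]"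
            "All TI (Atom PSeq [Var (0, TNt), Var (0, TAtmlst), Var (0, TI \<rightarrow>\<^sub>t TPrp) \<cdot> Bnd 0])" ?\<theta>])
        (auto simp: base_def_def D_intuit_def Let_def conv_refl wt_App_iff)
  qed
  then show ?case by blast
next
  case (bc_prog xs A0 G0 \<sigma> A As)
  have wt: "wt cs [] A TAtm" using bc_prog.prems(1) by auto
  have pc: "is_prog_clause cs (xs, A0, G0)" using prg bc_prog.hyps(1) by blast
  let ?G = "tsub \<sigma> (nf G0)"
  have wt_G: "wt cs [] ?G TPrp" using bc_prog.hyps(2) prog_clause_wt(3)[OF sig pc] by (rule wt_is_sub)
  obtain n where n: "\<forall>m \<ge> n. derivable cs qs D {#} (Atom PSeq [num m, lst As, ?G])"
    using bc_prog.IH wt_G bc_prog.prems(2) by auto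
  \<comment> \<open>The existential witness \<open>?G\<close> is an instance of the normal form of
    the clause body, whereas the clause itself mentions \<open>G0\<close>; matching up to conversion
    in \<open>defR\<close> absorbs the difference.\<close>
  have "tsub \<sigma> G0 \<approx> ?G"
    using is_sub_lc[OF bc_prog.hyps(2)] prog_clause_conv[OF sig pc] by (rule conv_tsub_left)
  then have prog: "derivable cs qs D {#} (Atom PProg [A, ?G])"
    using bc_prog.hyps wt wt_G
    by (intro derivable_defR[of PProg "[A0, G0]" Top \<sigma>])
      (auto simp: base_def_def D_prog_def conv_sym wf_seq_empty intro: topR)
  have "derivable cs qs D {#} (Atom PSeq [num m, lst As, Con CAtom \<cdot> A])" if "m \<ge> Suc n" for m
  proof -
    from that obtain k where k: "m = Suc k" "k \<ge> n" by (cases m) auto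
    have wt_As: "wt cs E (lst As) TAtmlst" for E
      using bc_prog.prems(2) by (auto simp: wt_lst intro: wt_weaken_Nil)
    let ?B = "And (Atom PProg [A, Bnd 0]) (Atom PSeq [num k, lst As, Bnd 0])"
    have "lc (lst As)" "lc A" by (rule wt_lc[OF wt_As] wt_lc[OF wt])+
    then have "?B\<lparr>?G\<rparr> = And (Atom PProg [A, ?G]) (Atom PSeq [num k, lst As, ?G])" by simp
    then have "derivable cs qs D {#} ?B\<lparr>?G\<rparr>" using prog n k(2) by (simp add: andR)
    with wt_G have "derivable cs qs D {#} (Ex TPrp ?B)"
      using wt_As wt_weaken_Nil[OF wt] by (intro exR) (auto simp: wf_seq_empty)
    moreover let ?\<theta> = "Var((0, TNt) := num k, (0, TAtmlst) := lst As, (0, TAtm) := A)"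
    have "is_sub cs ?\<theta>"
      using wt wt_As by (intro is_sub_upd is_sub_Var) auto
    ultimately show ?thesis using bc_prog.prems k wt_As
      by (intro derivable_defR[of PSeq
            "[succ (Var (0, TNt)), Var (0, TAtmlst), Con CAtom \<cdot> Var (0, TAtm)]"
            "Ex TPrp (And (Atom PProg [Var (0, TAtm), Bnd 0])
              (Atom PSeq [Var (0, TNt), Var (0, TAtmlst), Bnd 0]))" ?\<theta>])
        (auto simp: base_def_def D_intuit_def Let_def conv_refl wt_App_iff)
  qed
  then show ?case by blast
qed

end

theorem theorem5p1:
  fixes cs :: "('b, 'c) csig" and qs :: "('b, 'q) psig"
    and prg :: "('b, 'c) prog_clause list" and D :: "('b, 'c, 'q) clause set"
    and L B :: "('b, 'c) tm"
  assumes "object_sig cs"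
    and "\<forall>c \<in> set prg. is_prog_clause cs c"
    and "is_definition cs qs D"
    and "base_def prg \<subseteq> D"
    and "\<forall>c \<in> D - base_def prg. cprd c \<notin> {PNat, PSeq, PElement, PProg}"
    and "object_term cs L TAtmlst"
    and "object_term cs B TPrp"
  shows "derivable cs qs D {#} (entails L B) \<longleftrightarrow>
         int_consequence cs (set_mset (lst_trans L) \<union> prog_theory prg) (prp_trans B)"
proof -
  interpret object_logic cs prg D
    using assms by unfold_locales
  have wt: "wt cs [] L TAtmlst" "wt cs [] B TPrp" using assms(6,7) by (auto simp: object_term_def)
  note lc = wt_lc[OF wt(1)] wt_lc[OF wt(2)]
  note conv = conv_nf[OF wt(1)] conv_nf[OF wt(2)]
  obtain As where As: "nf L = lst As" using lst_nf[OF assms(1,6)] by blast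
  have atoms: "atoms cs As" using wt_nf[OF wt(1)] As by (simp add: wt_lst)
  have goal: "goal (nf B)" using assms(1,7) by (rule goal_nf)
  have ctx: "set_mset (lst_trans L) \<union> prog_theory prg = ctx As"
    by (simp add: lst_trans_def As lst_trans_nf_lst)
  show ?thesis
  proof
    assume der: "derivable cs qs D {#} (entails L B)"
    obtain M where "definition_model cs D M" using definition_model_exists[OF assms(3)] by blast
    then interpret definition_model cs D M .
    interpret object_logic_model cs prg D M by unfold_locales
    have "tr (entails L B)" using derivable_sound[OF der is_sub_Var] by simp
    \<comment> \<open>The height in a true \<open>entails L B\<close> is an arbitrary term; truth of
      its \<open>nat\<close> atom makes it convertible to a numeral.\<close>
    then obtain t k where "M PSeq [t, L, B]" "t \<approx> num k"
      by (auto simp: entails_def lc model_nat)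
    then have "M PSeq [num k, lst As, nf B]"
      using conv As by (elim model_conv) simp
    then have "nj cs (ctx As) (prp_trans B)"
      unfolding prp_trans_def using goal wt_nf[OF wt(2)] atoms by (rule model_seq_nj)
    moreover have "finite (ctx As)" using finite_prog_theory by simp
    ultimately show "int_consequence cs (set_mset (lst_trans L) \<union> prog_theory prg) (prp_trans B)"
      unfolding int_consequence_def ctx by blast
  next
    assume "int_consequence cs (set_mset (lst_trans L) \<union> prog_theory prg) (prp_trans B)"
    then obtain \<Gamma> where "nj cs \<Gamma> (prp_trans_nf (nf B))" "\<Gamma> \<subseteq> ctx As"
      unfolding int_consequence_def ctx prp_trans_def by blast
    then have "bc cs prg As (nf B)" using goal wt_nf[OF wt(2)] atoms by (rule nj_bc)
    then obtain n where "derivable cs qs D {#} (Atom PSeq [num n, lst As, nf B])"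
      using bc_derivable[OF _ wt_nf[OF wt(2)] atoms] by blast
    \<comment> \<open>The derivation was found for the normal forms of \<open>L\<close> and
      \<open>B\<close> and is transported back by conversion.\<close>
    then have "derivable cs qs D {#} (Atom PSeq [num n, L, B])"
      by (rule derivable.conv)
        (use wt conv As in \<open>auto simp: rel_mset_Zero conv_refl conv_sym wf_seq_empty\<close>)
    with derivable_num[of qs n] have "derivable cs qs D {#} (And (Atom PNat [num n]) (Atom PSeq [num n, L, B]))"
      by (rule andR)
    moreover have "wff cs (prd_ty qs) [] (entails L B)" using wt by (simp add: entails_def)
    ultimately show "derivable cs qs D {#} (entails L B)"
      unfolding entails_def by (intro exR[of cs "num n"]) (auto simp: lc wf_seq_empty)
  qed
qed

end
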